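(* Let $n\geq 3$, $M\geq 1$ an integer, $\kappa>0$, $a_1,\dots,a_n>0$ and $P_j<Q_j$ for $j=1,\dots,n$. The solution of the equation \[ -(\Delta+\kappa^2)u({\mathbf x})=\prod_{j=1}^n \chi_{(P_j,Q_j)}(x_j)\,\eta_{2M}(a_j x_j),\qquad {\mathbf x}\in\mathbb R^n, \] can be expressed by the one-dimensional integral \[ u({\mathbf x})=i \int_0^\infty e^{i \kappa^2 t}\prod_{j=1}^{n} \Big(\Psi_M( a_j x_j, 4i a_j^2 t, a_j P_j)-\Psi_M( a_j x_j,4 i a_j^2 t, a_j Q_j)\Big)\,dt, \] where \[ \Psi_M(x,t,y)=\frac{1}{2\sqrt{\pi}}\, e^{- x^2/(1+t)}\Bigg(\operatorname{erfc}\big(F(x,t,y)\big)\, \mathcal P_M(x,t) - \frac{e^{-F^2(x,t,y)}}{\sqrt{\pi} }\, \mathcal Q_M(x,t,y)\Bigg), \] \[ F(x,t,y)=\sqrt{\frac{t+1}{t}} \left(y-\frac{x}{t+1}\right),\qquad \mathcal P_M(x,t)=\sum_{s=0}^{M-1} \frac{(-1)^s}{s!\, 4^s } \frac{1}{(1+ t)^{s+1/2}} H_{2s}\left(\frac{ x}{\sqrt{1+ t}}\right), \] $\mathcal Q_1(x,t,y)=0$, and for $M>1$ \[ \mathcal Q_M(x,t,y) =2\sum_{k=1}^{M-1} \frac{(-1)^k}{k! \, 4^k}\sum_{\ell=1}^{2k}\frac{(-1)^{\ell}}{t^{\ell/2}}\bigg( H_{2k-\ell} (y)\,H_{\ell-1}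 \Big( \frac{y-x}{\sqrt{t}}\Big) -\binom{2k}{\ell}H_{2k-\ell}\Big(\frac{x}{\sqrt{1+t}}\Big)\frac{H_{\ell-1}\big(F(x,t,y)\big)}{(1+t)^{k+1/2}}\bigg). \]
   Context: $\chi_{(P,Q)}$ is the indicator function of the interval $(P,Q)$; $\operatorname{erfc}$ is the complementary error function. $H_k$ denotes the Hermite polynomial $H_k(x)=(-1)^k e^{x^2}\left(\frac{d}{dx}\right)^k e^{-x^2}$. The one-dimensional basis function is \[ \eta_{2M}(x)=\frac{(-1)^{M-1}}{2^{2M-1}\sqrt{\pi}\,(M-1)!}\,\frac{H_{2M-1}(x)\, e^{-x^2}}{x}. \] The equation $-(\Delta+\kappa^2)u=f$ is the Helmholtz equation whose (radiating) solution is the diffraction potential $u({\mathbf x})=\int_{\mathbb R^n}\mathcal E_\kappa({\mathbf x}-{\mathbf y})f({\mathbf y})\,d{\mathbf y}$ with $\mathcal E_\kappa({\mathbf x})=\frac{i}{4}\left(\frac{\kappa}{2\pi|{\mathbf x}|}\right)^{n/2-1}H^{(1)}_{n/2-1}(\kappa|{\mathbf x}|)$, $H^{(1)}_\nu$ the Hankel function of the first kind. *)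

theory Defs
  imports "HOL-Analysis.Analysis"
begin

definition hermite :: "nat \<Rightarrow> complex \<Rightarrow> complex" where
  "hermite k z = (-1) ^ k * exp (z\<^sup>2) * ((deriv ^^ k) (\<lambda>w. exp (- (w\<^sup>2))) z)"

text \<open>Complementary error function on the complex plane:
  erfc z = 1 - (2/sqrt pi) int_0^z e^{-w^2} dw (integral along the segment [0,z]).\<close>
definition cerfc :: "complex \<Rightarrow> complex" where
  "cerfc z = 1 - of_real (2 / sqrt pi) * z * integral {0..1} (\<lambda>s::real. exp (- ((z * of_real s)\<^sup>2)))"

definition eta :: "nat \<Rightarrow> real \<Rightarrow> complex" where
  "eta M x = of_real ((-1) ^ (M - 1) / (2 ^ (2 * M - 1) * sqrt pi * fact (M - 1)))
      * hermite (2 * M - 1) (of_real x) * of_real (exp (- (x\<^sup>2)) / x)"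

definition besselJ :: "real \<Rightarrow> real \<Rightarrow> real" where
  "besselJ \<nu> x = (\<Sum>m. (-1) ^ m / fact m * rGamma (real m + \<nu> + 1) * (x / 2) powr (2 * real m + \<nu>))"

definition besselY :: "real \<Rightarrow> real \<Rightarrow> real" where
  "besselY \<nu> x = Lim (at \<nu>) (\<lambda>\<mu>. (besselJ \<mu> x * cos (\<mu> * pi) - besselJ (- \<mu>) x) / sin (\<mu> * pi))"

definition hankel1 :: "real \<Rightarrow> real \<Rightarrow> complex" where
  "hankel1 \<nu> x = Complex (besselJ \<nu> x) (besselY \<nu> x)"

text \<open>Fundamental (radiating) solution of -(Delta + kappa^2) in R^n, n = CARD('n).\<close>
definition helmholtz_fund :: "real \<Rightarrow> real ^ 'n \<Rightarrow> complex" where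
  "helmholtz_fund \<kappa> x =
     \<i> / 4 * of_real ((\<kappa> / (2 * pi * norm x)) powr (real CARD('n) / 2 - 1))
       * hankel1 (real CARD('n) / 2 - 1) (\<kappa> * norm x)"

definition diffraction_potential :: "real \<Rightarrow> (real ^ 'n \<Rightarrow> complex) \<Rightarrow> real ^ 'n \<Rightarrow> complex" where
  "diffraction_potential \<kappa> f x = (LINT y|lborel. helmholtz_fund \<kappa> (x - y) * f y)"

definition FF :: "real \<Rightarrow> complex \<Rightarrow> real \<Rightarrow> complex" where
  "FF x t y = csqrt ((t + 1) / t) * (of_real y - of_real x / (t + 1))"

definition PP :: "nat \<Rightarrow> real \<Rightarrow> complex \<Rightarrow> complex" where
  "PP M x t = (\<Sum>s<M. of_real ((-1) ^ s / (fact s * 4 ^ s))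
       / ((1 + t) ^ s * csqrt (1 + t)) * hermite (2 * s) (of_real x / csqrt (1 + t)))"

definition QQ :: "nat \<Rightarrow> real \<Rightarrow> complex \<Rightarrow> real \<Rightarrow> complex" where
  "QQ M x t y = (if M = 1 then 0 else
     2 * (\<Sum>k\<in>{1..M-1}. of_real ((-1) ^ k / (fact k * 4 ^ k)) *
       (\<Sum>l\<in>{1..2*k}. (-1) ^ l / (csqrt t) ^ l *
          (hermite (2 * k - l) (of_real y) * hermite (l - 1) ((of_real y - of_real x) / csqrt t)
           - of_nat ((2 * k) choose l) * hermite (2 * k - l) (of_real x / csqrt (1 + t))
             * hermite (l - 1) (FF x t y) / ((1 + t) ^ k * csqrt (1 + t))))))"

definition Psi :: "nat \<Rightarrow> real \<Rightarrow> complex \<Rightarrow> real \<Rightarrow> complex" where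
  "Psi M x t y = of_real (1 / (2 * sqrt pi)) * exp (- (of_real (x\<^sup>2)) / (1 + t)) *
     (cerfc (FF x t y) * PP M x t - exp (- ((FF x t y)\<^sup>2)) / of_real (sqrt pi) * QQ M x t y)"

end

theory Submission
  imports Defs "HOL-Complex_Analysis.Complex_Analysis"
begin

unbundle no fps_syntax

text \<open>
  The fundamental solution is a superposition of heat kernels of complex time \<open>\<tau>\<close>,
  \[ \mathcal E_\kappa(z) = \int e^{\kappa^2 \tau} (4 \pi \tau)^{-n/2} e^{-|z|^2/(4\tau)} \, d\tau, \]
  where the contour leaves \<open>0\<close> along the positive real axis, turns into the imaginary axis along a
  quarter circle of radius \<open>c\<close> and then runs to infinity. Integrated against a product density, the heat
  kernels factorise into one-dimensional Gaussian integrals. These are bounded by a multiple of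
  \<open>min 1 (|\<tau>| powr (1/2))\<close> for \<open>Re \<tau> \<ge> 0\<close> (van der Corput), so the arc and the real segment contribute
  nothing in the limit \<open>c \<longrightarrow> 0\<close>, and the contour becomes the imaginary axis. For imaginary time the
  one-dimensional integrals are differences of values of \<open>\<Psi>\<^sub>M\<close>, because \<open>\<Psi>\<^sub>M\<close> is an antiderivative.

  The contour representation of the Hankel function comes from the entire function
  \<open>exp (x sinh \<zeta> - \<mu> \<zeta>)\<close>, with \<open>\<tau>\<close> proportional to \<open>exp \<zeta>\<close>. Let \<open>D \<mu>\<close> be its integral from
  \<open>-\<infinity>\<close> to \<open>\<infinity> + \<i> \<pi>\<close>. Hankel's loop integral for \<open>1/\<Gamma>\<close>, applied termwise, gives \<open>Im (D \<mu>) = \<pi> J\<^sub>\<mu>\<close>, and the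
  substitution of \<open>\<i> \<pi> - \<zeta>\<close> for \<open>\<zeta>\<close> gives \<open>D (-\<mu>) = exp (\<i> \<pi> \<mu>) D \<mu>\<close>; together they determine \<open>Y\<^sub>\<mu>\<close>
  for non-integral \<open>\<mu>\<close>, and continuity in \<open>\<mu>\<close> does the rest.
\<close>

section \<open>Hermite functions\<close>

text \<open>On the imaginary axis the heat kernels have modulus a multiple of s^(-n/2), with no
  decay in |z|, so the double integral over time and space diverges absolutely at time 0 and Fubini
  cannot be applied there. Starting the contour on the real axis repairs this: each of the n
  absolute one-dimensional integrals is O(sqrt \<tau>), which balances \<tau>^(-n/2). After
  factorisation, oscillation gives the same O(sqrt |\<tau>|) for all Re \<tau> \<ge> 0, so the
  integrand in \<tau> stays bounded near 0 and a piece of contour of length O(c) contributes O(c).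
  At infinity absolute convergence comes from n/2 > 1, which is where n \<ge> 3 enters. In the
  variable ln \<tau> all integrands are entire: contour deformations become comparisons of values of
  one primitive, and no branch of \<tau>^(-\<nu>) has to be chosen. Since \<open>besselY\<close> is
  a limit in the order, the integral representation is set up for all real orders, with tail
  estimates uniform on bounded sets of orders.\<close>

definition gauss :: "complex \<Rightarrow> complex" where
  "gauss z = exp (- (z\<^sup>2))"

lemma has_field_derivative_gauss: "(gauss has_field_derivative (- 2 * z * gauss z)) (at z)"
  unfolding gauss_def [abs_def] by (auto intro!: derivative_eq_intros)

lemma holomorphic_gauss: "gauss holomorphic_on A"
  unfolding gauss_def [abs_def] by (intro holomorphic_intros)

lemma has_field_derivative_higher_deriv_gauss:
  "((deriv ^^ k) gauss has_field_derivative (deriv ^^ Suc k) gauss z) (at z)"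
  using holomorphic_derivI [OF holomorphic_higher_deriv [OF holomorphic_gauss open_UNIV], of z k]
  by simp

text \<open>Comes from differentiating the equation gauss' = -2 z gauss k + 1 times; multiplied by
  exp(z^2) it is the three-term recurrence of the Hermite polynomials.\<close>

lemma higher_deriv_gauss_Suc:
  "(deriv ^^ Suc (Suc k)) gauss z
    = - 2 * z * (deriv ^^ Suc k) gauss z - 2 * of_nat (Suc k) * (deriv ^^ k) gauss z"
proof (induction k arbitrary: z)
  case 0
  have "deriv gauss = (\<lambda>z. - 2 * z * gauss z)"
    using has_field_derivative_gauss by (auto intro!: DERIV_imp_deriv)
  moreover have "((\<lambda>z. - 2 * z * gauss z) has_field_derivative - 2 * z * deriv gauss z - 2 * gauss z) (at z)"
    unfolding calculation by (auto intro!: derivative_eq_intros has_field_derivative_gauss)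
  ultimately show ?case by (simp add: DERIV_imp_deriv)
next
  case (Suc k)
  have "((\<lambda>z. - 2 * z * (deriv ^^ Suc k) gauss z - 2 * of_nat (Suc k) * (deriv ^^ k) gauss z)
     has_field_derivative (- 2 * z * (deriv ^^ Suc (Suc k)) gauss z - 2 * (deriv ^^ Suc k) gauss z
       - 2 * of_nat (Suc k) * (deriv ^^ Suc k) gauss z)) (at z)"
    by (rule derivative_eq_intros has_field_derivative_higher_deriv_gauss refl)+ simp
  moreover have "(\<lambda>z. - 2 * z * (deriv ^^ Suc k) gauss z - 2 * of_nat (Suc k) * (deriv ^^ k) gauss z)
      = (deriv ^^ Suc (Suc k)) gauss"
    using Suc.IH by auto
  ultimately have "deriv ((deriv ^^ Suc (Suc k)) gauss) z = - 2 * z * (deriv ^^ Suc (Suc k)) gauss z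
       - 2 * (deriv ^^ Suc k) gauss z - 2 * of_nat (Suc k) * (deriv ^^ Suc k) gauss z"
    by (metis DERIV_imp_deriv)
  then show ?case by (simp add: algebra_simps)
qed

lemma hermite_eq: "hermite k z = (-1) ^ k * exp (z\<^sup>2) * (deriv ^^ k) gauss z"
  unfolding hermite_def gauss_def [abs_def] by simp

lemma hermite_0 [simp]: "hermite 0 z = 1"
  by (simp add: hermite_eq gauss_def flip: exp_add)

lemma hermite_Suc_0 [simp]: "hermite (Suc 0) z = 2 * z"
  using DERIV_imp_deriv [OF has_field_derivative_gauss, of z]
  by (simp add: hermite_eq gauss_def flip: exp_add)

lemma hermite_Suc_Suc:
  "hermite (Suc (Suc k)) z = 2 * z * hermite (Suc k) z - 2 * of_nat (Suc k) * hermite k z"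
  unfolding hermite_eq higher_deriv_gauss_Suc by (simp add: algebra_simps)

lemma has_field_derivative_hermite:
  "(hermite k has_field_derivative (2 * z * hermite k z - hermite (Suc k) z)) (at z)"
proof -
  have "((\<lambda>z. (-1) ^ k * exp (z\<^sup>2) * (deriv ^^ k) gauss z) has_field_derivative
     (-1) ^ k * (2 * z * exp (z\<^sup>2) * (deriv ^^ k) gauss z + exp (z\<^sup>2) * (deriv ^^ Suc k) gauss z)) (at z)"
    by (rule derivative_eq_intros has_field_derivative_higher_deriv_gauss refl)+
      (simp add: algebra_simps)
  then show ?thesis
    unfolding hermite_eq [abs_def] by (simp add: algebra_simps)
qed

lemma has_field_derivative_hermite' [derivative_intros]:
  assumes "(g has_field_derivative g') (at z within S)"
  shows "((\<lambda>z. hermite k (g z)) has_field_derivative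
     (2 * g z * hermite k (g z) - hermite (Suc k) (g z)) * g') (at z within S)"
  by (rule DERIV_chain2 [OF has_field_derivative_hermite assms])

lemma continuous_on_hermite [continuous_intros]:
  assumes "continuous_on S g"
  shows "continuous_on S (\<lambda>x. hermite k (g x))"
proof (rule continuous_on_compose2 [OF _ assms subset_UNIV])
  show "continuous_on UNIV (hermite k)"
    by (meson DERIV_isCont has_field_derivative_hermite continuous_at_imp_continuous_on)
qed

lemma hermite_even_minus: "hermite (2 * k) (- z) = hermite (2 * k) z"
proof -
  have "hermite n (- z) = (-1) ^ n * hermite n z \<and> hermite (Suc n) (- z) = (-1) ^ Suc n * hermite (Suc n) z" for n
    by (induction n) (auto simp: hermite_Suc_Suc algebra_simps)
  then show ?thesis by auto
qed

text \<open>The recurrence of the Taylor coefficients of exp(2 z w - w^2) in w, in the shape in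
  which it is compared with a power series.\<close>

lemma hermite_Suc_Suc_fact:
  "of_nat (Suc (Suc k)) * (hermite (Suc (Suc k)) z / fact (Suc (Suc k)))
     = 2 * z * (hermite (Suc k) z / fact (Suc k)) - 2 * (hermite k z / fact k)"
proof -
  have "of_nat (Suc (Suc k)) * (hermite (Suc (Suc k)) z / fact (Suc (Suc k))) = hermite (Suc (Suc k)) z / fact (Suc k)"
    unfolding fact_Suc [of "Suc k"] of_nat_mult by (simp del: of_nat_Suc fact_Suc)
  also have "\<dots> = 2 * z * (hermite (Suc k) z / fact (Suc k)) - 2 * (of_nat (Suc k) * hermite k z / (of_nat (Suc k) * fact k))"
    unfolding hermite_Suc_Suc fact_Suc [of k] by (simp add: diff_divide_distrib del: of_nat_Suc)
  also have "of_nat (Suc k) * hermite k z / (of_nat (Suc k) * fact k) = hermite k z / fact k"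
    by (simp del: of_nat_Suc)
  finally show ?thesis .
qed

text \<open>The generating functions satisfy exp(2 \<alpha> p w - \<alpha>^2 w^2) exp(2 \<beta> q w
  - \<beta>^2 w^2) = exp(2 (\<alpha> p + \<beta> q) w - w^2) when \<alpha>^2 + \<beta>^2 = 1; the
  claim compares coefficients of w^n. As formal series the exponentials are handled through the
  linear differential equation that they solve.\<close>

theorem hermite_addition:
  fixes \<alpha> \<beta> p q :: complex
  assumes ab: "\<alpha>\<^sup>2 + \<beta>\<^sup>2 = 1"
  shows "(\<Sum>l\<le>n. of_nat (n choose l) * \<alpha> ^ (n - l) * \<beta> ^ l * hermite (n - l) p * hermite l q)
     = hermite n (\<alpha> * p + \<beta> * q)"
proof -
  define A where "A c z = Abs_fps (\<lambda>n. c ^ n * hermite n z / fact n)" for c z :: complex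
  have nth: "fps_nth (A c z) m = c ^ m * hermite m z / fact m" for c z m
    by (simp add: A_def)
  have A': "fps_deriv (A c z) = fps_const (2 * c * z) * A c z - fps_const (2 * c\<^sup>2) * (fps_X * A c z)" for c z
  proof (rule fps_ext)
    fix m
    show "fps_nth (fps_deriv (A c z)) m
      = fps_nth (fps_const (2 * c * z) * A c z - fps_const (2 * c\<^sup>2) * (fps_X * A c z)) m"
    proof -
      have "fps_nth (fps_deriv (A c z)) m = of_nat (Suc m) * (c ^ Suc m * hermite (Suc m) z / (of_nat (Suc m) * fact m))"
        by (simp add: nth)
      also have "\<dots> = c ^ Suc m * hermite (Suc m) z / fact m"
        by (simp del: of_nat_Suc)
      also have "\<dots> = fps_nth (fps_const (2 * c * z) * A c z - fps_const (2 * c\<^sup>2) * (fps_X * A c z)) m"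
      proof (cases m)
        case (Suc k)
        have "hermite (Suc m) z / fact m = 2 * z * (hermite m z / fact m) - 2 * (hermite k z / fact k)"
          using hermite_Suc_Suc_fact [of k z] by (simp add: Suc del: of_nat_Suc)
        then have "c ^ Suc m * hermite (Suc m) z / fact m
            = c ^ Suc m * (2 * z * (hermite m z / fact m) - 2 * (hermite k z / fact k))"
          by (metis times_divide_eq_right)
        then show ?thesis
          by (simp add: Suc nth algebra_simps power2_eq_square del: fact_Suc)
      qed (simp add: nth)
      finally show ?thesis .
    qed
  qed
  define C where "C = A \<alpha> p * A \<beta> q"
  define z where "z = \<alpha> * p + \<beta> * q"
  have "fps_deriv C = fps_const (2 * \<alpha> * p + 2 * \<beta> * q) * C - fps_const (2 * (\<alpha>\<^sup>2 + \<beta>\<^sup>2)) * (fps_X * C)"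
    unfolding C_def fps_deriv_mult A'
    by (simp add: algebra_simps flip: fps_const_add fps_const_mult)
  then have C': "fps_deriv C = fps_const (2 * z) * C - fps_const 2 * (fps_X * C)"
    by (simp add: ab z_def algebra_simps)
  \<comment> \<open>The equation \<open>C'\<close> amounts to a three-term recurrence, so the
    coefficients of \<open>C\<close> are determined by the first two.\<close>
  have C0: "fps_nth C 0 = 1"
    by (simp add: C_def nth)
  have "fps_nth (fps_deriv C) 0 = 2 * z"
    by (simp add: C' C0)
  then have C1: "fps_nth C 1 = 2 * z"
    by simp
  have C2: "of_nat (Suc (Suc m)) * fps_nth C (Suc (Suc m)) = 2 * z * fps_nth C (Suc m) - 2 * fps_nth C m" for m
    using arg_cong [OF C', of "\<lambda>f. fps_nth f (Suc m)"] by simp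
  have "fps_nth C m = hermite m z / fact m \<and> fps_nth C (Suc m) = hermite (Suc m) z / fact (Suc m)" for m
  proof (induction m)
    case 0
    then show ?case using C0 C1 by simp
  next
    case (Suc m)
    have "of_nat (Suc (Suc m)) * fps_nth C (Suc (Suc m))
        = of_nat (Suc (Suc m)) * (hermite (Suc (Suc m)) z / fact (Suc (Suc m)))"
      using Suc.IH unfolding C2 hermite_Suc_Suc_fact by simp
    moreover have "of_nat (Suc (Suc m)) \<noteq> (0::complex)"
      by (simp only: of_nat_eq_0_iff)
    ultimately have "fps_nth C (Suc (Suc m)) = hermite (Suc (Suc m)) z / fact (Suc (Suc m))"
      by (metis mult_left_cancel)
    with Suc.IH show ?case by blast
  qed
  then have "hermite n z = fact n * fps_nth C n"
    by simp
  also have "C = A \<beta> q * A \<alpha> p"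
    by (simp add: C_def mult.commute)
  also have "fact n * fps_nth \<dots> n = (\<Sum>l\<le>n. fact n * (\<beta> ^ l * hermite l q / fact l * (\<alpha> ^ (n - l) * hermite (n - l) p / fact (n - l))))"
    by (simp add: fps_mult_nth nth atLeast0AtMost sum_distrib_left)
  also have "\<dots> = (\<Sum>l\<le>n. of_nat (n choose l) * \<alpha> ^ (n - l) * \<beta> ^ l * hermite (n - l) p * hermite l q)"
    by (rule sum.cong) (auto simp: binomial_fact)
  finally show ?thesis by (simp add: z_def)
qed

section \<open>The basis function\<close>

definition hermite_coeff :: "nat \<Rightarrow> complex" where
  "hermite_coeff k = of_real ((-1) ^ k / (fact k * 4 ^ k))"

text \<open>The quotient in \<open>eta\<close> with its removable singularity at 0 filled in;
  \<open>eta M 0\<close> itself is 0 because of division by zero.\<close>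

definition eta_smooth :: "nat \<Rightarrow> real \<Rightarrow> complex" where
  "eta_smooth M y = (\<Sum>k<M. hermite_coeff k * hermite (2 * k) (of_real y)) * exp (- (of_real y)\<^sup>2) / of_real (sqrt pi)"

text \<open>The normalisation is such that in H_(2M+3) = 2 z H_(2M+2) - 4 (M+1) H_(2M+1) the last
  term reproduces the previous left-hand side, so the sum builds up term by term. This carries out
  the division by x in \<open>eta\<close> and leaves the even polynomials that occur in
  \<open>PP\<close>.\<close>

lemma hermite_odd_sum:
  "of_real ((-1) ^ M / (2 ^ (2 * M + 1) * fact M)) * hermite (2 * M + 1) z
     = z * (\<Sum>k\<le>M. hermite_coeff k * hermite (2 * k) z)"
proof (induction M)
  case 0
  then show ?case by (simp add: hermite_coeff_def)
next
  case (Suc M)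
  have "hermite (2 * Suc M + 1) z = 2 * z * hermite (2 * Suc M) z - 4 * of_nat (Suc M) * hermite (2 * M + 1) z"
    using hermite_Suc_Suc [of "2 * M + 1" z] by (simp add: algebra_simps)
  then have "of_real ((-1) ^ Suc M / (2 ^ (2 * Suc M + 1) * fact (Suc M))) * hermite (2 * Suc M + 1) z
     = of_real ((-1) ^ Suc M / (2 ^ (2 * Suc M + 1) * fact (Suc M))) * (2 * z * hermite (2 * Suc M) z)
       - of_real ((-1) ^ Suc M / (2 ^ (2 * Suc M + 1) * fact (Suc M))) * (4 * of_nat (Suc M)) * hermite (2 * M + 1) z"
    by (simp only: right_diff_distrib mult.assoc)
  also have "of_real ((-1) ^ Suc M / (2 ^ (2 * Suc M + 1) * fact (Suc M))) * (2 * z * hermite (2 * Suc M) z)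
     = z * (hermite_coeff (Suc M) * hermite (2 * Suc M) z)"
    unfolding hermite_coeff_def by (simp add: power_mult del: fact_Suc) 
  also have "of_real ((-1) ^ Suc M / (2 ^ (2 * Suc M + 1) * fact (Suc M))) * (4 * of_nat (Suc M))
      = - (of_real ((-1) ^ M / (2 ^ (2 * M + 1) * fact M)) :: complex)"
  proof -
    have "(fact (Suc M) :: complex) = of_nat (Suc M) * fact M" by simp
    moreover have "of_nat (Suc M) \<noteq> (0::complex)" by (simp only: of_nat_eq_0_iff)
    ultimately show ?thesis by (simp add: field_simps del: of_nat_Suc fact_Suc)
  qed
  finally show ?case using Suc.IH by (simp add: algebra_simps)
qed

lemma eta_eq_eta_smooth:
  assumes "M \<ge> 1" "y \<noteq> 0"
  shows "eta M y = eta_smooth M y"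
proof -
  obtain N where N: "M = Suc N" using assms by (cases M) auto
  have "eta M y = (of_real ((-1) ^ N / (2 ^ (2 * N + 1) * fact N)) * hermite (2 * N + 1) (of_real y))
     * (of_real (exp (- (y\<^sup>2))) / (of_real y * of_real (sqrt pi)))"
    by (simp add: N eta_def)
  also have "\<dots> = eta_smooth M y"
    unfolding hermite_odd_sum using assms
    by (simp add: N eta_smooth_def lessThan_Suc_atMost exp_of_real[symmetric])
  finally show ?thesis .
qed

section \<open>The function $\Psi_M$ as a Gaussian convolution\<close>

text \<open>The segment integral equals G z - G 0 for an entire primitive G of \<open>gauss\<close>,
  so it can be differentiated in its end point.\<close>

lemma has_field_derivative_cerfc:
  "(cerfc has_field_derivative - of_real (2 / sqrt pi) * exp (- (z\<^sup>2))) (at z)"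
proof -
  obtain G where G: "(G has_field_derivative gauss z) (at z)" for z
    using holomorphic_convex_primitive' [OF convex_UNIV open_UNIV holomorphic_gauss [of UNIV]] by auto
  have eq: "z * integral {0..1} (\<lambda>s::real. exp (- ((z * of_real s)\<^sup>2))) = G z - G 0" for z
  proof -
    have "((\<lambda>s::real. z * exp (- ((z * of_real s)\<^sup>2))) has_integral G (z * of_real 1) - G (z * of_real 0)) {0..1}"
    proof (rule fundamental_theorem_of_calculus)
      fix s :: real
      have "((\<lambda>s. G (z * s)) has_field_derivative gauss (z * of_real s) * z) (at (of_real s))"
        by (rule DERIV_chain2 [OF G]) (auto intro!: derivative_eq_intros)
      then have "((\<lambda>s. G (z * s)) has_field_derivative z * exp (- ((z * of_real s)\<^sup>2))) (at (of_real s))"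
        by (simp add: gauss_def mult.commute)
      then show "((\<lambda>s. G (z * of_real s)) has_vector_derivative z * exp (- ((z * of_real s)\<^sup>2))) (at s within {0..1})"
        by (rule has_vector_derivative_real_field)
    qed simp
    then show ?thesis
      by (metis integral_mult_right integral_unique mult.right_neutral mult_zero_right of_real_0 of_real_1)
  qed
  have "((\<lambda>z. 1 - of_real (2 / sqrt pi) * (G z - G 0)) has_field_derivative
     - of_real (2 / sqrt pi) * exp (- (z\<^sup>2))) (at z)"
    by (rule derivative_eq_intros G refl)+ (simp add: gauss_def)
  moreover have "cerfc = (\<lambda>z. 1 - of_real (2 / sqrt pi) * (G z - G 0))"
    by (simp only: cerfc_def [abs_def] mult.assoc eq)
  ultimately show ?thesis by simp
qed

text \<open>Principal roots do not divide in general. For Im t > 0 both roots lie in the open first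
  quadrant, so the argument of their quotient lies strictly between -pi/2 and pi/2. This expresses
  \<open>FF\<close> by the separate roots of t and 1 + t.\<close>

lemma csqrt_divide_upper:
  assumes "Im t > 0"
  shows "csqrt ((t + 1) / t) = csqrt (1 + t) / csqrt t"
proof (rule csqrt_unique)
  show "(csqrt (1 + t) / csqrt t)\<^sup>2 = (t + 1) / t"
    by (simp add: power_divide add.commute)
  have up: "Re (csqrt z) > 0 \<and> Im (csqrt z) > 0" if "Im z > 0" for z
  proof -
    have *: "Re (csqrt z) * Im (csqrt z) * 2 = Im z"
      using power2_csqrt [of z] by (metis complex_eq_iff Im_power2 mult.assoc mult.commute)
    moreover have "Re (csqrt z) \<ge> 0" using csqrt_principal [of z] by auto
    ultimately show ?thesis using that
      by (metis less_eq_real_def mult_zero_left mult_zero_right zero_less_mult_pos zero_less_mult_pos2 zero_less_numeral order_less_irrefl)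
  qed
  have "Re (csqrt (1 + t) / csqrt t) > 0"
    using up [of "1 + t"] up [OF assms] assms
    by (auto simp: Re_divide intro!: divide_pos_pos add_pos_pos mult_pos_pos)
  then show "0 < Re (csqrt (1 + t) / csqrt t) \<or> Re (csqrt (1 + t) / csqrt t) = 0 \<and> 0 \<le> Im (csqrt (1 + t) / csqrt t)"
    by simp
qed

text \<open>Here \<open>b\<close> and \<open>c\<close> stand for the square roots of \<open>t\<close> and \<open>1 + t\<close>.
  The first half of a summand of \<open>Q\<^sub>M\<close> collects the boundary terms of repeated integration by parts,
  whose derivatives telescope; the derivative of the other half is summed by the addition theorem.\<close>

lemma has_field_derivative_QQ_summand:
  fixes b c X w :: complex and k :: nat
  assumes b: "b \<noteq> 0" and c: "c \<noteq> 0" and bc: "c\<^sup>2 = 1 + b\<^sup>2"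
  defines "v \<equiv> \<lambda>w. (w - X) / b" and "F \<equiv> \<lambda>w. c / b * (w - X / c\<^sup>2)"
  defines "q \<equiv> \<lambda>w. \<Sum>l\<in>{1..2*k}. (-1) ^ l / b ^ l * (hermite (2 * k - l) w * hermite (l - 1) (v w)
       - of_nat ((2 * k) choose l) * hermite (2 * k - l) (X / c) * hermite (l - 1) (F w) / (c ^ (2 * k) * c))"
  shows "(q has_field_derivative 2 * F w * (c / b) * q w
     + (hermite (2 * k) w - hermite (2 * k) (X / c) / c ^ (2 * k)) / b) (at w)"
proof -
  define n where "n = 2 * k"
  \<comment> \<open>Both sides are half the derivative of F^2 = w^2 + v^2 - X^2 / c^2. Hence
    products of Hermite polynomials in w and v, and Hermite polynomials in F, produce the same
    factor \<open>2 * F w * (c / b)\<close> when differentiated.\<close>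
  have F: "F w * (c / b) = w + v w / b" for w
  proof -
    have "F w * (c / b) = (c\<^sup>2 * w - X) / b\<^sup>2"
      using b c unfolding F_def by (simp add: field_simps power2_eq_square)
    also have "\<dots> = w + v w / b"
      using b unfolding bc v_def by (simp add: field_simps power2_eq_square)
    finally show ?thesis .
  qed
  have dv: "(v has_field_derivative 1 / b) (at w)" and dF: "(F has_field_derivative c / b) (at w)"
    unfolding v_def F_def by (auto intro!: derivative_eq_intros simp: b)
  define u where "u l = (-1) ^ l / b ^ Suc l * hermite (n - l) w * hermite l (v w)" for l
  define u' where "u' l = (-1) ^ l / b ^ Suc l * of_nat (n choose l) * hermite (n - l) (X / c) * hermite l (F w) / c ^ n" for l
  define T where "T l w = (-1) ^ l / b ^ l * (hermite (n - l) w * hermite (l - 1) (v w)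
       - of_nat (n choose l) * hermite (n - l) (X / c) * hermite (l - 1) (F w) / (c ^ n * c))" for l w
  have T: "(T l has_field_derivative 2 * F w * (c / b) * T l w + (u (l - 1) - u l) + u' l) (at w)"
    if l: "l \<in> {1..n}" for l
  proof -
    define A B C D where "A = hermite (n - l) w" and "B = hermite (l - 1) (v w)"
      and "C = of_nat (n choose l) * hermite (n - l) (X / c) / (c ^ n * c)" and "D = hermite (l - 1) (F w)"
    have Suc: "Suc (l - 1) = l" "Suc (n - l) = n - (l - 1)" using l by auto
    have "(T l has_field_derivative (-1) ^ l / b ^ l *
        (((2 * w * A - hermite (n - (l - 1)) w) * B + (2 * v w * B - hermite l (v w)) * (1 / b) * A)
         - C * ((2 * F w * D - hermite l (F w)) * (c / b)))) (at w)"
    proof -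
      have TC: "T l = (\<lambda>w. (-1) ^ l / b ^ l * (hermite (n - l) w * hermite (l - 1) (v w) - C * hermite (l - 1) (F w)))"
        by (simp add: T_def C_def fun_eq_iff)
      have "(hermite (n - l) has_field_derivative 2 * w * A - hermite (n - (l - 1)) w) (at w)"
        using has_field_derivative_hermite [of "n - l" w] by (simp add: A_def Suc)
      moreover have "((\<lambda>w. hermite (l - 1) (v w)) has_field_derivative (2 * v w * B - hermite l (v w)) * (1 / b)) (at w)"
        using has_field_derivative_hermite' [OF dv, of "l - 1", unfolded Suc(1)] by (simp only: B_def)
      moreover have "((\<lambda>w. hermite (l - 1) (F w)) has_field_derivative (2 * F w * D - hermite l (F w)) * (c / b)) (at w)"
        using has_field_derivative_hermite' [OF dF, of "l - 1", unfolded Suc(1)] by (simp only: D_def)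
      ultimately show ?thesis
        unfolding TC A_def B_def by (intro DERIV_cmult DERIV_diff DERIV_mult)
    qed
    also have "(-1) ^ l / b ^ l *
        (((2 * w * A - hermite (n - (l - 1)) w) * B + (2 * v w * B - hermite l (v w)) * (1 / b) * A)
         - C * ((2 * F w * D - hermite l (F w)) * (c / b)))
       = 2 * (F w * (c / b)) * ((-1) ^ l / b ^ l * (A * B - C * D))
        - (-1) ^ l / b ^ l * (hermite (n - (l - 1)) w * B)
         - (-1) ^ l / b ^ l * (hermite l (v w) * A / b) + (-1) ^ l / b ^ l * (C * (c / b) * hermite l (F w))"
    proof -
      have "(2 * w * A - h1) * B + (2 * v w * B - h2) * (1 / b) * A
          = 2 * (F w * (c / b)) * (A * B) - h1 * B - h2 * A / b" for h1 h2
        unfolding F by (simp add: algebra_simps diff_divide_distrib add_divide_distrib)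
      moreover have "C * ((2 * F w * D - h3) * (c / b)) = 2 * (F w * (c / b)) * (C * D) - C * (c / b) * h3" for h3
        by (simp add: algebra_simps)
      ultimately show ?thesis
        by (simp only: right_diff_distrib) (simp only: algebra_simps)
    qed
    also have "- ((-1) ^ l / b ^ l * (hermite (n - (l - 1)) w * B)) = u (l - 1)"
      using l unfolding u_def B_def Suc
      by (cases l) simp_all
    then have "(-1) ^ l / b ^ l * (hermite (n - (l - 1)) w * B) = - u (l - 1)"
      by (simp add: minus_equation_iff)
    also have "(-1) ^ l / b ^ l * (hermite l (v w) * A / b) = u l"
      by (simp add: u_def A_def field_simps)
    also have "(-1) ^ l / b ^ l * (C * (c / b) * hermite l (F w)) = u' l"
      using c by (simp add: u'_def C_def field_simps)
    also have "(-1) ^ l / b ^ l * (A * B - C * D) = T l w"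
      by (simp add: T_def A_def B_def C_def D_def)
    finally show ?thesis by (simp add: algebra_simps)
  qed
  have "(q has_field_derivative (\<Sum>l\<in>{1..n}. 2 * F w * (c / b) * T l w + (u (l - 1) - u l) + u' l)) (at w)"
    unfolding q_def n_def [symmetric] T_def [symmetric]
    by (rule DERIV_sum) (use T in auto)
  also have "(\<Sum>l\<in>{1..n}. 2 * F w * (c / b) * T l w + (u (l - 1) - u l) + u' l)
     = 2 * F w * (c / b) * q w + (\<Sum>l\<in>{1..n}. u (l - 1) - u l) + (\<Sum>l\<in>{1..n}. u' l)"
    by (simp add: sum.distrib q_def T_def n_def sum_distrib_left)
  also have "(\<Sum>l\<in>{1..n}. u (l - 1) - u l) = u 0 - u n"
    by (simp add: sum.atLeast1_atMost_eq sum_lessThan_telescope')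
  \<comment> \<open>The addition theorem needs the full binomial sum; its l = 0 term does not occur
    in \<open>q\<close> and is subtracted again.\<close>
  also have "(\<Sum>l\<in>{1..n}. u' l) = (\<Sum>l\<le>n. u' l) - u' 0"
    by (simp add: sum.atMost_shift sum.atLeast1_atMost_eq)
  also have "(\<Sum>l\<le>n. u' l) = (1 / b ^ Suc n) *
       (\<Sum>l\<le>n. of_nat (n choose l) * (b / c) ^ (n - l) * (- 1 / c) ^ l * hermite (n - l) (X / c) * hermite l (F w))"
    unfolding sum_distrib_left
  proof (rule sum.cong)
    fix l assume "l \<in> {..n}"
    then obtain j where j: "n = l + j" by (auto simp: le_iff_add)
    show "u' l = 1 / b ^ Suc n * (of_nat (n choose l) * (b / c) ^ (n - l) * (- 1 / c) ^ l * hermite (n - l) (X / c) * hermite l (F w))"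
      unfolding u'_def using b c
      by (simp add: j power_add power_divide power_minus [of "1 / c"] field_simps)
  qed simp
  also have "(\<Sum>l\<le>n. of_nat (n choose l) * (b / c) ^ (n - l) * (- 1 / c) ^ l * hermite (n - l) (X / c) * hermite l (F w))
     = hermite n (b / c * (X / c) + (- 1 / c) * F w)"
  proof (rule hermite_addition)
    show "(b / c)\<^sup>2 + (- 1 / c)\<^sup>2 = 1"
    proof -
      have "(b / c)\<^sup>2 + (- 1 / c)\<^sup>2 = (1 + b\<^sup>2) / c\<^sup>2"
        by (simp add: power_divide add_divide_distrib)
      then show ?thesis using c by (simp add: bc [symmetric])
    qed
  qed
  also have "b / c * (X / c) + (- 1 / c) * F w = - v w"
  proof -
    have "b / c * (X / c) + (- 1 / c) * F w = (b * X + X / b) / c\<^sup>2 - w / b"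
    proof -
      have "F w = c * w / b - X / (b * c)"
        using c unfolding F_def by (simp add: right_diff_distrib power2_eq_square)
      then show ?thesis
        using c by (simp add: right_diff_distrib add_divide_distrib power2_eq_square)
    qed
    also have "b * X + X / b = c\<^sup>2 * (X / b)"
      using b unfolding bc by (simp add: distrib_right add_divide_distrib power2_eq_square)
    finally show ?thesis using c by (simp add: v_def diff_divide_distrib)
  qed
  \<comment> \<open>Because n is even, the binomial sum equals \<open>u n\<close> and cancels the
    upper end of the telescoping sum. Only the l = 0 terms \<open>u 0\<close> and
    \<open>u' 0\<close> survive.\<close>
  also have "hermite n (- v w) = hermite n (v w)"
    by (simp add: n_def hermite_even_minus)
  also have "1 / b ^ Suc n * hermite n (v w) = u n"
    by (simp add: u_def n_def)
  also have "u' 0 = hermite n (X / c) / c ^ n / b"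
    by (simp add: u'_def)
  also have "u 0 = hermite n w / b"
    by (simp add: u_def)
  finally show ?thesis by (simp add: n_def diff_divide_distrib)
qed

text \<open>Three cancellations: differentiating the factor exp(-F^2) absorbs the
  \<open>2 * F w * (c / b) * R w\<close> part of the derivative of \<open>QQ\<close>; the parts of
  that derivative with argument X / c cancel \<open>PP\<close>, which enters through the derivative
  of \<open>cerfc\<close>; the exponents combine by completing the square. What is left is the sum
  in \<open>eta_smooth\<close>.\<close>

lemma has_vector_derivative_Psi:
  assumes t: "Im t > 0"
  shows "(Psi M x t has_vector_derivative
     - exp (- (of_real (x - y))\<^sup>2 / t) * eta_smooth M y / (of_real (sqrt pi) * csqrt t)) (at y within S)"
proof -
  define b c X where "b = csqrt t" and "c = csqrt (1 + t)" and "X = (of_real x :: complex)"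
  have "t \<noteq> 0" "1 + t \<noteq> 0" using t by (auto simp: complex_eq_iff)
  then have b: "b \<noteq> 0" and c: "c \<noteq> 0" by (auto simp: b_def c_def)
  have b2: "b\<^sup>2 = t" and c2: "c\<^sup>2 = 1 + t" by (auto simp: b_def c_def)
  have bc: "c\<^sup>2 = 1 + b\<^sup>2" by (simp add: b2 c2)
  define F where "F w = c / b * (w - X / c\<^sup>2)" for w
  have FF: "FF x t y = F (of_real y)" for y
    unfolding FF_def F_def X_def csqrt_divide_upper [OF t] b_def [symmetric] c_def [symmetric] c2
    by (simp add: add.commute)
  define q where "q k w = (\<Sum>l\<in>{1..2*k}. (-1) ^ l / b ^ l * (hermite (2 * k - l) w * hermite (l - 1) ((w - X) / b)
       - of_nat ((2 * k) choose l) * hermite (2 * k - l) (X / c) * hermite (l - 1) (F w) / (c ^ (2 * k) * c)))" for k w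
  have q: "(q k has_field_derivative 2 * F w * (c / b) * q k w
     + (hermite (2 * k) w - hermite (2 * k) (X / c) / c ^ (2 * k)) / b) (at w)" for k w
    using has_field_derivative_QQ_summand [OF b c bc, of k X w] unfolding q_def F_def by simp
  define R where "R w = 2 * (\<Sum>k\<in>{1..M-1}. hermite_coeff k * q k w)" for w
  have R: "QQ M x t y = R (of_real y)" for y
    unfolding QQ_def R_def q_def hermite_coeff_def FF b_def [symmetric] c_def [symmetric] X_def [symmetric]
    unfolding c2 [symmetric] by (simp add: power_mult)
  define p where "p = PP M x t"
  have p: "p = (\<Sum>k<M. hermite_coeff k * (hermite (2 * k) (X / c) / c ^ (2 * k))) / c"
    unfolding p_def PP_def hermite_coeff_def c_def [symmetric] X_def [symmetric]
    unfolding c2 [symmetric] by (simp add: sum_divide_distrib power_mult mult.assoc)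
  define L where "L w = of_real (1 / (2 * sqrt pi)) * exp (- (X\<^sup>2) / c\<^sup>2) *
     (cerfc (F w) * p - exp (- ((F w)\<^sup>2)) / of_real (sqrt pi) * R w)" for w
  have L: "Psi M x t y = L (of_real y)" for y
    unfolding Psi_def L_def FF R p_def c2 X_def by simp
  define w where "w = (of_real y :: complex)"
  have dF: "(F has_field_derivative c / b) (at w)"
    unfolding F_def by (auto intro!: derivative_eq_intros simp: b)
  define R' where "R' = 2 * (\<Sum>k\<in>{1..M-1}. hermite_coeff k * (2 * F w * (c / b) * q k w
     + (hermite (2 * k) w - hermite (2 * k) (X / c) / c ^ (2 * k)) / b))"
  have dR: "(R has_field_derivative R') (at w)"
    unfolding R_def R'_def by (intro DERIV_cmult DERIV_sum q)
  have "R' = (\<Sum>k\<in>{1..M-1}. 2 * F w * (c / b) * (2 * (hermite_coeff k * q k w)) 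
     + 2 / b * (hermite_coeff k * (hermite (2 * k) w - hermite (2 * k) (X / c) / c ^ (2 * k))))"
    unfolding R'_def sum_distrib_left by (rule sum.cong) (simp_all add: distrib_left mult_ac)
  then have R': "R' = 2 * F w * (c / b) * R w + 2 / b * (\<Sum>k\<in>{1..M-1}. 
      hermite_coeff k * (hermite (2 * k) w - hermite (2 * k) (X / c) / c ^ (2 * k)))"
    by (simp add: R_def sum.distrib sum_distrib_left)
  have sum: "c * p + (\<Sum>k\<in>{1..M-1}. hermite_coeff k * (hermite (2 * k) w - hermite (2 * k) (X / c) / c ^ (2 * k)))
     = (\<Sum>k<M. hermite_coeff k * hermite (2 * k) w)"
  proof (cases M)
    case 0
    then show ?thesis by (simp add: p)
  next
    case (Suc N)
    \<comment> \<open>The k = 0 summand is 1 - 1, so the sum in \<open>QQ\<close> can start at k = 1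
      although the one in \<open>PP\<close> starts at 0.\<close>
    have "(\<Sum>k\<in>{1..N}. hermite_coeff k * (hermite (2 * k) w - hermite (2 * k) (X / c) / c ^ (2 * k)))
       = (\<Sum>k<M. hermite_coeff k * (hermite (2 * k) w - hermite (2 * k) (X / c) / c ^ (2 * k)))"
      by (simp add: Suc sum.atLeast1_atMost_eq sum.lessThan_Suc_shift del: sum.lessThan_Suc)
    then show ?thesis
      unfolding p using c by (simp add: Suc right_diff_distrib sum_subtractf del: sum.lessThan_Suc)
  qed
  have "(L has_field_derivative of_real (1 / (2 * sqrt pi)) * exp (- (X\<^sup>2) / c\<^sup>2) *
     (- of_real (2 / sqrt pi) * exp (- ((F w)\<^sup>2)) * (c / b) * p
       - (- (2 * F w * (c / b)) * exp (- ((F w)\<^sup>2)) / of_real (sqrt pi) * R w + R' * (exp (- ((F w)\<^sup>2)) / of_real (sqrt pi))))) (at w)"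
    unfolding L_def
  proof (intro DERIV_cmult DERIV_diff DERIV_cmult_right DERIV_mult DERIV_cdivide dR)
    show "((\<lambda>w. cerfc (F w)) has_field_derivative - of_real (2 / sqrt pi) * exp (- ((F w)\<^sup>2)) * (c / b)) (at w)"
      by (rule DERIV_chain2 [OF has_field_derivative_cerfc dF])
    show "((\<lambda>w. exp (- ((F w)\<^sup>2))) has_field_derivative - (2 * F w * (c / b)) * exp (- ((F w)\<^sup>2))) (at w)"
      using DERIV_chain2 [OF has_field_derivative_gauss dF] by (simp add: gauss_def algebra_simps)
  qed
  also have "of_real (1 / (2 * sqrt pi)) * exp (- (X\<^sup>2) / c\<^sup>2) *
     (- of_real (2 / sqrt pi) * exp (- ((F w)\<^sup>2)) * (c / b) * p
       - (- (2 * F w * (c / b)) * exp (- ((F w)\<^sup>2)) / of_real (sqrt pi) * R w + R' * (exp (- ((F w)\<^sup>2)) / of_real (sqrt pi))))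
    = - (exp (- (X\<^sup>2) / c\<^sup>2) * exp (- ((F w)\<^sup>2))) / (of_real (sqrt pi) * of_real (sqrt pi) * b) *
     (c * p + (\<Sum>k\<in>{1..M-1}. hermite_coeff k * (hermite (2 * k) w - hermite (2 * k) (X / c) / c ^ (2 * k))))"
    unfolding R' using b by (simp add: field_simps)
  also have "exp (- (X\<^sup>2) / c\<^sup>2) * exp (- ((F w)\<^sup>2)) = exp (- (X - w)\<^sup>2 / t) * exp (- (w\<^sup>2))"
  proof -
    have "(F w)\<^sup>2 + X\<^sup>2 / c\<^sup>2 = (c\<^sup>2 * w\<^sup>2 - 2 * w * X) / t + X\<^sup>2 * (1 + t) / (c\<^sup>2 * t)"
      using \<open>t \<noteq> 0\<close> c unfolding F_def power_mult_distrib power_divide b2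
      by (simp add: field_simps power2_eq_square)
    also have "X\<^sup>2 * (1 + t) / (c\<^sup>2 * t) = X\<^sup>2 / t"
      using c \<open>1 + t \<noteq> 0\<close> unfolding c2 by simp
    also have "(c\<^sup>2 * w\<^sup>2 - 2 * w * X) / t + X\<^sup>2 / t = (X - w)\<^sup>2 / t + w\<^sup>2"
      using \<open>t \<noteq> 0\<close> unfolding c2 by (simp add: field_simps power2_eq_square)
    finally have "- (X\<^sup>2) / c\<^sup>2 + - ((F w)\<^sup>2) = - (X - w)\<^sup>2 / t + - (w\<^sup>2)"
      by (simp add: algebra_simps)
    then show ?thesis
      by (simp only: flip: exp_add)
  qed
  also note sum
  finally have "(L has_field_derivative - exp (- (X - w)\<^sup>2 / t) * eta_smooth M y / (of_real (sqrt pi) * b)) (at (of_real y))"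
    by (simp add: eta_smooth_def w_def field_simps)
  from has_vector_derivative_real_field [OF this, of S] show ?thesis
    unfolding L [abs_def] b_def X_def w_def by simp
qed

text \<open>With t = 4 i a^2 s the exponent -(a x - a y)^2 / t is i (x - y)^2 / (4 s), and the
  Jacobian turns sqrt(pi) sqrt(t) / a into the root of 4 pi i s. Neither depends on a, so all
  coordinates can share one heat kernel.\<close>

lemma Psi_diff_eq_integral:
  assumes "a > 0" "s > 0" "p \<le> r"
  shows "((\<lambda>y. exp (\<i> * of_real ((x - y)\<^sup>2 / (4 * s))) * eta_smooth M (a * y)) has_integral
     csqrt (of_real (4 * pi * s) * \<i>) * (Psi M (a * x) (4 * \<i> * of_real (a\<^sup>2 * s)) (a * p)
       - Psi M (a * x) (4 * \<i> * of_real (a\<^sup>2 * s)) (a * r))) {p..r}"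
proof -
  define t where "t = 4 * \<i> * of_real (a\<^sup>2 * s)"
  define R where "R = csqrt (of_real (4 * pi * s) * \<i>)"
  have t: "Im t > 0" using assms by (simp add: t_def)
  have R: "R = of_real (sqrt pi) * csqrt t / of_real a"
    unfolding R_def
  proof (rule csqrt_unique)
    show "(of_real (sqrt pi) * csqrt t / of_real a)\<^sup>2 = of_real (4 * pi * s) * \<i>"
      using assms by (simp add: power_mult_distrib power_divide t_def flip: of_real_power)
    have "t \<noteq> 0" using t by auto
    have "Re (csqrt t) \<noteq> 0"
    proof
      assume "Re (csqrt t) = 0"
      moreover have "Im t = 2 * Re (csqrt t) * Im (csqrt t)"
        by (metis Im_power2 power2_csqrt)
      ultimately have "Im t = 0" by (metis mult_zero_left mult_zero_right)
      then show False using t by (metis less_irrefl)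
    qed
    then have "Re (csqrt t) > 0" using csqrt_principal [of t] by linarith
    then show "0 < Re (of_real (sqrt pi) * csqrt t / of_real a) \<or>
      Re (of_real (sqrt pi) * csqrt t / of_real a) = 0 \<and> 0 \<le> Im (of_real (sqrt pi) * csqrt t / of_real a)"
      using assms by (simp add: Re_divide_of_real)
  qed
  have "t \<noteq> 0" using t by auto
  have "((\<lambda>y. exp (\<i> * of_real ((x - y)\<^sup>2 / (4 * s))) * eta_smooth M (a * y)) has_integral
     - R * Psi M (a * x) t (a * r) - (- R * Psi M (a * x) t (a * p))) {p..r}"
  proof (rule fundamental_theorem_of_calculus)
    fix y
    have "((\<lambda>y. Psi M (a * x) t (a * y)) has_vector_derivative
        a *\<^sub>R (- exp (- (of_real (a * x - a * y))\<^sup>2 / t) * eta_smooth M (a * y) / (of_real (sqrt pi) * csqrt t))) (at y within {p..r})"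
      by (rule vector_diff_chain_within [unfolded o_def, OF _ has_vector_derivative_Psi [OF t]])
         (auto intro!: derivative_eq_intros)
    then have "((\<lambda>y. - R * Psi M (a * x) t (a * y)) has_vector_derivative
        - R * (a *\<^sub>R (- exp (- (of_real (a * x - a * y))\<^sup>2 / t) * eta_smooth M (a * y) / (of_real (sqrt pi) * csqrt t)))) (at y within {p..r})"
      by (rule has_vector_derivative_mult_right)
    also have "- R * (a *\<^sub>R (- exp (- (of_real (a * x - a * y))\<^sup>2 / t) * eta_smooth M (a * y) / (of_real (sqrt pi) * csqrt t)))
       = exp (- (of_real (a * x - a * y))\<^sup>2 / t) * eta_smooth M (a * y)"
      unfolding R using assms \<open>t \<noteq> 0\<close> by (simp add: scaleR_conv_of_real)
    also have "- (of_real (a * x - a * y))\<^sup>2 / t = \<i> * of_real ((x - y)\<^sup>2 / (4 * s))"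
    proof -
      have E: "complex_of_real (a * x - a * y) = of_real a * of_real (x - y)"
        by (simp add: algebra_simps)
      show ?thesis
        unfolding E power_mult_distrib t_def using assms by (simp add: field_simps del: of_real_diff)
    qed
    finally show "((\<lambda>y. - R * Psi M (a * x) t (a * y)) has_vector_derivative
        exp (\<i> * of_real ((x - y)\<^sup>2 / (4 * s))) * eta_smooth M (a * y)) (at y within {p..r})" .
  qed fact
  then show ?thesis by (simp add: R_def t_def algebra_simps)
qed

section \<open>Primitives of entire functions\<close>

text \<open>The integral of f over the segment from 0 to z. The explicit formula, rather than some
  chosen primitive, makes continuity in a parameter, conjugation and the value at 0
  immediate.\<close>

definition prim :: "(complex \<Rightarrow> complex) \<Rightarrow> complex \<Rightarrow> complex" where
  "prim f z = z * integral {0..1} (\<lambda>s. f (of_real s * z))"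

lemma prim_eqI:
  assumes "\<And>z. (G has_field_derivative f z) (at z)"
  shows "prim f z = G z - G 0"
proof -
  have "((\<lambda>s::real. z * f (of_real s * z)) has_integral G (of_real 1 * z) - G (of_real 0 * z)) {0..1}"
  proof (rule fundamental_theorem_of_calculus)
    fix s :: real
    have "((\<lambda>s. G (s * z)) has_field_derivative f (of_real s * z) * z) (at (of_real s))"
      by (rule DERIV_chain2 [OF assms]) (auto intro!: derivative_eq_intros)
    from has_vector_derivative_real_field [OF this]
    show "((\<lambda>s. G (of_real s * z)) has_vector_derivative z * f (of_real s * z)) (at s within {0..1})"
      by (simp add: mult.commute)
  qed simp
  from integral_unique [OF this] show ?thesis
    by (simp add: prim_def)
qed

lemma entire_primitive:
  assumes "f holomorphic_on UNIV"
  obtains G where "\<And>z. (G has_field_derivative f z) (at z)"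
  using holomorphic_convex_primitive' [OF convex_UNIV open_UNIV assms] by auto

lemma has_field_derivative_prim:
  assumes "f holomorphic_on UNIV"
  shows "(prim f has_field_derivative f z) (at z)"
proof -
  obtain G where G: "\<And>z. (G has_field_derivative f z) (at z)"
    using entire_primitive [OF assms] by blast
  then have "prim f = (\<lambda>z. G z - G 0)"
    using prim_eqI by blast
  moreover have "((\<lambda>z. G z - G 0) has_field_derivative f z) (at z)"
    by (auto intro!: derivative_eq_intros G)
  ultimately show ?thesis by simp
qed

text \<open>Path integrals are represented by differences of \<open>prim\<close>, so any other
  primitive may be used instead: substitutions and termwise integration below consist in exhibiting
  a suitable G.\<close>

lemma prim_diff_eqI:
  assumes "\<And>z. (G has_field_derivative f z) (at z)"
  shows "prim f z - prim f w = G z - G w"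
  unfolding prim_eqI [OF assms] by simp

text \<open>The increments of F are dominated by those of -(C / \<delta>) exp(-\<delta> t), so F is
  Cauchy. The tail bound is kept explicit because it is needed uniformly in the order.\<close>

lemma converges_exponential_tail:
  fixes F :: "real \<Rightarrow> complex"
  assumes F: "\<And>t. t \<ge> 0 \<Longrightarrow> (F has_vector_derivative f t) (at t)"
    and f: "\<And>t. t \<ge> 0 \<Longrightarrow> norm (f t) \<le> C * exp (- \<delta> * t)" and \<delta>: "\<delta> > 0"
  obtains L where "(F \<longlongrightarrow> L) at_top" "\<And>t. t \<ge> 0 \<Longrightarrow> norm (L - F t) \<le> C / \<delta> * exp (- \<delta> * t)"
proof -
  have "0 \<le> C" using order_trans [OF norm_ge_zero f [of 0]] by simp
  have diff: "norm (F t - F s) \<le> C / \<delta> * exp (- \<delta> * s)" if "0 \<le> s" "s \<le> t" for s t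
  proof (cases "s = t")
    case False
    have "norm (F t - F s) \<le> (- C / \<delta> * exp (- \<delta> * t)) - (- C / \<delta> * exp (- \<delta> * s))"
    proof (rule differentiable_bound_general)
      show "s < t" using that False by simp
      show "continuous_on {s..t} F"
      proof (intro continuous_at_imp_continuous_on ballI)
        show "isCont F x" if "x \<in> {s..t}" for x
          using has_vector_derivative_continuous [OF F [of x]] that \<open>0 \<le> s\<close> by simp
      qed
      show "continuous_on {s..t} (\<lambda>t. - C / \<delta> * exp (- \<delta> * t))"
        by (intro continuous_intros)
      show "(F has_vector_derivative f x) (at x)" if "s < x" for x
        using F that \<open>0 \<le> s\<close> by simp
      show "((\<lambda>t. - C / \<delta> * exp (- \<delta> * t)) has_vector_derivative C * exp (- \<delta> * x)) (at x)" for x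
        using \<delta> by (auto intro!: derivative_eq_intros simp flip: has_real_derivative_iff_has_vector_derivative)
      show "norm (f x) \<le> C * exp (- \<delta> * x)" if "s < x" for x
        using f that \<open>0 \<le> s\<close> by simp
    qed
    also have "\<dots> \<le> C / \<delta> * exp (- \<delta> * s)"
      using \<open>0 \<le> C\<close> \<delta> by simp
    finally show ?thesis .
  qed (use \<open>0 \<le> C\<close> \<delta> in simp)
  have lim0: "((\<lambda>t. C / \<delta> * exp (- \<delta> * t)) \<longlongrightarrow> 0) at_top"
    using \<delta> by real_asymp
  have "Cauchy (\<lambda>n. F (real n))"
  proof (rule CauchyI')
    fix e :: real assume "e > 0"
    have "eventually (\<lambda>t. C / \<delta> * exp (- \<delta> * t) < e) at_top"
      using order_tendstoD(2) [OF lim0 \<open>e > 0\<close>] .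
    then obtain N where N: "\<And>t. t \<ge> N \<Longrightarrow> C / \<delta> * exp (- \<delta> * t) < e"
      by (auto simp: eventually_at_top_linorder)
    show "\<exists>M. \<forall>m\<ge>M. \<forall>n>m. dist (F (real m)) (F (real n)) < e"
    proof (intro exI allI impI)
      fix m n assume "nat \<lceil>N\<rceil> \<le> m" "m < n"
      then have "dist (F (real m)) (F (real n)) \<le> C / \<delta> * exp (- \<delta> * real m)"
        using diff [of "real m" "real n"] by (simp add: dist_norm norm_minus_commute)
      also have "\<dots> < e" using N [of "real m"] \<open>nat \<lceil>N\<rceil> \<le> m\<close> by linarith
      finally show "dist (F (real m)) (F (real n)) < e" .
    qed
  qed
  then obtain L where L: "(\<lambda>n. F (real n)) \<longlonglongrightarrow> L"
    using Cauchy_convergent_iff convergent_def by blast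
  have bound: "norm (L - F t) \<le> C / \<delta> * exp (- \<delta> * t)" if "t \<ge> 0" for t
  proof (rule tendsto_le [OF _ tendsto_const])
    show "(\<lambda>n. norm (F (real n) - F t)) \<longlonglongrightarrow> norm (L - F t)"
      by (intro tendsto_intros L)
    show "eventually (\<lambda>n. norm (F (real n) - F t) \<le> C / \<delta> * exp (- \<delta> * t)) sequentially"
      using eventually_ge_at_top [of "nat \<lceil>t\<rceil>"]
      by eventually_elim (use diff that in \<open>simp add: nat_le_iff ceiling_le_iff\<close>)
  qed simp
  have "((\<lambda>t. F t - L) \<longlongrightarrow> 0) at_top"
  proof (rule Lim_null_comparison [OF _ lim0])
    show "eventually (\<lambda>t. norm (F t - L) \<le> C / \<delta> * exp (- \<delta> * t)) at_top"
      using eventually_ge_at_top [of 0] by eventually_elim (use bound in \<open>simp add: norm_minus_commute\<close>)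
  qed
  then have "(F \<longlongrightarrow> L) at_top" by (rule LIM_zero_cancel)
  with bound show ?thesis using that by blast
qed

lemma norm_diff_segment_le:
  assumes "\<And>z. (F has_field_derivative f z) (at z)"
    and "\<And>z. z \<in> closed_segment a b \<Longrightarrow> norm (f z) \<le> B"
  shows "norm (F b - F a) \<le> B * norm (b - a)"
  by (rule field_differentiable_bound [of "closed_segment a b"])
     (auto intro: has_field_derivative_at_within assms)

lemma norm_diff_vertical_le:
  assumes F: "\<And>z. (F has_field_derivative f z) (at z)" and "\<alpha> \<le> \<beta>"
    and f: "\<And>\<theta>. \<alpha> \<le> \<theta> \<Longrightarrow> \<theta> \<le> \<beta> \<Longrightarrow> norm (f (of_real t + \<i> * of_real \<theta>)) \<le> B"
  shows "norm (F (of_real t + \<i> * of_real \<beta>) - F (of_real t + \<i> * of_real \<alpha>)) \<le> B * (\<beta> - \<alpha>)"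
proof -
  have "norm (F (of_real t + \<i> * of_real \<beta>) - F (of_real t + \<i> * of_real \<alpha>))
     \<le> B * norm ((of_real t + \<i> * of_real \<beta>) - (of_real t + \<i> * of_real \<alpha>))"
  proof (rule norm_diff_segment_le [OF F])
    fix z assume "z \<in> closed_segment (of_real t + \<i> * of_real \<alpha>) (of_real t + \<i> * of_real \<beta>)"
    then obtain u where u: "0 \<le> u" "u \<le> 1"
      and z: "z = (1 - u) *\<^sub>R (of_real t + \<i> * of_real \<alpha>) + u *\<^sub>R (of_real t + \<i> * of_real \<beta>)"
      unfolding in_segment by blast
    have "z = of_real t + \<i> * of_real (\<alpha> + u * (\<beta> - \<alpha>))"
      unfolding z by (simp add: complex_eq_iff algebra_simps)
    moreover have "0 \<le> u * (\<beta> - \<alpha>)" "u * (\<beta> - \<alpha>) \<le> 1 * (\<beta> - \<alpha>)"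
      using u assms(2) by (intro mult_right_mono mult_nonneg_nonneg; simp)+
    then have "\<alpha> \<le> \<alpha> + u * (\<beta> - \<alpha>)" "\<alpha> + u * (\<beta> - \<alpha>) \<le> \<beta>"
      by auto
    ultimately show "norm (f z) \<le> B"
      using f by metis
  qed
  also have "(of_real t + \<i> * of_real \<beta>) - (of_real t + \<i> * of_real \<alpha>) = \<i> * of_real (\<beta> - \<alpha>)"
    by (simp add: algebra_simps)
  also have "norm (\<i> * of_real (\<beta> - \<alpha>)) = \<beta> - \<alpha>"
    using assms(2) by (simp add: norm_mult del: of_real_diff)
  finally show ?thesis .
qed

lemma entire_constant:
  assumes "\<And>z. (F has_field_derivative 0) (at z)"
  obtains c :: complex where "\<And>z. F z = c"
proof -
  have "\<exists>c. \<forall>z\<in>UNIV. F z = c"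
    using assms by (intro has_field_derivative_zero_constant) simp_all
  then show ?thesis using that by blast
qed

section \<open>The kernel of Schlaefli's integrals in logarithmic coordinates\<close>

text \<open>With u = exp z this is the integrand exp(a u - b / u) u^(-\<mu> - 1) du of Schlaefli's
  integrals. In z it is entire; the two sides of the cut of u^(-\<mu>) become the lines Im z = pi
  and Im z = -pi. For a = b = x / 2 the exponent is x sinh z - \<mu> z.\<close>

definition schlaefli :: "real \<Rightarrow> real \<Rightarrow> real \<Rightarrow> complex \<Rightarrow> complex" where
  "schlaefli a b \<mu> z = exp (of_real a * exp z - of_real b * exp (- z) - of_real \<mu> * z)"

definition schlaefli_prim :: "real \<Rightarrow> real \<Rightarrow> real \<Rightarrow> complex \<Rightarrow> complex" where
  "schlaefli_prim a b \<mu> = prim (schlaefli a b \<mu>)"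

lemma has_field_derivative_schlaefli_prim: "(schlaefli_prim a b \<mu> has_field_derivative schlaefli a b \<mu> z) (at z)"
  unfolding schlaefli_prim_def
  by (rule has_field_derivative_prim) (unfold schlaefli_def [abs_def], intro holomorphic_intros)

lemma schlaefli_prim_diff_eqI:
  assumes "\<And>z. (G has_field_derivative schlaefli a b \<mu> z) (at z)"
  shows "schlaefli_prim a b \<mu> z - schlaefli_prim a b \<mu> w = G z - G w"
  unfolding schlaefli_prim_def by (rule prim_diff_eqI) fact

lemma norm_schlaefli:
  "norm (schlaefli a b \<mu> (of_real t + \<i> * of_real \<theta>)) = exp ((a * exp t - b * exp (- t)) * cos \<theta> - \<mu> * t)"
  by (simp add: schlaefli_def Re_exp algebra_simps)

lemma has_vector_derivative_schlaefli_prim_horizontal: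
  "((\<lambda>t. schlaefli_prim a b \<mu> (of_real t + \<i> * of_real \<theta>)) has_vector_derivative
      schlaefli a b \<mu> (of_real t + \<i> * of_real \<theta>)) (at t within S)"
proof -
  have "((\<lambda>z. schlaefli_prim a b \<mu> (z + \<i> * of_real \<theta>)) has_field_derivative schlaefli a b \<mu> (of_real t + \<i> * of_real \<theta>) * 1) (at (of_real t))"
    by (rule DERIV_chain2 [OF has_field_derivative_schlaefli_prim]) (auto intro!: derivative_eq_intros)
  from has_vector_derivative_real_field [OF this] show ?thesis by simp
qed

lemma has_vector_derivative_schlaefli_prim_vertical:
  "((\<lambda>\<theta>. schlaefli_prim a b \<mu> (of_real t + \<i> * of_real \<theta>)) has_vector_derivative
      \<i> * schlaefli a b \<mu> (of_real t + \<i> * of_real \<theta>)) (at \<theta> within S)"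
proof -
  have "((\<lambda>z. schlaefli_prim a b \<mu> (of_real t + \<i> * z)) has_field_derivative schlaefli a b \<mu> (of_real t + \<i> * of_real \<theta>) * \<i>) (at (of_real \<theta>))"
    by (rule DERIV_chain2 [OF has_field_derivative_schlaefli_prim]) (auto intro!: derivative_eq_intros)
  from has_vector_derivative_real_field [OF this] show ?thesis by (simp add: mult.commute)
qed

text \<open>exp t \<ge> t^2 / 2 replaces the double exponential by a Gaussian; (m + 1)^2 / (2 c) is
  the maximum of (m + 1) t - c t^2 / 2. The order enters only through its bound m, which makes the
  later limits locally uniform in \<mu>.\<close>

lemma exp_decay_bound:
  fixes c m \<mu> t :: real
  assumes "c > 0" "t \<ge> 0" "\<bar>\<mu>\<bar> \<le> m"
  shows "exp (- c * exp t - \<mu> * t) \<le> exp ((m + 1)\<^sup>2 / (2 * c)) * exp (- t)"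
proof -
  have "c * (t\<^sup>2 / 2) \<le> c * exp t"
    using exp_lower_Taylor_quadratic [OF assms(2)] assms by (intro mult_left_mono) auto
  moreover have "- \<mu> * t \<le> m * t"
    using assms by (intro mult_right_mono) auto
  moreover have "c / 2 * (t - (m + 1) / c)\<^sup>2 = c * (t\<^sup>2 / 2) - (m + 1) * t + (m + 1)\<^sup>2 / (2 * c)"
  proof -
    define k where "k = (m + 1) / c"
    have "m + 1 = c * k" using assms by (simp add: k_def)
    then show ?thesis
      unfolding k_def [symmetric] using assms
      by (simp add: power2_diff power_mult_distrib algebra_simps power2_eq_square)
  qed
  moreover have "0 \<le> c / 2 * (t - (m + 1) / c)\<^sup>2"
    using assms by simp
  ultimately have "- c * exp t - \<mu> * t \<le> (m + 1)\<^sup>2 / (2 * c) + - t"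
    by (simp add: algebra_simps)
  then show ?thesis by (simp flip: exp_add)
qed

text \<open>On these lines exp z = -exp t, so the a-term decays doubly exponentially while the
  b-term stays below b.\<close>

lemma norm_schlaefli_right:
  assumes "a > 0" "b \<ge> 0" "t \<ge> 0" "\<bar>\<mu>\<bar> \<le> m" "cos \<theta> = - 1"
  shows "norm (schlaefli a b \<mu> (of_real t + \<i> * of_real \<theta>)) \<le> exp b * exp ((m + 1)\<^sup>2 / (2 * a)) * exp (- t)"
proof -
  have "norm (schlaefli a b \<mu> (of_real t + \<i> * of_real \<theta>)) = exp (b * exp (- t)) * exp (- a * exp t - \<mu> * t)"
    unfolding norm_schlaefli assms by (simp add: algebra_simps flip: exp_add)
  also have "b * exp (- t) \<le> b * 1"
    using assms by (intro mult_left_mono) auto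
  then have "exp (b * exp (- t)) * exp (- a * exp t - \<mu> * t) \<le> exp b * (exp ((m + 1)\<^sup>2 / (2 * a)) * exp (- t))"
    using assms by (intro mult_mono exp_decay_bound) auto
  finally show ?thesis by (simp add: mult.assoc)
qed

lemma norm_schlaefli_left:
  assumes "a \<ge> 0" "b > 0" "t \<ge> 0" "\<bar>\<mu>\<bar> \<le> m"
  shows "norm (schlaefli a b \<mu> (- of_real t)) \<le> exp a * exp ((m + 1)\<^sup>2 / (2 * b)) * exp (- t)"
proof -
  have "norm (schlaefli a b \<mu> (- of_real t)) = exp (a * exp (- t)) * exp (- b * exp t - (- \<mu>) * t)"
    using norm_schlaefli [of a b \<mu> "- t" 0] by (simp add: algebra_simps flip: exp_add)
  also have "a * exp (- t) \<le> a * 1"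
    using assms by (intro mult_left_mono) auto
  then have "exp (a * exp (- t)) * exp (- b * exp t - (- \<mu>) * t) \<le> exp a * (exp ((m + 1)\<^sup>2 / (2 * b)) * exp (- t))"
    using assms by (intro mult_mono exp_decay_bound) auto
  finally show ?thesis by (simp add: mult.assoc)
qed

lemma schlaefli_prim_right_limit:
  assumes "a > 0" "b \<ge> 0" "\<bar>\<mu>\<bar> \<le> m" "cos \<theta> = - 1"
  obtains L where "((\<lambda>t. schlaefli_prim a b \<mu> (of_real t + \<i> * of_real \<theta>)) \<longlongrightarrow> L) at_top"
    "\<And>t. t \<ge> 0 \<Longrightarrow> norm (L - schlaefli_prim a b \<mu> (of_real t + \<i> * of_real \<theta>)) \<le> exp b * exp ((m + 1)\<^sup>2 / (2 * a)) * exp (- t)"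
proof (rule converges_exponential_tail [of "\<lambda>t. schlaefli_prim a b \<mu> (of_real t + \<i> * of_real \<theta>)"
      "\<lambda>t. schlaefli a b \<mu> (of_real t + \<i> * of_real \<theta>)" "exp b * exp ((m + 1)\<^sup>2 / (2 * a))" 1])
qed (use that has_vector_derivative_schlaefli_prim_horizontal norm_schlaefli_right [OF assms(1,2) _ assms(3,4)] in simp_all)

lemma schlaefli_prim_left_limit:
  assumes "a \<ge> 0" "b > 0" "\<bar>\<mu>\<bar> \<le> m"
  obtains L where "((\<lambda>t. schlaefli_prim a b \<mu> (- of_real t)) \<longlongrightarrow> L) at_top"
    "\<And>t. t \<ge> 0 \<Longrightarrow> norm (L - schlaefli_prim a b \<mu> (- of_real t)) \<le> exp a * exp ((m + 1)\<^sup>2 / (2 * b)) * exp (- t)"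
proof (rule converges_exponential_tail [of "\<lambda>t. schlaefli_prim a b \<mu> (- of_real t)"
      "\<lambda>t. - schlaefli a b \<mu> (- of_real t)" "exp a * exp ((m + 1)\<^sup>2 / (2 * b))" 1])
  fix t :: real
  have "((\<lambda>z. schlaefli_prim a b \<mu> (- z)) has_field_derivative schlaefli a b \<mu> (- of_real t) * (- 1)) (at (of_real t))"
    by (rule DERIV_chain2 [OF has_field_derivative_schlaefli_prim]) (auto intro!: derivative_eq_intros)
  from has_vector_derivative_real_field [OF this]
  show "((\<lambda>t. schlaefli_prim a b \<mu> (- of_real t)) has_vector_derivative - schlaefli a b \<mu> (- of_real t)) (at t)"
    by simp
qed (use that norm_schlaefli_left [OF assms(1,2) _ assms(3)] in simp_all)

text \<open>Translating z by l dilates u by exp l, which keeps the product a b fixed and produces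
  the factor exp(\<mu> l). It serves twice: to reach a = 1 for the power series of
  \<open>besselJ\<close>, and to reach the exponent \<kappa>^2 \<tau> - r^2 / (4 \<tau>) of the heat
  kernels.\<close>

lemma schlaefli_prim_scale:
  "schlaefli_prim (a * exp l) (b * exp (- l)) \<mu> z - schlaefli_prim (a * exp l) (b * exp (- l)) \<mu> w
     = of_real (exp (\<mu> * l)) * (schlaefli_prim a b \<mu> (z + of_real l) - schlaefli_prim a b \<mu> (w + of_real l))"
proof -
  have "schlaefli_prim (a * exp l) (b * exp (- l)) \<mu> z - schlaefli_prim (a * exp l) (b * exp (- l)) \<mu> w
     = of_real (exp (\<mu> * l)) * schlaefli_prim a b \<mu> (z + of_real l) - of_real (exp (\<mu> * l)) * schlaefli_prim a b \<mu> (w + of_real l)"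
  proof (rule schlaefli_prim_diff_eqI)
    fix z
    have "((\<lambda>z. schlaefli_prim a b \<mu> (z + of_real l)) has_field_derivative schlaefli a b \<mu> (z + of_real l) * 1) (at z)"
      by (rule DERIV_chain2 [OF has_field_derivative_schlaefli_prim]) (auto intro!: derivative_eq_intros)
    note D = DERIV_cmult [OF this, of "of_real (exp (\<mu> * l))"]
    show "((\<lambda>z. of_real (exp (\<mu> * l)) * schlaefli_prim a b \<mu> (z + of_real l)) has_field_derivative
         schlaefli (a * exp l) (b * exp (- l)) \<mu> z) (at z)"
    proof -
      have "of_real (exp (\<mu> * l)) * schlaefli a b \<mu> (z + of_real l) = schlaefli (a * exp l) (b * exp (- l)) \<mu> z"
        unfolding schlaefli_def exp_of_real [symmetric] exp_add [symmetric]
        by (rule arg_cong [of _ _ exp]) (simp add: algebra_simps exp_add exp_diff exp_minus exp_of_real divide_inverse)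
      then show ?thesis
        using D by simp
    qed
  qed
  then show ?thesis by (simp add: right_diff_distrib)
qed

section \<open>Hankel's loop integral for the reciprocal Gamma function\<close>

text \<open>In u = exp z the path starts at -exp t below the cut, circles 0 and returns above it;
  path independence leaves only the end points.\<close>

definition hankel_loop :: "real \<Rightarrow> real \<Rightarrow> real \<Rightarrow> real \<Rightarrow> complex" where
  "hankel_loop a b \<mu> t = schlaefli_prim a b \<mu> (of_real t + \<i> * of_real pi) - schlaefli_prim a b \<mu> (of_real t + \<i> * of_real (- pi))"

lemma has_integral_tendsto_at_top:
  fixes f :: "real \<Rightarrow> real"
  assumes "(f has_integral I) {0..}"
  shows "((\<lambda>y. integral {0..y} f) \<longlongrightarrow> I) at_top"
proof (rule tendstoI)
  fix e :: real assume "e > 0"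
  then obtain B where B: "B > 0" "\<And>a b. ball 0 B \<subseteq> cbox a b \<Longrightarrow>
      norm (integral (cbox a b) (\<lambda>x. if x \<in> {0..} then f x else 0) - I) < e"
    using assms unfolding has_integral_alt' [of f] by meson
  show "eventually (\<lambda>y. dist (integral {0..y} f) I < e) at_top"
    using eventually_ge_at_top [of B]
  proof eventually_elim
    case (elim y)
    have "ball 0 B \<subseteq> cbox (- y) y" using elim by (auto simp: dist_norm)
    then have "norm (integral (cbox (- y) y) (\<lambda>x. if x \<in> {0..} then f x else 0) - I) < e"
      by (rule B)
    also have "integral (cbox (- y) y) (\<lambda>x. if x \<in> {0..} then f x else 0) = integral ({- y..y} \<inter> {0..}) f"
      by (simp only: integral_restrict_Int cbox_interval Int_commute)
    also have "{- y..y} \<inter> {0..} = {0..y}" using elim B(1) by auto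
    finally show ?case by (simp add: dist_norm)
  qed
qed

text \<open>For s < -1 the loop can be shrunk onto the cut: the circle around 0 vanishes in the
  limit, and the two sides give Gamma(-s) with the phases exp(-i pi s) and exp(i pi s), whose
  difference is a multiple of sin(pi s). The reflection formula then produces 1 / Gamma(1 +
  s).\<close>

lemma hankel_loop_base:
  assumes s: "s < - 1"
  shows "(hankel_loop 1 0 s \<longlongrightarrow> 2 * of_real pi * \<i> * rGamma (of_real (1 + s))) at_top"
proof -
  \<comment> \<open>The lower incomplete Gamma function at -s; s < -1 rather than s < 0 makes the
    integrand continuous at 0.\<close>
  define g where "g v = integral {0..v} (\<lambda>w. w powr (- s - 1) / exp w)" for v
  have cont: "continuous_on {0..} (\<lambda>w. w powr (- s - 1) / exp w)"
    using s by (intro continuous_intros continuous_on_powr') auto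
  have g': "(g has_vector_derivative v powr (- s - 1) / exp v) (at v)" if "v > 0" for v
  proof -
    have "(g has_vector_derivative v powr (- s - 1) / exp v) (at v within {0..v + 1})"
      unfolding g_def using that
      by (intro integral_has_vector_derivative continuous_on_subset [OF cont]) auto
    then show ?thesis using that
      by (metis at_within_Icc_at less_add_one)
  qed
  have gexp: "((\<lambda>u. g (exp u)) has_vector_derivative exp (- exp u - s * u)) (at u within S)" for u S
  proof -
    have "((\<lambda>u. g (exp u)) has_real_derivative (exp u powr (- s - 1) / exp (exp u)) * exp u) (at u)"
      by (rule DERIV_chain2 [OF _ DERIV_exp])
         (use g' in \<open>simp add: has_real_derivative_iff_has_vector_derivative\<close>)
    also have "(exp u powr (- s - 1) / exp (exp u)) * exp u = exp (- exp u - s * u)"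
      by (simp add: powr_def algebra_simps flip: exp_add exp_diff)
    finally show ?thesis
      by (simp add: has_real_derivative_iff_has_vector_derivative has_vector_derivative_at_within)
  qed
  have "(g \<longlongrightarrow> Gamma (- s)) at_top"
    unfolding g_def using Gamma_integral_real [of "- s"] s by (intro has_integral_tendsto_at_top) auto
  then have lim1: "((\<lambda>t. g (exp t)) \<longlongrightarrow> Gamma (- s)) at_top"
    by (rule filterlim_compose [OF _ exp_at_top])
  have "continuous_on {0..1} g"
    unfolding g_def
    by (intro indefinite_integral_continuous_1 integrable_continuous_real continuous_on_subset [OF cont]) auto
  then have "(g \<longlongrightarrow> g 0) (at 0 within {0..1})"
    by (auto simp: continuous_on)
  then have "(g \<longlongrightarrow> 0) (at_right 0)"
    by (simp add: g_def at_within_Icc_at_right)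
  moreover have "filterlim (\<lambda>t::real. exp (- t)) (at_right 0) at_top"
    by real_asymp
  ultimately have lim2: "((\<lambda>t. g (exp (- t))) \<longlongrightarrow> 0) at_top"
    by (rule filterlim_compose)
  have arm: "schlaefli_prim 1 0 s (of_real t + \<i> * of_real \<theta>) - schlaefli_prim 1 0 s (of_real (- t) + \<i> * of_real \<theta>)
     = exp (- \<i> * of_real (s * \<theta>)) * of_real (g (exp t) - g (exp (- t)))"
    if "cos \<theta> = - 1" "sin \<theta> = 0" "t \<ge> 0" for \<theta> t
  proof (rule has_integral_unique)
    show "((\<lambda>u. schlaefli 1 0 s (of_real u + \<i> * of_real \<theta>)) has_integral
       schlaefli_prim 1 0 s (of_real t + \<i> * of_real \<theta>) - schlaefli_prim 1 0 s (of_real (- t) + \<i> * of_real \<theta>)) {- t..t}"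
      using that by (intro fundamental_theorem_of_calculus has_vector_derivative_schlaefli_prim_horizontal) auto
    have "((\<lambda>u. exp (- exp u - s * u)) has_integral g (exp t) - g (exp (- t))) {- t..t}"
      using that by (intro fundamental_theorem_of_calculus gexp) auto
    from has_integral_mult_right [OF has_integral_of_real [OF this], of "exp (- \<i> * of_real (s * \<theta>))"]
    have "((\<lambda>u. exp (- \<i> * of_real (s * \<theta>)) * of_real (exp (- exp u - s * u))) has_integral 
       exp (- \<i> * of_real (s * \<theta>)) * of_real (g (exp t) - g (exp (- t)))) {- t..t}" .
    moreover have "exp (- \<i> * of_real (s * \<theta>)) * of_real (exp (- exp u - s * u)) = schlaefli 1 0 s (of_real u + \<i> * of_real \<theta>)" for u
    proof -
      have "exp (of_real u + \<i> * of_real \<theta>) = - of_real (exp u)"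
        using that by (simp add: complex_eq_iff Re_exp Im_exp)
      then show ?thesis
        unfolding schlaefli_def exp_of_real [symmetric] exp_add [symmetric]
        by (intro arg_cong [of _ _ exp]) (simp add: algebra_simps exp_of_real)
    qed
    ultimately show "((\<lambda>u. schlaefli 1 0 s (of_real u + \<i> * of_real \<theta>)) has_integral 
       exp (- \<i> * of_real (s * \<theta>)) * of_real (g (exp t) - g (exp (- t)))) {- t..t}"
      by simp
  qed
  \<comment> \<open>The circle of radius exp(-t): on it |u^(-s)| = exp(s t) tends to 0.\<close>
  have vert: "((\<lambda>t. hankel_loop 1 0 s (- t)) \<longlongrightarrow> 0) at_top"
  proof (rule Lim_null_comparison)
    show "eventually (\<lambda>t. norm (hankel_loop 1 0 s (- t)) \<le> exp (1 + s * t) * (2 * pi)) at_top"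
      using eventually_ge_at_top [of 0]
    proof eventually_elim
      case (elim t)
      have "norm (hankel_loop 1 0 s (- t)) \<le> exp (1 + s * t) * (pi - (- pi))"
        unfolding hankel_loop_def
      proof (rule norm_diff_vertical_le [OF has_field_derivative_schlaefli_prim])
        fix \<theta> :: real
        have "exp (- t) * cos \<theta> \<le> exp (- t) * 1"
          by (intro mult_left_mono) auto
        also have "\<dots> \<le> 1" using elim by simp
        finally show "norm (schlaefli 1 0 s (of_real (- t) + \<i> * of_real \<theta>)) \<le> exp (1 + s * t)"
          unfolding norm_schlaefli by simp
      qed simp
      also have "pi - (- pi) = 2 * pi" by simp
      finally show ?case .
    qed
    show "((\<lambda>t. exp (1 + s * t) * (2 * pi)) \<longlongrightarrow> 0) at_top"
      using s by real_asymp
  qed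
  have "((\<lambda>t. hankel_loop 1 0 s (- t) + (exp (- \<i> * of_real (s * pi)) - exp (- \<i> * of_real (s * (- pi)))) * of_real (g (exp t) - g (exp (- t))))
     \<longlongrightarrow> 0 + (exp (- \<i> * of_real (s * pi)) - exp (- \<i> * of_real (s * (- pi)))) * of_real (Gamma (- s) - 0)) at_top"
    by (intro tendsto_intros vert lim1 lim2)
  moreover have "eventually (\<lambda>t. hankel_loop 1 0 s (- t) + (exp (- \<i> * of_real (s * pi)) - exp (- \<i> * of_real (s * (- pi)))) * of_real (g (exp t) - g (exp (- t)))
     = hankel_loop 1 0 s t) at_top"
    using eventually_ge_at_top [of 0]
  proof eventually_elim
    case (elim t)
    show ?case
      unfolding left_diff_distrib arm [OF cos_pi sin_pi elim, symmetric]
        arm [of "- pi", simplified cos_minus sin_minus cos_pi sin_pi, OF refl _ elim, simplified neg_equal_0_iff_equal, OF refl, symmetric]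
      by (simp add: hankel_loop_def)
  qed
  ultimately have "(hankel_loop 1 0 s \<longlongrightarrow> 0 + (exp (- \<i> * of_real (s * pi)) - exp (- \<i> * of_real (s * (- pi)))) * of_real (Gamma (- s) - 0)) at_top"
    by (rule Lim_transform_eventually)
  also have "0 + (exp (- \<i> * of_real (s * pi)) - exp (- \<i> * of_real (s * (- pi)))) * of_real (Gamma (- s) - 0)
     = 2 * of_real pi * \<i> * rGamma (of_real (1 + s))"
  proof -
    have "rGamma (of_real (- s)) * rGamma (of_real (1 + s)) = (sin (of_real pi * of_real (- s)) / of_real pi :: complex)"
      using rGamma_reflection_complex [of "of_real (- s)"] by simp
    moreover have "Gamma (- s) * rGamma (- s) = 1"
      using s by (simp add: rGamma_inverse_Gamma Gamma_eq_zero_iff nonpos_Ints_def)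
    then have "of_real (Gamma (- s)) * rGamma (of_real (- s)) = (1 :: complex)"
      by (metis of_real_1 of_real_mult rGamma_complex_of_real)
    ultimately have "rGamma (of_real (1 + s)) = of_real (Gamma (- s)) * (sin (of_real pi * of_real (- s)) / of_real pi :: complex)"
      by (metis mult.assoc mult_1)
    moreover have "exp (- \<i> * of_real (s * pi)) - exp (- \<i> * of_real (s * (- pi))) = - 2 * \<i> * sin (of_real pi * of_real s)"
      by (simp add: sin_exp_eq field_simps)
    ultimately show ?thesis by simp
  qed
  finally show ?thesis .
qed

text \<open>At order 0 the integrand has period 2 pi i, so the loop is constant in t. Letting t tend
  to minus infinity, where the integrand tends to 1, gives the length of the segment. This order is
  separate because the recursion divides by s.\<close>

lemma hankel_loop_0: "hankel_loop 1 0 0 t = 2 * of_real pi * \<i>"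
proof -
  have const: "((\<lambda>z. schlaefli_prim 1 0 0 (z + 2 * of_real pi * \<i>) - schlaefli_prim 1 0 0 z) has_field_derivative 0) (at z)" for z
  proof -
    have "((\<lambda>z. schlaefli_prim 1 0 0 (z + 2 * of_real pi * \<i>)) has_field_derivative schlaefli 1 0 0 (z + 2 * of_real pi * \<i>) * 1) (at z)"
      by (rule DERIV_chain2 [OF has_field_derivative_schlaefli_prim]) (auto intro!: derivative_eq_intros)
    from DERIV_diff [OF this has_field_derivative_schlaefli_prim [of 1 0 0 z]]
    show ?thesis by (simp add: schlaefli_def exp_add exp_two_pi_i)
  qed
  obtain c where c: "\<And>z. schlaefli_prim 1 0 0 (z + 2 * of_real pi * \<i>) - schlaefli_prim 1 0 0 z = c"
    by (rule entire_constant [OF const]) blast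
  have loop: "hankel_loop 1 0 0 t = c" for t
    using c [of "of_real t + \<i> * of_real (- pi)"] by (simp add: hankel_loop_def algebra_simps)
  have "((\<lambda>t. hankel_loop 1 0 0 (- t) - 2 * of_real pi * \<i>) \<longlongrightarrow> 0) at_top"
  proof (rule Lim_null_comparison)
    show "eventually (\<lambda>t. norm (hankel_loop 1 0 0 (- t) - 2 * of_real pi * \<i>) \<le> (exp 1 * exp (- t)) * (2 * pi)) at_top"
      using eventually_ge_at_top [of 0]
    proof eventually_elim
      case (elim t)
      define F where "F z = schlaefli_prim 1 0 0 z - z" for z
      have le: "norm (F (of_real (- t) + \<i> * of_real pi) - F (of_real (- t) + \<i> * of_real (- pi)))
         \<le> (exp 1 * exp (- t)) * (pi - (- pi))"
      proof (rule norm_diff_vertical_le)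
        show "(F has_field_derivative schlaefli 1 0 0 z - 1) (at z)" for z
          unfolding F_def by (intro DERIV_diff has_field_derivative_schlaefli_prim DERIV_ident)
        fix \<theta> :: real
        define w where "w = exp (of_real (- t) + \<i> * of_real \<theta> :: complex)"
        have n: "norm w = exp (- t)" by (simp add: w_def)
        have "norm (exp w - exp 0) \<le> exp 1 * norm (w - 0)"
        proof (rule norm_diff_segment_le [OF DERIV_exp])
          fix z assume "z \<in> closed_segment 0 w"
          then have "norm z \<le> norm w"
            using segment_bound(1) [of z 0 w] by simp
          then have "Re z \<le> 1"
            using n elim complex_Re_le_cmod [of z] by (smt (verit) exp_le_one_iff)
          then show "norm (exp z) \<le> exp 1" by simp
        qed
        moreover have "schlaefli 1 0 0 (of_real (- t) + \<i> * of_real \<theta>) = exp w"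
          unfolding schlaefli_def w_def by simp
        ultimately show "norm (schlaefli 1 0 0 (of_real (- t) + \<i> * of_real \<theta>) - 1) \<le> exp 1 * exp (- t)"
          by (simp only: n exp_zero diff_zero)
      qed simp
      have eq: "F (of_real (- t) + \<i> * of_real pi) - F (of_real (- t) + \<i> * of_real (- pi)) = hankel_loop 1 0 0 (- t) - 2 * of_real pi * \<i>"
        by (simp add: F_def hankel_loop_def algebra_simps)
      have "pi - (- pi) = 2 * pi" by simp
      with le show ?case unfolding eq by (simp only:)
    qed
    show "((\<lambda>t. (exp 1 * exp (- t)) * (2 * pi)) \<longlongrightarrow> 0) at_top"
      by real_asymp
  qed
  then have "c - 2 * of_real pi * \<i> = 0"
    unfolding loop by (simp add: tendsto_const_iff)
  then show ?thesis by (simp add: loop)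
qed

text \<open>Integration by parts: the derivative of \<open>schlaefli 1 0 s\<close> is
  \<open>schlaefli 1 0 (s - 1)\<close> minus s times itself, and its end-point values vanish in the
  limit. This matches 1 / Gamma(s) = s / Gamma(1 + s).\<close>

lemma hankel_loop_step:
  assumes s: "s \<noteq> 0"
    and lim: "(hankel_loop 1 0 (s - 1) \<longlongrightarrow> 2 * of_real pi * \<i> * rGamma (of_real s)) at_top"
  shows "(hankel_loop 1 0 s \<longlongrightarrow> 2 * of_real pi * \<i> * rGamma (of_real (1 + s))) at_top"
proof -
  define G where "G z = schlaefli 1 0 s z" for z
  have G: "(G has_field_derivative schlaefli 1 0 (s - 1) z - of_real s * schlaefli 1 0 s z) (at z)" for z
  proof -
    have "(G has_field_derivative (exp z - of_real s) * schlaefli 1 0 s z) (at z)"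
      unfolding G_def schlaefli_def by (auto intro!: derivative_eq_intros)
    also have "(exp z - of_real s) * schlaefli 1 0 s z = schlaefli 1 0 (s - 1) z - of_real s * schlaefli 1 0 s z"
      by (simp add: schlaefli_def algebra_simps flip: exp_add)
    finally show ?thesis .
  qed
  have const: "((\<lambda>z. schlaefli_prim 1 0 (s - 1) z - of_real s * schlaefli_prim 1 0 s z - G z) has_field_derivative 0) (at z)" for z
    using DERIV_diff [OF DERIV_diff [OF has_field_derivative_schlaefli_prim [of 1 0 "s - 1" z] DERIV_cmult [OF has_field_derivative_schlaefli_prim [of 1 0 s z], of "of_real s"]] G [of z]]
    by simp
  obtain c where c: "\<And>z. schlaefli_prim 1 0 (s - 1) z - of_real s * schlaefli_prim 1 0 s z - G z = c"
    by (rule entire_constant [OF const]) blast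
  have eq: "hankel_loop 1 0 s t = (hankel_loop 1 0 (s - 1) t - (G (of_real t + \<i> * of_real pi) - G (of_real t + \<i> * of_real (- pi)))) / of_real s" for t
  proof -
    have "hankel_loop 1 0 (s - 1) t - of_real s * hankel_loop 1 0 s t
        = G (of_real t + \<i> * of_real pi) - G (of_real t + \<i> * of_real (- pi))"
    proof -
      have "schlaefli_prim 1 0 (s - 1) z = of_real s * schlaefli_prim 1 0 s z + G z + c" for z
        using c [of z] by (simp add: algebra_simps)
      then show ?thesis unfolding hankel_loop_def by (simp add: algebra_simps)
    qed
    then show ?thesis using s by (simp add: field_simps)
  qed
  have Glim: "((\<lambda>t. G (of_real t + \<i> * of_real \<theta>)) \<longlongrightarrow> 0) at_top" if "cos \<theta> = - 1" for \<theta>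
  proof (rule Lim_null_comparison)
    show "eventually (\<lambda>t. norm (G (of_real t + \<i> * of_real \<theta>)) \<le> exp 0 * exp ((\<bar>s\<bar> + 1)\<^sup>2 / (2 * 1)) * exp (- t)) at_top"
      using eventually_ge_at_top [of 0] unfolding G_def
      by eventually_elim (rule norm_schlaefli_right, use that in auto)
    show "((\<lambda>t. exp 0 * exp ((\<bar>s\<bar> + 1)\<^sup>2 / (2 * 1)) * exp (- t)) \<longlongrightarrow> 0) at_top"
      by real_asymp
  qed
  have "(hankel_loop 1 0 s \<longlongrightarrow> (2 * of_real pi * \<i> * rGamma (of_real s) - (0 - 0)) / of_real s) at_top"
    unfolding eq [abs_def] by (intro tendsto_intros lim Glim) (use s in auto)
  also have "(2 * of_real pi * \<i> * rGamma (of_real s) - (0 - 0)) / of_real s = 2 * of_real pi * \<i> * rGamma (of_real (1 + s))"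
    using rGamma_plus1 [of "of_real s :: complex"] s by (simp add: field_simps)
  finally show ?thesis .
qed

theorem hankel_loop_rGamma:
  "(hankel_loop 1 0 s \<longlongrightarrow> 2 * of_real pi * \<i> * rGamma (of_real (1 + s))) at_top"
proof -
  have "\<forall>s. s < real n - 1 \<longrightarrow> (hankel_loop 1 0 s \<longlongrightarrow> 2 * of_real pi * \<i> * rGamma (of_real (1 + s))) at_top" for n
  proof (induction n)
    case 0
    then show ?case using hankel_loop_base by simp
  next
    case (Suc n)
    show ?case
    proof (intro allI impI)
      fix s assume s: "s < real (Suc n) - 1"
      show "(hankel_loop 1 0 s \<longlongrightarrow> 2 * of_real pi * \<i> * rGamma (of_real (1 + s))) at_top"
      proof (cases "s = 0")
        case True
        then show ?thesis by (simp add: hankel_loop_0 [abs_def])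
      next
        case False
        have "(hankel_loop 1 0 (s - 1) \<longlongrightarrow> 2 * of_real pi * \<i> * rGamma (of_real (1 + (s - 1)))) at_top"
          using Suc.IH s by (intro Suc.IH [rule_format]) simp
        then show ?thesis by (intro hankel_loop_step False) simp
      qed
    qed
  qed
  moreover obtain n where "s < real n - 1"
    using reals_Archimedean2 [of "s + 1"] by (metis less_diff_eq)
  ultimately show ?thesis by blast
qed

section \<open>Integral representation of the Hankel function\<close>

text \<open>Expanding exp(-q exp(-z)) produces powers exp(-m z), which raise the order by m. The
  series of integrands converges uniformly on a disc around 0 that has z in its interior, so it can
  be integrated term by term.\<close>

lemma schlaefli_prim_series:
  fixes q \<mu> :: real
  defines "c \<equiv> \<lambda>m. complex_of_real ((- q) ^ m / fact m)"
  shows "summable (\<lambda>m. c m * schlaefli_prim 1 0 (\<mu> + real m) z)" (is ?S)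
    and "((\<lambda>z. \<Sum>m. c m * schlaefli_prim 1 0 (\<mu> + real m) z) has_field_derivative schlaefli 1 q \<mu> z) (at z)" (is ?D)
proof -
  define R where "R = norm z + 1"
  have R: "R \<ge> 0" by (simp add: R_def)
  define K where "K m = exp (exp R + \<bar>\<mu>\<bar> * R) * ((\<bar>q\<bar> * exp R) ^ m / fact m)" for m
  have "summable (\<lambda>m. (\<bar>q\<bar> * exp R) ^ m / fact m)"
    using summable_exp [of "\<bar>q\<bar> * exp R"] by (simp add: field_simps)
  then have K: "summable K"
    unfolding K_def by (rule summable_mult)
  have bound: "norm (c m * schlaefli 1 0 (\<mu> + real m) w) \<le> K m" if "w \<in> cball 0 R" for m w
  proof -
    have w: "\<bar>Re w\<bar> \<le> R" using that abs_Re_le_cmod [of w] by simp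
    have "Re (exp w) \<le> exp R"
      using complex_Re_le_cmod [of "exp w"] w by (simp add: order_trans [OF complex_Re_le_cmod])
    moreover have "- \<mu> * Re w \<le> \<bar>\<mu>\<bar> * R"
    proof -
      have "- \<mu> * Re w \<le> \<bar>- \<mu> * Re w\<bar>" by (rule abs_ge_self)
      also have "\<dots> = \<bar>\<mu>\<bar> * \<bar>Re w\<bar>" by (simp add: abs_mult)
      also have "\<dots> \<le> \<bar>\<mu>\<bar> * R" using w by (intro mult_left_mono) auto
      finally show ?thesis .
    qed
    moreover have "real m * (- Re w) \<le> real m * R"
      using w by (intro mult_left_mono) auto
    ultimately have "norm (schlaefli 1 0 (\<mu> + real m) w) \<le> exp (exp R + \<bar>\<mu>\<bar> * R + real m * R)"
      by (simp add: schlaefli_def algebra_simps)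
    also have "\<dots> = exp (exp R + \<bar>\<mu>\<bar> * R) * exp R ^ m"
      by (simp add: exp_add exp_of_nat_mult)
    finally have "norm (c m * schlaefli 1 0 (\<mu> + real m) w) \<le> \<bar>q\<bar> ^ m / fact m * (exp (exp R + \<bar>\<mu>\<bar> * R) * exp R ^ m)"
      unfolding norm_mult by (intro mult_mono) (auto simp: c_def norm_divide norm_power)
    then show ?thesis by (simp add: K_def power_mult_distrib mult_ac)
  qed
  have series: "uniformly_convergent_on (cball 0 R) (\<lambda>n w. \<Sum>m<n. c m * schlaefli 1 0 (\<mu> + real m) w)"
    by (rule Weierstrass_m_test' [OF bound K])
  have d: "((\<lambda>w. c m * schlaefli_prim 1 0 (\<mu> + real m) w) has_field_derivative c m * schlaefli 1 0 (\<mu> + real m) w) (at w within cball 0 R)" for m w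
    by (intro DERIV_cmult has_field_derivative_at_within [OF has_field_derivative_schlaefli_prim])
  have 0: "summable (\<lambda>m. c m * schlaefli_prim 1 0 (\<mu> + real m) 0)"
    by (simp add: schlaefli_prim_def prim_def)
  have z: "z \<in> interior (cball 0 R)"
    by (simp add: R_def)
  note * = has_field_derivative_series' [OF convex_cball d series _ 0 z]
  show ?S by (rule *(1)) (use R in simp)
  have "(\<Sum>m. c m * schlaefli 1 0 (\<mu> + real m) z) = schlaefli 1 q \<mu> z"
  proof -
    have "(\<lambda>m. (- (of_real q * exp (- z))) ^ m /\<^sub>R fact m) sums exp (- (of_real q * exp (- z)))"
      by (rule exp_converges)
    from sums_mult [OF this, of "exp (exp z - of_real \<mu> * z)"]
    have "(\<lambda>m. exp (exp z - of_real \<mu> * z) * ((- (of_real q * exp (- z))) ^ m /\<^sub>R fact m)) sums schlaefli 1 q \<mu> z"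
      by (simp add: schlaefli_def algebra_simps flip: exp_add)
    moreover have "exp (exp z - of_real \<mu> * z) * ((- (of_real q * exp (- z))) ^ m /\<^sub>R fact m) = c m * schlaefli 1 0 (\<mu> + real m) z" for m
    proof -
      have "schlaefli 1 0 (\<mu> + real m) z = exp (exp z - of_real \<mu> * z) * exp (of_nat m * (- z))"
        unfolding schlaefli_def exp_add [symmetric] by (rule arg_cong [of _ _ exp]) (simp add: algebra_simps)
      also have "exp (of_nat m * (- z)) = exp (- z) ^ m" by (rule exp_of_nat_mult)
      finally show ?thesis
        by (simp add: c_def scaleR_conv_of_real power_minus [of "of_real q * exp (- z)"]
            power_minus [of "of_real q"] power_mult_distrib divide_inverse)
    qed
    ultimately show ?thesis by (simp add: sums_iff)
  qed
  moreover have "((\<lambda>z. \<Sum>m. c m * schlaefli_prim 1 0 (\<mu> + real m) z) has_field_derivative (\<Sum>m. c m * schlaefli 1 0 (\<mu> + real m) z)) (at z)"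
    by (rule *(2)) (use R in simp)
  ultimately show ?D by simp
qed

lemma hankel_loop_series:
  "hankel_loop 1 q \<mu> t = (\<Sum>m. of_real ((- q) ^ m / fact m) * hankel_loop 1 0 (\<mu> + real m) t)"
  unfolding hankel_loop_def schlaefli_prim_diff_eqI [OF schlaefli_prim_series(2) [where q = q and \<mu> = \<mu>]] right_diff_distrib
  by (intro suminf_diff schlaefli_prim_series(1))

text \<open>The path is routed along Re z = 0: on the arms with Re z \<ge> 0 the factor exp(-m Re z)
  is at most 1, and on the vertical segment of length 2 pi the integrand is at most e. Independence
  of m and t is what Tannery's theorem asks for.\<close>

lemma norm_hankel_loop_le:
  assumes "t \<ge> 0"
  shows "norm (hankel_loop 1 0 (\<mu> + real m) t) \<le> 4 * exp ((\<bar>\<mu>\<bar> + 1)\<^sup>2 / 2) + 2 * pi * exp 1"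
proof -
  define C where "C = exp ((\<bar>\<mu>\<bar> + 1)\<^sup>2 / 2)"
  have arm: "norm (schlaefli_prim 1 0 (\<mu> + real m) (of_real t + \<i> * of_real \<theta>) - schlaefli_prim 1 0 (\<mu> + real m) (of_real 0 + \<i> * of_real \<theta>)) \<le> 2 * C"
    if "cos \<theta> = - 1" for \<theta>
  proof -
    have decay: "norm (schlaefli 1 0 (\<mu> + real m) (of_real u + \<i> * of_real \<theta>)) \<le> C * exp (- 1 * u)" if "u \<ge> 0" for u
    proof -
      have "norm (schlaefli 1 0 (\<mu> + real m) (of_real u + \<i> * of_real \<theta>)) \<le> norm (schlaefli 1 0 \<mu> (of_real u + \<i> * of_real \<theta>))"
        unfolding norm_schlaefli using that by (simp add: algebra_simps)
      also have "\<dots> \<le> exp 0 * exp ((\<bar>\<mu>\<bar> + 1)\<^sup>2 / (2 * 1)) * exp (- u)"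
        using that \<open>cos \<theta> = - 1\<close> by (intro norm_schlaefli_right) auto
      finally show ?thesis by (simp add: C_def)
    qed
    obtain L where "((\<lambda>t. schlaefli_prim 1 0 (\<mu> + real m) (of_real t + \<i> * of_real \<theta>)) \<longlongrightarrow> L) at_top"
      and L0: "\<And>t. t \<ge> 0 \<Longrightarrow> norm (L - schlaefli_prim 1 0 (\<mu> + real m) (of_real t + \<i> * of_real \<theta>)) \<le> C / 1 * exp (- 1 * t)"
    proof (rule converges_exponential_tail [of "\<lambda>t. schlaefli_prim 1 0 (\<mu> + real m) (of_real t + \<i> * of_real \<theta>)"
          "\<lambda>t. schlaefli 1 0 (\<mu> + real m) (of_real t + \<i> * of_real \<theta>)" C 1])
    qed (use that decay has_vector_derivative_schlaefli_prim_horizontal in simp_all)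
    have L: "norm (L - schlaefli_prim 1 0 (\<mu> + real m) (of_real t + \<i> * of_real \<theta>)) \<le> C" if "t \<ge> 0" for t
    proof -
      have "C / 1 * exp (- 1 * t) \<le> C * 1"
        using that unfolding div_by_1 by (intro mult_left_mono) (auto simp: C_def)
      with L0 [OF that] show ?thesis by linarith
    qed
    show ?thesis
      using norm_triangle_ineq4 [of "L - schlaefli_prim 1 0 (\<mu> + real m) (of_real 0 + \<i> * of_real \<theta>)" "L - schlaefli_prim 1 0 (\<mu> + real m) (of_real t + \<i> * of_real \<theta>)"]
        L [OF assms] L [of 0] by (simp add: algebra_simps)
  qed
  have mid: "norm (schlaefli_prim 1 0 (\<mu> + real m) (of_real 0 + \<i> * of_real pi) - schlaefli_prim 1 0 (\<mu> + real m) (of_real 0 + \<i> * of_real (- pi))) \<le> exp 1 * (pi - (- pi))"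
    by (rule norm_diff_vertical_le [OF has_field_derivative_schlaefli_prim]) (unfold norm_schlaefli, auto)
  define X Y X' Y' where "X = schlaefli_prim 1 0 (\<mu> + real m) (of_real t + \<i> * of_real pi)"
    and "Y = schlaefli_prim 1 0 (\<mu> + real m) (of_real 0 + \<i> * of_real pi)"
    and "X' = schlaefli_prim 1 0 (\<mu> + real m) (of_real t + \<i> * of_real (- pi))"
    and "Y' = schlaefli_prim 1 0 (\<mu> + real m) (of_real 0 + \<i> * of_real (- pi))"
  have "norm (X - X') \<le> norm (X - Y) + norm (Y - Y') + norm (X' - Y')"
    using norm_triangle_ineq4 [of "(X - Y) + (Y - Y')" "X' - Y'"] norm_triangle_ineq [of "X - Y" "Y - Y'"]
    by (simp add: algebra_simps)
  also have "\<dots> \<le> 2 * C + exp 1 * (pi - (- pi)) + 2 * C"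
    using arm [of pi] arm [of "- pi"] mid unfolding X_def Y_def X'_def Y'_def by (intro add_mono) auto
  finally show ?thesis
    unfolding hankel_loop_def X_def [symmetric] X'_def [symmetric] by (simp add: C_def algebra_simps)
qed

text \<open>By Tannery's theorem the limit may be taken in each term, where it is a value of the
  reciprocal Gamma function; this gives the defining series of \<open>besselJ\<close>.\<close>

lemma hankel_loop_besselJ:
  assumes x: "x > 0"
  shows "(hankel_loop (x / 2) (x / 2) \<mu> \<longlongrightarrow> 2 * of_real pi * \<i> * of_real (besselJ \<mu> x)) at_top"
proof -
  \<comment> \<open>Dilation by exp l = x / 2 carries the parameters (1, q) to (x / 2, x / 2), and
    exp(\<mu> l) q^m = (x / 2)^(2 m + \<mu>).\<close>
  define q l where "q = x\<^sup>2 / 4" and "l = ln (x / 2)"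
  define B where "B = 4 * exp ((\<bar>\<mu>\<bar> + 1)\<^sup>2 / 2) + 2 * pi * exp 1"
  define b where "b m = of_real ((- q) ^ m / fact m) * (2 * of_real pi * \<i> * rGamma (of_real (1 + (\<mu> + real m))))" for m
  have "summable (\<lambda>m. \<bar>q\<bar> ^ m / fact m)"
    using summable_exp [of "\<bar>q\<bar>"] by (simp add: field_simps)
  then have sB: "summable (\<lambda>m. \<bar>q\<bar> ^ m / fact m * B)"
    by (rule summable_mult2)
  have ev: "eventually (\<lambda>(m, t). norm (of_real ((- q) ^ m / fact m) * hankel_loop 1 0 (\<mu> + real m) t) \<le> \<bar>q\<bar> ^ m / fact m * B) (at_top \<times>\<^sub>F at_top)"
    unfolding eventually_prod_filter
  proof (intro exI conjI allI impI)
    show "eventually (\<lambda>t::real. t \<ge> 0) at_top" by (rule eventually_ge_at_top)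
    show "eventually (\<lambda>m::nat. True) at_top" by simp
    fix m :: nat and t :: real assume "t \<ge> 0"
    from norm_hankel_loop_le [OF this, of \<mu> m]
    show "case (m, t) of (m, t) \<Rightarrow> norm (of_real ((- q) ^ m / fact m) * hankel_loop 1 0 (\<mu> + real m) t) \<le> \<bar>q\<bar> ^ m / fact m * B"
      unfolding prod.case norm_mult B_def by (intro mult_mono) (auto simp: norm_divide norm_power)
  qed
  have T: "eventually (\<lambda>t. summable (\<lambda>m. norm (of_real ((- q) ^ m / fact m) * hankel_loop 1 0 (\<mu> + real m) t))) at_top \<and>
      summable (\<lambda>m. norm (b m)) \<and>
      ((\<lambda>t. \<Sum>m. of_real ((- q) ^ m / fact m) * hankel_loop 1 0 (\<mu> + real m) t) \<longlongrightarrow> suminf b) at_top"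
    using ev sB unfolding b_def
    by (intro tannerys_theorem [where M = "\<lambda>m. \<bar>q\<bar> ^ m / fact m * B"] tendsto_intros hankel_loop_rGamma) auto
  have "(\<lambda>t. \<Sum>m. of_real ((- q) ^ m / fact m) * hankel_loop 1 0 (\<mu> + real m) t) = hankel_loop 1 q \<mu>"
    by (rule ext) (rule hankel_loop_series [symmetric])
  with T have sb: "summable b" and lim: "(hankel_loop 1 q \<mu> \<longlongrightarrow> suminf b) at_top"
    by (auto intro: summable_norm_cancel)
  have "filterlim (\<lambda>t. t + l) at_top at_top"
    by real_asymp
  from filterlim_compose [OF lim this]
  have "((\<lambda>t. of_real (exp (\<mu> * l)) * hankel_loop 1 q \<mu> (t + l)) \<longlongrightarrow> of_real (exp (\<mu> * l)) * suminf b) at_top"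
    by (intro tendsto_intros) 
  also have "(\<lambda>t. of_real (exp (\<mu> * l)) * hankel_loop 1 q \<mu> (t + l)) = hankel_loop (x / 2) (x / 2) \<mu>"
  proof
    fix t
    have e: "1 * exp l = x / 2" "q * exp (- l) = x / 2"
      using x by (auto simp: q_def l_def exp_minus field_simps power2_eq_square)
    have "hankel_loop (1 * exp l) (q * exp (- l)) \<mu> t = of_real (exp (\<mu> * l)) * hankel_loop 1 q \<mu> (t + l)"
      unfolding hankel_loop_def by (subst schlaefli_prim_scale) (simp add: algebra_simps)
    then show "of_real (exp (\<mu> * l)) * hankel_loop 1 q \<mu> (t + l) = hankel_loop (x / 2) (x / 2) \<mu> t"
      unfolding e by simp
  qed
  also have "of_real (exp (\<mu> * l)) * suminf b = 2 * of_real pi * \<i> * of_real (besselJ \<mu> x)"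
  proof -
    define j where "j m = (-1) ^ m / fact m * rGamma (real m + \<mu> + 1) * (x / 2) powr (2 * real m + \<mu>)" for m
    have bj: "of_real (exp (\<mu> * l)) * b m = 2 * of_real pi * \<i> * of_real (j m)" for m
    proof -
      have "(x / 2) powr (2 * real m + \<mu>) = exp (\<mu> * l) * q ^ m"
      proof -
        have "(x / 2) powr (2 * real m + \<mu>) = (x / 2) powr \<mu> * (x / 2) powr real (2 * m)"
          by (simp add: powr_add)
        also have "(x / 2) powr real (2 * m) = q ^ m"
          using x by (subst powr_realpow) (auto simp: q_def power_mult power_divide)
        finally show ?thesis using x by (simp add: powr_def l_def)
      qed
      moreover have "rGamma (of_real (1 + (\<mu> + real m))) = complex_of_real (rGamma (real m + \<mu> + 1))"
        unfolding rGamma_complex_of_real [symmetric] by (simp add: algebra_simps)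
      ultimately show ?thesis
        by (simp add: b_def j_def power_minus [of q])
    qed
    have "summable (\<lambda>m. of_real (exp (\<mu> * l)) * b m)"
      using sb by (rule summable_mult)
    then have "summable (\<lambda>m. complex_of_real (j m))"
      unfolding bj by (simp add: summable_cmult_iff mult.assoc)
    then have "(\<Sum>m. complex_of_real (j m)) = of_real (besselJ \<mu> x)"
      unfolding besselJ_def j_def [symmetric] by (simp add: suminf_of_real summable_of_real_iff)
    then show ?thesis
      using suminf_mult [OF sb, of "of_real (exp (\<mu> * l))"] suminf_mult [OF \<open>summable (\<lambda>m. complex_of_real (j m))\<close>]
      by (simp add: bj)
  qed
  finally show ?thesis .
qed

section \<open>Bessel functions of both kinds from one contour integral\<close>

definition hankel_path :: "real \<Rightarrow> real \<Rightarrow> real \<Rightarrow> complex" where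
  "hankel_path x \<mu> t = schlaefli_prim (x / 2) (x / 2) \<mu> (of_real t + \<i> * of_real pi) - schlaefli_prim (x / 2) (x / 2) \<mu> (- of_real t)"

lemma cnj_schlaefli_prim: "cnj (schlaefli_prim a b \<mu> z) = schlaefli_prim a b \<mu> (cnj z)"
proof -
  have "cnj (schlaefli a b \<mu> w) = schlaefli a b \<mu> (cnj w)" for w
    by (simp add: schlaefli_def exp_cnj)
  then show ?thesis by (simp add: schlaefli_prim_def prim_def integral_cnj)
qed

text \<open>The left end -t is real, so it cancels, and the ends t + i pi and t - i pi of the loop
  remain.\<close>

lemma hankel_path_cnj: "hankel_path x \<mu> t - cnj (hankel_path x \<mu> t) = hankel_loop (x / 2) (x / 2) \<mu> t"
  by (simp add: hankel_path_def hankel_loop_def cnj_schlaefli_prim)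

text \<open>The substitution of i pi - z for z preserves sinh z and exchanges the two end points of
  the truncated path, so the reflection in the order is exact already for finite t.\<close>

lemma hankel_path_minus:
  "hankel_path x (- \<mu>) t = exp (\<i> * of_real (pi * \<mu>)) * hankel_path x \<mu> t"
proof -
  define c where "c = x / 2"
  have "schlaefli_prim c c (- \<mu>) z - schlaefli_prim c c (- \<mu>) w
     = - exp (\<i> * of_real (pi * \<mu>)) * schlaefli_prim c c \<mu> (\<i> * of_real pi - z) - (- exp (\<i> * of_real (pi * \<mu>)) * schlaefli_prim c c \<mu> (\<i> * of_real pi - w))" for z w
  proof (rule schlaefli_prim_diff_eqI)
    fix z
    have "((\<lambda>z. schlaefli_prim c c \<mu> (\<i> * of_real pi - z)) has_field_derivative schlaefli c c \<mu> (\<i> * of_real pi - z) * (- 1)) (at z)"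
      by (rule DERIV_chain2 [OF has_field_derivative_schlaefli_prim]) (auto intro!: derivative_eq_intros)
    note D = DERIV_cmult [OF this, of "- exp (\<i> * of_real (pi * \<mu>))"]
    have e: "exp (\<i> * of_real pi - z) = - exp (- z)" "exp (- (\<i> * of_real pi - z)) = - exp z"
      by (simp_all add: exp_diff exp_minus field_simps)
    have "exp (\<i> * of_real (pi * \<mu>)) * schlaefli c c \<mu> (\<i> * of_real pi - z) = schlaefli c c (- \<mu>) z"
      unfolding schlaefli_def exp_add [symmetric] e by (rule arg_cong [of _ _ exp]) (simp add: algebra_simps)
    then show "((\<lambda>z. - exp (\<i> * of_real (pi * \<mu>)) * schlaefli_prim c c \<mu> (\<i> * of_real pi - z)) has_field_derivative schlaefli c c (- \<mu>) z) (at z)"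
      using D by simp
  qed
  from this [of "of_real t + \<i> * of_real pi" "- of_real t"] show ?thesis
    unfolding hankel_path_def c_def [symmetric] by (simp add: algebra_simps)
qed

definition hankel_int :: "real \<Rightarrow> real \<Rightarrow> complex" where
  "hankel_int x \<mu> = Lim at_top (hankel_path x \<mu>)"

lemma hankel_path_limit:
  assumes "x > 0" "\<bar>\<mu>\<bar> \<le> m"
  shows "(hankel_path x \<mu> \<longlongrightarrow> hankel_int x \<mu>) at_top" (is ?L)
    and "t \<ge> 0 \<Longrightarrow> norm (hankel_path x \<mu> t - hankel_int x \<mu>) \<le> 2 * exp (x / 2) * exp ((m + 1)\<^sup>2 / x) * exp (- t)"
proof -
  define c where "c = x / 2"
  have c: "c > 0" using assms by (simp add: c_def)
  obtain A where A: "((\<lambda>t. schlaefli_prim c c \<mu> (of_real t + \<i> * of_real pi)) \<longlongrightarrow> A) at_top"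
    "\<And>t. t \<ge> 0 \<Longrightarrow> norm (A - schlaefli_prim c c \<mu> (of_real t + \<i> * of_real pi)) \<le> exp c * exp ((m + 1)\<^sup>2 / (2 * c)) * exp (- t)"
    using schlaefli_prim_right_limit [of c c \<mu> m pi] c assms by auto
  obtain B where B: "((\<lambda>t. schlaefli_prim c c \<mu> (- of_real t)) \<longlongrightarrow> B) at_top"
    "\<And>t. t \<ge> 0 \<Longrightarrow> norm (B - schlaefli_prim c c \<mu> (- of_real t)) \<le> exp c * exp ((m + 1)\<^sup>2 / (2 * c)) * exp (- t)"
    using schlaefli_prim_left_limit [of c c \<mu> m] c assms by auto
  have lim: "(hankel_path x \<mu> \<longlongrightarrow> A - B) at_top"
    unfolding hankel_path_def [abs_def] c_def [symmetric] by (intro tendsto_intros A B)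
  then have AB: "hankel_int x \<mu> = A - B"
    unfolding hankel_int_def by (intro tendsto_Lim) auto
  with lim show ?L by simp
  assume t: "t \<ge> 0"
  have "norm (hankel_path x \<mu> t - hankel_int x \<mu>)
      = norm ((B - schlaefli_prim c c \<mu> (- of_real t)) - (A - schlaefli_prim c c \<mu> (of_real t + \<i> * of_real pi)))"
    unfolding hankel_path_def c_def [symmetric] AB by (simp add: algebra_simps)
  also have "\<dots> \<le> 2 * (exp c * exp ((m + 1)\<^sup>2 / (2 * c)) * exp (- t))"
    using norm_triangle_ineq4 [of "B - schlaefli_prim c c \<mu> (- of_real t)" "A - schlaefli_prim c c \<mu> (of_real t + \<i> * of_real pi)"] A(2) [OF t] B(2) [OF t]
    by linarith
  finally show "norm (hankel_path x \<mu> t - hankel_int x \<mu>) \<le> 2 * exp (x / 2) * exp ((m + 1)\<^sup>2 / x) * exp (- t)"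
    by (simp add: c_def)
qed

text \<open>For finite t continuity in the order is that of integrals over compact segments; the
  tail bound, uniform for |\<mu>| \<le> m, carries it to the limit. The choice m = |\<nu>| + 1 keeps
  \<nu> in the interior.\<close>

lemma continuous_hankel_int:
  assumes x: "x > 0"
  shows "isCont (hankel_int x) \<nu>"
proof -
  define m where "m = \<bar>\<nu>\<bar> + 1"
  have schlaefli_prim: "continuous_on U (\<lambda>\<mu>. schlaefli_prim c c \<mu> z)" for U c z
  proof -
    have "continuous_on U (\<lambda>\<mu>. integral (cbox 0 1) (\<lambda>s::real. schlaefli c c \<mu> (of_real s * z)))"
      by (rule integral_continuous_on_param)
         (unfold schlaefli_def split_def, intro continuous_intros)
    then show ?thesis
      unfolding schlaefli_prim_def prim_def by (auto intro!: continuous_intros)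
  qed
  have "uniform_limit {- m..m} (\<lambda>t \<mu>. hankel_path x \<mu> t) (hankel_int x) at_top"
  proof (rule uniform_limitI)
    fix e :: real assume e: "e > 0"
    have "((\<lambda>t. 2 * exp (x / 2) * exp ((m + 1)\<^sup>2 / x) * exp (- t)) \<longlongrightarrow> 0) at_top"
      by real_asymp
    then have "eventually (\<lambda>t. 2 * exp (x / 2) * exp ((m + 1)\<^sup>2 / x) * exp (- t) < e) at_top"
      using e by (rule order_tendstoD)
    then show "eventually (\<lambda>t. \<forall>\<mu>\<in>{- m..m}. dist (hankel_path x \<mu> t) (hankel_int x \<mu>) < e) at_top"
      using eventually_ge_at_top [of 0]
    proof eventually_elim
      case (elim t)
      show ?case
      proof
        fix \<mu> assume "\<mu> \<in> {- m..m}"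
        then have "\<bar>\<mu>\<bar> \<le> m" by auto
        from hankel_path_limit(2) [OF x this elim(2)] elim(1)
        show "dist (hankel_path x \<mu> t) (hankel_int x \<mu>) < e" by (simp add: dist_norm)
      qed
    qed
  qed
  then have "continuous_on {- m..m} (hankel_int x)"
    by (rule uniform_limit_theorem [rotated])
       (auto simp: hankel_path_def intro!: always_eventually continuous_intros schlaefli_prim)
  then show ?thesis
    by (rule continuous_on_interior) (auto simp: m_def)
qed

lemma besselJ_eq_Im: "x > 0 \<Longrightarrow> Im (hankel_int x \<mu>) = pi * besselJ \<mu> x"
proof -
  assume x: "x > 0"
  have "((\<lambda>t. hankel_path x \<mu> t - cnj (hankel_path x \<mu> t)) \<longlongrightarrow> hankel_int x \<mu> - cnj (hankel_int x \<mu>)) at_top"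
    by (intro tendsto_intros hankel_path_limit [OF x order_refl])
  then have "hankel_int x \<mu> - cnj (hankel_int x \<mu>) = 2 * of_real pi * \<i> * of_real (besselJ \<mu> x)"
    unfolding hankel_path_cnj using hankel_loop_besselJ [OF x] by (intro tendsto_unique) auto
  then show ?thesis by (simp add: complex_eq_iff)
qed

lemma hankel_int_minus: "x > 0 \<Longrightarrow> hankel_int x (- \<mu>) = exp (\<i> * of_real (pi * \<mu>)) * hankel_int x \<mu>"
proof -
  assume x: "x > 0"
  have "((\<lambda>t. exp (\<i> * of_real (pi * \<mu>)) * hankel_path x \<mu> t) \<longlongrightarrow> exp (\<i> * of_real (pi * \<mu>)) * hankel_int x \<mu>) at_top"
    by (intro tendsto_intros hankel_path_limit [OF x order_refl])
  then show ?thesis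
    unfolding hankel_path_minus [symmetric]
    using hankel_path_limit(1) [OF x order_refl, of "- \<mu>"] by (intro tendsto_unique) auto
qed

text \<open>When sin(\<mu> pi) \<noteq> 0, the imaginary parts at \<mu> and -\<mu> turn the quotient
  in \<open>besselY\<close> into -Re (\<open>hankel_int x \<mu>\<close>) / pi. This is continuous in
  \<mu>, so the limit is its value at \<nu>.\<close>

theorem hankel1_eq_hankel_int:
  assumes x: "x > 0" and \<nu>: "2 * \<nu> \<in> \<int>"
  shows "hankel_int x \<nu> = of_real pi * \<i> * hankel1 \<nu> x"
proof -
  have quot: "(besselJ \<mu> x * cos (\<mu> * pi) - besselJ (- \<mu>) x) / sin (\<mu> * pi) = - Re (hankel_int x \<mu>) / pi"
    if s: "sin (\<mu> * pi) \<noteq> 0" for \<mu>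
  proof -
    have "pi * besselJ (- \<mu>) x = cos (\<mu> * pi) * Im (hankel_int x \<mu>) + sin (\<mu> * pi) * Re (hankel_int x \<mu>)"
      using besselJ_eq_Im [OF x, of "- \<mu>"] unfolding hankel_int_minus [OF x]
      by (simp add: Re_exp Im_exp mult.commute)
    then have "pi * (besselJ \<mu> x * cos (\<mu> * pi) - besselJ (- \<mu>) x) = - sin (\<mu> * pi) * Re (hankel_int x \<mu>)"
      unfolding besselJ_eq_Im [OF x] by (simp add: algebra_simps)
    then show ?thesis using s by (simp add: field_simps)
  qed
  \<comment> \<open>Since 2 \<nu> is an integer, no integer other than possibly \<nu> itself is
    closer to \<nu> than 1/2.\<close>
  have "eventually (\<lambda>\<mu>. dist \<mu> \<nu> < 1 / 2 \<and> \<mu> \<noteq> \<nu>) (at \<nu>)"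
    unfolding eventually_at by (intro exI [of _ "1 / 2"]) auto
  then have "eventually (\<lambda>\<mu>. - Re (hankel_int x \<mu>) / pi = (besselJ \<mu> x * cos (\<mu> * pi) - besselJ (- \<mu>) x) / sin (\<mu> * pi)) (at \<nu>)"
  proof eventually_elim
    case (elim \<mu>)
    have "sin (\<mu> * pi) \<noteq> 0"
    proof
      assume "sin (\<mu> * pi) = 0"
      then obtain i where "\<mu> * pi = of_int i * pi" by (auto simp: sin_zero_iff_int2)
      then have "\<mu> = of_int i" by simp
      moreover obtain k where "2 * \<nu> = of_int k" using \<nu> by (rule Ints_cases)
      moreover have "\<bar>2 * \<mu> - 2 * \<nu>\<bar> < 1"
        using elim unfolding dist_norm real_norm_def by linarith
      ultimately have "\<bar>real_of_int (2 * i - k)\<bar> < 1"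
        by simp
      then have "2 * i = k" by linarith
      then show False using elim \<open>\<mu> = of_int i\<close> \<open>2 * \<nu> = of_int k\<close> by simp
    qed
    then show ?case by (rule quot [symmetric])
  qed
  moreover have "((\<lambda>\<mu>. - Re (hankel_int x \<mu>) / pi) \<longlongrightarrow> - Re (hankel_int x \<nu>) / pi) (at \<nu>)"
    using continuous_hankel_int [OF x] unfolding isCont_def by (intro tendsto_intros) auto
  ultimately have "((\<lambda>\<mu>. (besselJ \<mu> x * cos (\<mu> * pi) - besselJ (- \<mu>) x) / sin (\<mu> * pi)) \<longlongrightarrow> - Re (hankel_int x \<nu>) / pi) (at \<nu>)"
    by (rule Lim_transform_eventually [rotated])
  then have "besselY \<nu> x = - Re (hankel_int x \<nu>) / pi"
    unfolding besselY_def by (intro tendsto_Lim) auto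
  then show ?thesis
    using besselJ_eq_Im [OF x, of \<nu>] by (simp add: hankel1_def complex_eq_iff)
qed

text \<open>The right end is turned from Im z = pi to Im z = pi / 2, the imaginary \<tau>-axis. In
  between cos \<theta> \<le> 0, so the integrand is at most exp(-\<nu> t), which tends to 0 because
  \<nu> > 0.\<close>

theorem hankel1_limits:
  assumes x: "x > 0" and \<nu>: "2 * \<nu> \<in> \<int>" "\<nu> > 0"
  obtains A B where "((\<lambda>t. schlaefli_prim (x / 2) (x / 2) \<nu> (of_real t + \<i> * of_real (pi / 2))) \<longlongrightarrow> A) at_top"
    "((\<lambda>t. schlaefli_prim (x / 2) (x / 2) \<nu> (- of_real t)) \<longlongrightarrow> B) at_top"
    "A - B = of_real pi * \<i> * hankel1 \<nu> x"
proof -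
  define c where "c = x / 2"
  have c: "c > 0" using assms by (simp add: c_def)
  obtain A where A: "((\<lambda>t. schlaefli_prim c c \<nu> (of_real t + \<i> * of_real pi)) \<longlongrightarrow> A) at_top"
    using schlaefli_prim_right_limit [of c c \<nu> "\<bar>\<nu>\<bar>" pi] c by auto
  obtain B where B: "((\<lambda>t. schlaefli_prim c c \<nu> (- of_real t)) \<longlongrightarrow> B) at_top"
    using schlaefli_prim_left_limit [of c c \<nu> "\<bar>\<nu>\<bar>"] c by auto
  have "(hankel_path x \<nu> \<longlongrightarrow> A - B) at_top"
    unfolding hankel_path_def [abs_def] c_def [symmetric] by (intro tendsto_intros A B)
  then have AB: "A - B = of_real pi * \<i> * hankel1 \<nu> x"
    using hankel_path_limit(1) [OF x order_refl] hankel1_eq_hankel_int [OF x \<nu>(1)]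
    by (metis tendsto_unique trivial_limit_at_top_linorder)
  have "((\<lambda>t. schlaefli_prim c c \<nu> (of_real t + \<i> * of_real pi) - schlaefli_prim c c \<nu> (of_real t + \<i> * of_real (pi / 2))) \<longlongrightarrow> 0) at_top"
  proof (rule Lim_null_comparison)
    show "eventually (\<lambda>t. norm (schlaefli_prim c c \<nu> (of_real t + \<i> * of_real pi) - schlaefli_prim c c \<nu> (of_real t + \<i> * of_real (pi / 2)))
        \<le> exp (- \<nu> * t) * (pi - pi / 2)) at_top"
      using eventually_ge_at_top [of 0]
    proof eventually_elim
      case (elim t)
      show ?case
      proof (rule norm_diff_vertical_le [OF has_field_derivative_schlaefli_prim])
        fix \<theta> assume \<theta>: "pi / 2 \<le> \<theta>" "\<theta> \<le> pi"
        have "0 \<le> sin (\<theta> - pi / 2)" using \<theta> by (intro sin_ge_zero) auto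
        then have "cos \<theta> \<le> 0" by (simp add: sin_diff)
        moreover have "0 \<le> c * exp t - c * exp (- t)" using c elim by simp
        ultimately have "(c * exp t - c * exp (- t)) * cos \<theta> \<le> 0"
          by (rule mult_nonneg_nonpos [rotated])
        then show "norm (schlaefli c c \<nu> (of_real t + \<i> * of_real \<theta>)) \<le> exp (- \<nu> * t)"
          unfolding norm_schlaefli by simp
      qed simp
    qed
    show "((\<lambda>t. exp (- \<nu> * t) * (pi - pi / 2)) \<longlongrightarrow> 0) at_top"
      using \<nu> by real_asymp
  qed
  from tendsto_diff [OF A this]
  have "((\<lambda>t. schlaefli_prim c c \<nu> (of_real t + \<i> * of_real (pi / 2))) \<longlongrightarrow> A) at_top" by simp
  with AB B show ?thesis using that unfolding c_def by blast
qed

section \<open>The fundamental solution as a superposition of Gaussians\<close>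

lemma set_integral_FTC_Ioo:
  fixes F f :: "real \<Rightarrow> 'a::euclidean_space"
  assumes "a < b" "\<And>x. a < x \<Longrightarrow> x < b \<Longrightarrow> (F has_vector_derivative f x) (at x)"
    and "\<And>x. a < x \<Longrightarrow> x < b \<Longrightarrow> isCont f x" "set_integrable lborel {a<..<b} f"
    and "(F \<longlongrightarrow> A) (at_right a)" "(F \<longlongrightarrow> B) (at_left b)"
  shows "(LINT x:{a<..<b}|lborel. f x) = B - A"
proof -
  have "(LBINT x=ereal a..ereal b. f x) = B - A"
    by (rule interval_integral_FTC_integrable) (use assms in \<open>auto simp: ereal_tendsto_simps\<close>)
  then show ?thesis using assms(1) by (simp add: interval_lebesgue_integral_le_eq)
qed

lemma set_integral_FTC_Ioi:
  fixes F f :: "real \<Rightarrow> 'a::euclidean_space"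
  assumes "\<And>x. a < x \<Longrightarrow> (F has_vector_derivative f x) (at x)"
    and "\<And>x. a < x \<Longrightarrow> isCont f x" "set_integrable lborel {a<..} f"
    and "(F \<longlongrightarrow> A) (at_right a)" "(F \<longlongrightarrow> B) at_top"
  shows "(LINT x:{a<..}|lborel. f x) = B - A"
proof -
  have "(LBINT x=ereal a..\<infinity>. f x) = B - A"
    by (rule interval_integral_FTC_integrable) (use assms in \<open>auto simp: ereal_tendsto_simps\<close>)
  then show ?thesis by (simp add: interval_integral_to_infinity_eq)
qed

lemma set_integrable_powr_Ioi:
  fixes c \<nu> :: real
  assumes "c > 0" "\<nu> > 0"
  shows "set_integrable lborel {c<..} (\<lambda>s. s powr (- \<nu> - 1))"
proof -
  have "set_integrable lborel (einterval (ereal c) \<infinity>) (\<lambda>s. s powr (- \<nu> - 1))"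
  proof (rule interval_integral_FTC_nonneg(1))
    show "((\<lambda>s. - (s powr - \<nu>) / \<nu>) has_real_derivative x powr (- \<nu> - 1)) (at x)" if "ereal c < ereal x" for x
      using that assms by (auto intro!: derivative_eq_intros)
    show "isCont (\<lambda>s. s powr (- \<nu> - 1)) x" if "ereal c < ereal x" for x
      using that assms by (intro continuous_intros) auto
    show "(((\<lambda>s. - (s powr - \<nu>) / \<nu>) \<circ> real_of_ereal) \<longlongrightarrow> - (c powr - \<nu>) / \<nu>) (at_right (ereal c))"
      unfolding ereal_tendsto_simps using assms by (intro tendsto_intros) auto
    have "((\<lambda>s. - (s powr - \<nu>) / \<nu>) \<longlongrightarrow> - 0 / \<nu>) at_top"
      using assms by (intro tendsto_intros tendsto_neg_powr filterlim_ident) auto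
    then show "(((\<lambda>s. - (s powr - \<nu>) / \<nu>) \<circ> real_of_ereal) \<longlongrightarrow> 0) (at_left \<infinity>)"
      unfolding ereal_tendsto_simps by simp
  qed auto
  then show ?thesis by simp
qed

text \<open>Weights and rates of the Gaussians on the three pieces of the contour in the \<open>\<tau>\<close>-plane:
  the segment from \<open>0\<close> to \<open>c\<close>, the quarter circle from \<open>c\<close> to \<open>\<i> c\<close>, and the ray from \<open>\<i> c\<close> upwards.\<close>

definition wt1 :: "real \<Rightarrow> real \<Rightarrow> real \<Rightarrow> complex" where
  "wt1 \<kappa> \<nu> s = of_real (exp (\<kappa>\<^sup>2 * s) * s powr (- \<nu> - 1))"
definition rate1 :: "real \<Rightarrow> complex" where
  "rate1 s = of_real (1 / (4 * s))"
definition wt2 :: "real \<Rightarrow> real \<Rightarrow> real \<Rightarrow> real \<Rightarrow> complex" where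
  "wt2 \<kappa> \<nu> c \<theta> = \<i> * exp (of_real (\<kappa>\<^sup>2 * c) * exp (\<i> * of_real \<theta>) - of_real \<nu> * (of_real (ln c) + \<i> * of_real \<theta>))"
definition rate2 :: "real \<Rightarrow> real \<Rightarrow> complex" where
  "rate2 c \<theta> = exp (- (\<i> * of_real \<theta>)) / of_real (4 * c)"
definition wt3 :: "real \<Rightarrow> real \<Rightarrow> real \<Rightarrow> complex" where
  "wt3 \<kappa> \<nu> s = exp (\<i> * of_real (\<kappa>\<^sup>2 * s)) * exp (- (\<i> * of_real (pi * \<nu> / 2))) * of_real (s powr (- \<nu> - 1))"
definition rate3 :: "real \<Rightarrow> complex" where
  "rate3 s = - \<i> / of_real (4 * s)"

text \<open>Dilation by exp l = 2 \<kappa> / r and \<tau> = exp z give the exponent \<kappa>^2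
  \<tau> - r^2 / (4 \<tau>). The distance r now appears only in a Gaussian of rate 1 / (4 \<tau>),
  and the weights are independent of r. In the z-plane the three pieces are the real axis up to ln
  c, a vertical segment and the line Im z = pi / 2.\<close>

lemma hankel1_eq_integrals:
  assumes \<kappa>: "\<kappa> > 0" and r: "r > 0" and c: "c > 0" and \<nu>: "2 * \<nu> \<in> \<int>" "\<nu> > 0"
  shows "of_real ((2 * \<kappa> / r) powr \<nu>) * (of_real pi * \<i> * hankel1 \<nu> (\<kappa> * r))
    = (LINT s:{0<..<c}|lborel. wt1 \<kappa> \<nu> s * exp (- (rate1 s * of_real (r\<^sup>2))))
    + (LINT \<theta>:{0<..<pi/2}|lborel. wt2 \<kappa> \<nu> c \<theta> * exp (- (rate2 c \<theta> * of_real (r\<^sup>2))))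
    + (LINT s:{c<..}|lborel. wt3 \<kappa> \<nu> s * exp (- (rate3 s * of_real (r\<^sup>2))))"
proof -
  define x l where "x = \<kappa> * r" and "l = ln (2 * \<kappa> / r)"
  have x: "x > 0" using \<kappa> r by (simp add: x_def)
  obtain A B where A: "((\<lambda>t. schlaefli_prim (x / 2) (x / 2) \<nu> (of_real t + \<i> * of_real (pi / 2))) \<longlongrightarrow> A) at_top"
    and B: "((\<lambda>t. schlaefli_prim (x / 2) (x / 2) \<nu> (- of_real t)) \<longlongrightarrow> B) at_top"
    and AB: "A - B = of_real pi * \<i> * hankel1 \<nu> x"
    using hankel1_limits [OF x \<nu>] by blast
  define p P f where "p = schlaefli_prim (x / 2) (x / 2) \<nu>" and "P = schlaefli_prim (\<kappa>\<^sup>2) (r\<^sup>2 / 4) \<nu>" and "f = schlaefli (\<kappa>\<^sup>2) (r\<^sup>2 / 4) \<nu>"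
  have e: "x / 2 * exp l = \<kappa>\<^sup>2" "x / 2 * exp (- l) = r\<^sup>2 / 4"
    using \<kappa> r by (auto simp: x_def l_def exp_minus field_simps power2_eq_square)
  \<comment> \<open>Both primitives vanish at their own origin, so the dilation relates their values
    by an affine map, which also transports the limits.\<close>
  have P: "P z = P 0 + of_real (exp (\<nu> * l)) * (p (z + of_real l) - p (of_real l))" for z
    using schlaefli_prim_scale [of "x / 2" l "x / 2" \<nu> z 0] unfolding e P_def p_def by (simp add: algebra_simps)
  define A' B' where "A' = P 0 + of_real (exp (\<nu> * l)) * (A - p (of_real l))"
    and "B' = P 0 + of_real (exp (\<nu> * l)) * (B - p (of_real l))"
  have "filterlim (\<lambda>t. t + l) at_top at_top" by real_asymp
  from filterlim_compose [OF A this] have "((\<lambda>t. p (of_real t + \<i> * of_real (pi / 2) + of_real l)) \<longlongrightarrow> A) at_top"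
    by (simp add: p_def algebra_simps)
  then have A': "((\<lambda>t. P (of_real t + \<i> * of_real (pi / 2))) \<longlongrightarrow> A') at_top"
    unfolding P [of "of_real _ + \<i> * of_real (pi / 2)"] A'_def by (intro tendsto_intros)
  have "filterlim (\<lambda>t. t - l) at_top at_top" by real_asymp
  from filterlim_compose [OF B this] have "((\<lambda>t. p (- of_real t + of_real l)) \<longlongrightarrow> B) at_top"
    by (simp add: p_def algebra_simps)
  then have B': "((\<lambda>t. P (- of_real t)) \<longlongrightarrow> B') at_top"
    unfolding P [of "- of_real _"] B'_def by (intro tendsto_intros)
  have P': "(P has_field_derivative f z) (at z)" for z
    unfolding P_def f_def by (rule has_field_derivative_schlaefli_prim)
  have dP: "((\<lambda>s. P (of_real (ln s) + \<i> * of_real \<theta>)) has_vector_derivative f (of_real (ln s) + \<i> * of_real \<theta>) / of_real s) (at s)"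
    if "s > 0" for s \<theta>
  proof -
    have "((\<lambda>s. ln s) has_vector_derivative 1 / s) (at s)"
      using that by (auto intro!: derivative_eq_intros simp flip: has_real_derivative_iff_has_vector_derivative)
    from vector_diff_chain_within [OF this has_vector_derivative_schlaefli_prim_horizontal]
    show ?thesis by (simp add: o_def P_def f_def scaleR_conv_of_real field_simps)
  qed
  have contf: "continuous_on U f" for U
    unfolding f_def schlaefli_def by (intro continuous_intros)
  have P_cont: "isCont P z" for z
    using P' DERIV_isCont by blast

  have f1: "f (of_real (ln s) + \<i> * of_real 0) / of_real s = wt1 \<kappa> \<nu> s * exp (- (rate1 s * of_real (r\<^sup>2)))" if s: "s > 0" for s
  proof -
    have "f (of_real (ln s) + \<i> * of_real 0) / of_real s
       = of_real (exp (\<kappa>\<^sup>2 * exp (ln s) - r\<^sup>2 / 4 * exp (- ln s) - \<nu> * ln s) / s)"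
      by (simp add: f_def schlaefli_def exp_of_real [symmetric])
    also have "exp (\<kappa>\<^sup>2 * exp (ln s) - r\<^sup>2 / 4 * exp (- ln s) - \<nu> * ln s) / s = exp (\<kappa>\<^sup>2 * s) * s powr (- \<nu> - 1) * exp (- (1 / (4 * s) * r\<^sup>2))"
    proof -
      have "s powr (- \<nu> - 1) = exp (- \<nu> * ln s) / s"
        using s by (simp add: powr_def exp_diff left_diff_distrib)
      then have "exp (\<kappa>\<^sup>2 * s) * s powr (- \<nu> - 1) * exp (- (1 / (4 * s) * r\<^sup>2))
          = exp (\<kappa>\<^sup>2 * s + (- \<nu> * ln s + - (1 / (4 * s) * r\<^sup>2))) / s"
        by (simp only: exp_add) simp
      moreover have "\<kappa>\<^sup>2 * s + (- \<nu> * ln s + - (1 / (4 * s) * r\<^sup>2))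
          = \<kappa>\<^sup>2 * exp (ln s) - r\<^sup>2 / 4 * exp (- ln s) - \<nu> * ln s"
        using s by (simp add: exp_minus field_simps)
      ultimately show ?thesis by (simp only:)
    qed
    finally show ?thesis by (simp add: wt1_def rate1_def exp_of_real [symmetric])
  qed
  have f3: "f (of_real (ln s) + \<i> * of_real (pi / 2)) / of_real s = wt3 \<kappa> \<nu> s * exp (- (rate3 s * of_real (r\<^sup>2)))" if s: "s > 0" for s
  proof -
    have e: "exp (of_real (ln s) + \<i> * of_real (pi / 2)) = \<i> * of_real s"
        "exp (- (of_real (ln s) + \<i> * of_real (pi / 2))) = - \<i> / of_real s"
      using s by (simp_all add: complex_eq_iff Re_exp Im_exp Re_divide Im_divide exp_minus power2_eq_square field_simps)
    have pw: "complex_of_real (s powr (- \<nu> - 1)) = exp (of_real (- \<nu> * ln s)) / of_real s"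
      unfolding exp_of_real using s by (simp add: powr_def exp_diff left_diff_distrib)
    have assoc: "u * v * (w / of_real s) * z = u * (v * (w * z)) / of_real s" for u v w z :: complex
      by simp
    have w: "wt3 \<kappa> \<nu> s * exp (- (rate3 s * of_real (r\<^sup>2)))
       = exp (\<i> * of_real (\<kappa>\<^sup>2 * s) + (- (\<i> * of_real (pi * \<nu> / 2)) + (of_real (- \<nu> * ln s) + - (rate3 s * of_real (r\<^sup>2))))) / of_real s"
      unfolding wt3_def exp_add pw assoc ..
    show ?thesis
      unfolding w unfolding f_def schlaefli_def e rate3_def using s
      by (intro arg_cong2 [of _ _ _ _ "(/)"] arg_cong [of _ _ exp]) (simp_all add: field_simps)
  qed
  have f2: "\<i> * f (of_real (ln c) + \<i> * of_real \<theta>) = wt2 \<kappa> \<nu> c \<theta> * exp (- (rate2 c \<theta> * of_real (r\<^sup>2)))" for \<theta>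
  proof -
    have e: "exp (of_real (ln c) + \<i> * of_real \<theta>) = of_real c * exp (\<i> * of_real \<theta>)"
        "exp (- (of_real (ln c) + \<i> * of_real \<theta>)) = exp (- (\<i> * of_real \<theta>)) / of_real c"
      using c by (simp_all add: exp_add exp_diff exp_of_real exp_minus field_simps)
    show ?thesis
      unfolding f_def schlaefli_def e wt2_def rate2_def mult.assoc exp_add [symmetric] using c
      by (intro arg_cong2 [of _ _ _ _ "(*)"] arg_cong [of _ _ exp]) (simp_all add: field_simps)
  qed

  have lim0: "((\<lambda>s. P (of_real (ln s) + \<i> * of_real 0)) \<longlongrightarrow> B') (at_right 0)"
  proof -
    have "filterlim (\<lambda>s::real. - ln s) at_top (at_right 0)" by real_asymp
    from filterlim_compose [OF B' this] show ?thesis by simp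
  qed
  have lim3: "((\<lambda>s. P (of_real (ln s) + \<i> * of_real (pi / 2))) \<longlongrightarrow> A') at_top"
    using filterlim_compose [OF A' ln_at_top] .
  have limc: "((\<lambda>s. P (of_real (ln s) + \<i> * of_real \<theta>)) \<longlongrightarrow> P (of_real (ln c) + \<i> * of_real \<theta>)) (at c within U)" for U \<theta>
    using has_vector_derivative_continuous [OF dP [OF c, of \<theta>]] by (auto simp: continuous_within intro: tendsto_within_subset)
  have cont: "isCont (\<lambda>s. f (of_real (ln s) + \<i> * of_real \<theta>) / of_real s) s" if "s > 0" for s \<theta>
    using that unfolding f_def schlaefli_def by (intro continuous_intros) auto

  \<comment> \<open>The integrand is nonnegative and its primitive has a finite limit at 0; this
    yields integrability without an estimate near 0.\<close>
  have int1: "set_integrable lborel {0<..<c} (\<lambda>s. f (of_real (ln s) + \<i> * of_real 0) / of_real s)"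
  proof -
    define h where "h s = exp (\<kappa>\<^sup>2 * s) * s powr (- \<nu> - 1) * exp (- (1 / (4 * s) * r\<^sup>2))" for s
    have h: "f (of_real (ln s) + \<i> * of_real 0) / of_real s = of_real (h s)" if "s > 0" for s
      unfolding f1 [OF that] by (simp add: h_def wt1_def rate1_def exp_of_real [symmetric])
    have "set_integrable lborel (einterval (ereal 0) (ereal c)) h"
    proof (rule interval_integral_FTC_nonneg(1))
      show "((\<lambda>s. Re (P (of_real (ln s) + \<i> * of_real 0))) has_real_derivative h s) (at s)" if "ereal 0 < ereal s" for s
      proof -
        have "s > 0" using that by simp
        from bounded_linear.has_vector_derivative [OF bounded_linear_Re dP [OF this, of 0]] show ?thesis
          unfolding h [OF \<open>s > 0\<close>] by (simp add: has_real_derivative_iff_has_vector_derivative)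
      qed
      show "isCont h s" if "ereal 0 < ereal s" for s
        using that unfolding h_def by (intro continuous_intros) auto
      show "AE s in lborel. ereal 0 < ereal s \<longrightarrow> ereal s < ereal c \<longrightarrow> 0 \<le> h s"
        by (simp add: h_def)
      show "(((\<lambda>s. Re (P (of_real (ln s) + \<i> * of_real 0))) \<circ> real_of_ereal) \<longlongrightarrow> Re B') (at_right (ereal 0))"
        unfolding ereal_tendsto_simps by (intro tendsto_intros lim0)
      show "(((\<lambda>s. Re (P (of_real (ln s) + \<i> * of_real 0))) \<circ> real_of_ereal) \<longlongrightarrow> Re (P (of_real (ln c) + \<i> * of_real 0))) (at_left (ereal c))"
        unfolding ereal_tendsto_simps by (intro tendsto_intros limc)
    qed (use c in auto)
    then have "set_integrable lborel {0<..<c} (\<lambda>s. complex_of_real (h s))"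
      unfolding einterval_eq by (simp add: set_integrable_def scaleR_conv_of_real flip: of_real_mult)
    then show ?thesis
      by (rule set_integrable_cong [THEN iffD1, rotated -1]) (use h in auto)
  qed
  \<comment> \<open>On the imaginary axis the exponentials have modulus 1, so the modulus is
    s^(-\<nu> - 1), integrable at infinity as \<nu> > 0.\<close>
  have int3: "set_integrable lborel {c<..} (\<lambda>s. f (of_real (ln s) + \<i> * of_real (pi / 2)) / of_real s)"
  proof (rule set_integrable_bound [OF set_integrable_powr_Ioi [OF c \<nu>(2)]])
    show "set_borel_measurable lborel {c<..} (\<lambda>s. f (of_real (ln s) + \<i> * of_real (pi / 2)) / of_real s)"
      unfolding set_borel_measurable_def measurable_lborel2
      by (intro borel_measurable_continuous_on_indicator continuous_at_imp_continuous_on ballI cont) (use c in auto)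
    show "AE s in lborel. s \<in> {c<..} \<longrightarrow> norm (f (of_real (ln s) + \<i> * of_real (pi / 2)) / of_real s) \<le> norm (s powr (- \<nu> - 1))"
    proof (intro AE_I2 impI)
      fix s assume "s \<in> {c<..}"
      then have "s > 0" using c by auto
      then show "norm (f (of_real (ln s) + \<i> * of_real (pi / 2)) / of_real s) \<le> norm (s powr (- \<nu> - 1))"
        unfolding f3 [OF \<open>s > 0\<close>] by (simp add: wt3_def rate3_def norm_mult)
    qed
  qed
  have int2: "set_integrable lborel {0<..<pi/2} (\<lambda>\<theta>. \<i> * f (of_real (ln c) + \<i> * of_real \<theta>))"
  proof (rule set_integrable_subset)
    show "set_integrable lborel {0..pi/2} (\<lambda>\<theta>. \<i> * f (of_real (ln c) + \<i> * of_real \<theta>))"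
      by (intro borel_integrable_atLeastAtMost' continuous_intros continuous_on_compose2 [OF contf [of UNIV]]) auto
  qed auto

  have I1: "(LINT s:{0<..<c}|lborel. f (of_real (ln s) + \<i> * of_real 0) / of_real s) = P (of_real (ln c) + \<i> * of_real 0) - B'"
    by (rule set_integral_FTC_Ioo [OF c dP cont int1 lim0 limc])
  have I3: "(LINT s:{c<..}|lborel. f (of_real (ln s) + \<i> * of_real (pi / 2)) / of_real s) = A' - P (of_real (ln c) + \<i> * of_real (pi / 2))"
    by (rule set_integral_FTC_Ioi [OF dP cont int3 limc lim3]) (use c in auto)
  have I2: "(LINT \<theta>:{0<..<pi/2}|lborel. \<i> * f (of_real (ln c) + \<i> * of_real \<theta>))
     = P (of_real (ln c) + \<i> * of_real (pi / 2)) - P (of_real (ln c) + \<i> * of_real 0)"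
  proof -
    have L: "((\<lambda>\<theta>. P (of_real (ln c) + \<i> * of_real \<theta>)) \<longlongrightarrow> P (of_real (ln c) + \<i> * of_real a)) (at a within U)" for a U
      by (intro isCont_tendsto_compose [OF P_cont] tendsto_intros)
    have D: "((\<lambda>\<theta>. P (of_real (ln c) + \<i> * of_real \<theta>)) has_vector_derivative \<i> * f (of_real (ln c) + \<i> * of_real \<theta>)) (at \<theta>)" for \<theta>
      unfolding P_def f_def by (rule has_vector_derivative_schlaefli_prim_vertical)
    have "isCont (\<lambda>\<theta>. \<i> * f (of_real (ln c) + \<i> * of_real \<theta>)) \<theta>" for \<theta>
      unfolding f_def schlaefli_def by (intro continuous_intros)
    from set_integral_FTC_Ioo [OF _ D this int2 L L] show ?thesis by simp
  qed

  have "of_real ((2 * \<kappa> / r) powr \<nu>) * (of_real pi * \<i> * hankel1 \<nu> (\<kappa> * r)) = A' - B'"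
    using \<kappa> r AB by (simp add: A'_def B'_def powr_def l_def x_def right_diff_distrib [symmetric])
  also have "\<dots> = (LINT s:{0<..<c}|lborel. f (of_real (ln s) + \<i> * of_real 0) / of_real s)
     + (LINT \<theta>:{0<..<pi/2}|lborel. \<i> * f (of_real (ln c) + \<i> * of_real \<theta>))
     + (LINT s:{c<..}|lborel. f (of_real (ln s) + \<i> * of_real (pi / 2)) / of_real s)"
    unfolding I1 I2 I3 by simp
  also have "(LINT s:{0<..<c}|lborel. f (of_real (ln s) + \<i> * of_real 0) / of_real s)
    = (LINT s:{0<..<c}|lborel. wt1 \<kappa> \<nu> s * exp (- (rate1 s * of_real (r\<^sup>2))))"
    by (intro set_lebesgue_integral_cong) (use f1 in auto)
  also have "(LINT s:{c<..}|lborel. f (of_real (ln s) + \<i> * of_real (pi / 2)) / of_real s)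
    = (LINT s:{c<..}|lborel. wt3 \<kappa> \<nu> s * exp (- (rate3 s * of_real (r\<^sup>2))))"
    by (intro set_lebesgue_integral_cong) (use f3 c in auto)
  finally show ?thesis unfolding f2 .
qed

text \<open>From \<kappa> / (2 pi r) = (2 \<kappa> / r) / (4 pi) and i / 4 = pi i / (4 pi) the
  constant (4 pi)^(-\<nu> - 1) = (4 pi)^(-n/2) of the heat kernel remains. The radius c stays free,
  so that it can tend to 0 later.\<close>

theorem helmholtz_fund_eq_integrals:
  fixes z :: "real ^ 'n"
  assumes n: "CARD('n) \<ge> 3" and \<kappa>: "\<kappa> > 0" and c: "c > 0" and z: "z \<noteq> 0"
  defines "\<nu> \<equiv> real CARD('n) / 2 - 1"
  shows "helmholtz_fund \<kappa> z = of_real ((4 * pi) powr (- \<nu> - 1)) *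
    ((LINT s:{0<..<c}|lborel. wt1 \<kappa> \<nu> s * exp (- (rate1 s * of_real ((norm z)\<^sup>2))))
    + (LINT \<theta>:{0<..<pi/2}|lborel. wt2 \<kappa> \<nu> c \<theta> * exp (- (rate2 c \<theta> * of_real ((norm z)\<^sup>2))))
    + (LINT s:{c<..}|lborel. wt3 \<kappa> \<nu> s * exp (- (rate3 s * of_real ((norm z)\<^sup>2)))))"
proof -
  define r where "r = norm z"
  have r: "r > 0" using z by (simp add: r_def)
  have \<nu>: "\<nu> > 0" using n by (simp add: \<nu>_def)
  have "2 * \<nu> = of_int (int CARD('n) - 2)" by (simp add: \<nu>_def)
  then have \<nu>2: "2 * \<nu> \<in> \<int>" by (metis Ints_of_int)
  have "helmholtz_fund \<kappa> z = \<i> / 4 * of_real ((\<kappa> / (2 * pi * r)) powr \<nu>) * hankel1 \<nu> (\<kappa> * r)"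
    by (simp add: helmholtz_fund_def \<nu>_def r_def)
  also have "\<dots> = of_real ((4 * pi) powr (- \<nu> - 1)) * (of_real ((2 * \<kappa> / r) powr \<nu>) * (of_real pi * \<i> * hankel1 \<nu> (\<kappa> * r)))"
  proof -
    have "(\<kappa> / (2 * pi * r)) = (2 * \<kappa> / r) / (4 * pi)" by simp
    then have "(\<kappa> / (2 * pi * r)) powr \<nu> = (2 * \<kappa> / r) powr \<nu> / (4 * pi) powr \<nu>"
      using \<kappa> r by (simp only: powr_divide)
    moreover have "(4 * pi) powr (- \<nu> - 1) = 1 / ((4 * pi) powr \<nu> * (4 * pi))"
      by (simp add: powr_diff powr_minus field_simps)
    ultimately show ?thesis by (simp add: mult_ac)
  qed
  finally show ?thesis
    unfolding hankel1_eq_integrals [OF \<kappa> r c \<nu>2 \<nu>] unfolding r_def .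
qed

section \<open>Gaussian and Fresnel integrals with a smooth weight\<close>

text \<open>Van der Corput's splitting at \<delta> = |\<sigma>|^(-1/2): up to \<delta> the integrand
  is at most 1, beyond it one integration by parts gains a factor 1 / (|\<sigma>| u). Each part
  contributes at most \<delta>, and Re \<sigma> \<ge> 0 suffices for both.\<close>

lemma fresnel_tail:
  fixes p :: "real \<Rightarrow> complex"
  assumes p: "\<And>u. (p has_vector_derivative exp (- (\<sigma> * of_real (u\<^sup>2)))) (at u)"
    and \<sigma>: "Re \<sigma> \<ge> 0" "\<sigma> \<noteq> 0" and u: "u \<ge> 0"
  shows "norm (p u - p 0) \<le> 2 / sqrt (norm \<sigma>)"
proof -
  define \<delta> where "\<delta> = 1 / sqrt (norm \<sigma>)"
  have \<delta>: "\<delta> > 0" using \<sigma> by (simp add: \<delta>_def)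
  have \<delta>2: "1 / (norm \<sigma> * \<delta>) = \<delta>"
    using \<sigma> by (simp add: \<delta>_def real_div_sqrt)
  have e1: "norm (exp (- (\<sigma> * of_real (u\<^sup>2)))) \<le> 1" for u :: real
    using \<sigma> by (simp del: of_real_power)
  have near: "norm (p u - p 0) \<le> u" if "u \<ge> 0" for u
  proof (cases "u = 0")
    case False
    have "norm (p u - p 0) \<le> u - 0"
    proof (rule differentiable_bound_general [where f' = "\<lambda>u. exp (- (\<sigma> * of_real (u\<^sup>2)))" and \<phi>' = "\<lambda>_. 1"])
      show "continuous_on {0..u} p"
        using p by (intro continuous_at_imp_continuous_on) (blast intro: has_vector_derivative_continuous)
      show "((\<lambda>u. u) has_vector_derivative 1) (at x)" for x :: real
        by (auto intro!: derivative_eq_intros)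
    qed (use p e1 False that in auto)
    then show ?thesis by simp
  qed simp
  show ?thesis
  proof (cases "u \<le> \<delta>")
    case True
    with near [OF u] have "norm (p u - p 0) \<le> \<delta>" by simp
    also have "\<dots> \<le> 2 / sqrt (norm \<sigma>)" by (simp add: \<delta>_def divide_right_mono)
    finally show ?thesis .
  next
    case False
    \<comment> \<open>The boundary term of the integration by parts. The remainder \<open>F\<close>
      has a derivative of modulus at most 1 / (2 |\<sigma>| u^2), and the terms in 1 / u in the
      bounds for \<open>F\<close> and \<open>G\<close> cancel.\<close>
    define G where "G u = - exp (- (\<sigma> * of_real (u\<^sup>2))) / (2 * \<sigma> * of_real u)" for u :: real
    define F where "F u = p u - G u" for u
    have G: "(G has_vector_derivative exp (- (\<sigma> * of_real (u\<^sup>2))) + exp (- (\<sigma> * of_real (u\<^sup>2))) / (2 * \<sigma> * of_real (u\<^sup>2))) (at u)"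
      if "u > 0" for u
    proof -
      have "((\<lambda>z. - exp (- (\<sigma> * z\<^sup>2)) / (2 * \<sigma> * z)) has_field_derivative
          exp (- (\<sigma> * (of_real u)\<^sup>2)) + exp (- (\<sigma> * (of_real u)\<^sup>2)) / (2 * \<sigma> * (of_real u)\<^sup>2)) (at (of_real u))"
        using that \<sigma> by (auto intro!: derivative_eq_intros simp: field_simps power2_eq_square)
      from has_vector_derivative_real_field [OF this] show ?thesis
        unfolding G_def by simp
    qed
    have F: "(F has_vector_derivative - (exp (- (\<sigma> * of_real (u\<^sup>2))) / (2 * \<sigma> * of_real (u\<^sup>2)))) (at u)" if "u > 0" for u
      using has_vector_derivative_diff [OF p G [OF that]] by (simp add: F_def [abs_def])
    have "norm (F u - F \<delta>) \<le> - 1 / (2 * norm \<sigma> * u) - - 1 / (2 * norm \<sigma> * \<delta>)"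
    proof (rule differentiable_bound_general [where f' = "\<lambda>u. - (exp (- (\<sigma> * of_real (u\<^sup>2))) / (2 * \<sigma> * of_real (u\<^sup>2)))"
          and \<phi>' = "\<lambda>u. 1 / (2 * norm \<sigma> * u\<^sup>2)" and \<phi> = "\<lambda>u. - 1 / (2 * norm \<sigma> * u)"])
      show "continuous_on {\<delta>..u} F"
        using F \<delta> by (intro continuous_at_imp_continuous_on ballI has_vector_derivative_continuous [OF F]) auto
      show "continuous_on {\<delta>..u} (\<lambda>u. - 1 / (2 * norm \<sigma> * u))"
        using \<delta> \<sigma> by (intro continuous_intros) auto
      show "((\<lambda>u. - 1 / (2 * norm \<sigma> * u)) has_vector_derivative 1 / (2 * norm \<sigma> * x\<^sup>2)) (at x)" if "\<delta> < x" for x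
        using that \<delta> \<sigma> unfolding has_real_derivative_iff_has_vector_derivative [symmetric]
        by (auto intro!: derivative_eq_intros simp: field_simps power2_eq_square)
      show "norm (- (exp (- (\<sigma> * of_real (x\<^sup>2))) / (2 * \<sigma> * of_real (x\<^sup>2)))) \<le> 1 / (2 * norm \<sigma> * x\<^sup>2)" for x
        using e1 [of x] by (simp add: norm_divide norm_mult norm_power divide_right_mono del: of_real_power)
      show "(F has_vector_derivative - (exp (- (\<sigma> * of_real (x\<^sup>2))) / (2 * \<sigma> * of_real (x\<^sup>2)))) (at x)" if "\<delta> < x" for x
        using F that \<delta> by simp
    qed (use False in simp)
    moreover have G_le: "norm (G v) \<le> 1 / (2 * norm \<sigma> * v)" if "v > 0" for v
      using e1 [of v] that by (simp add: G_def norm_divide norm_mult divide_right_mono del: of_real_power)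
    moreover have "norm (p u - p \<delta>) \<le> norm (F u - F \<delta>) + norm (G u) + norm (G \<delta>)"
      using norm_triangle_ineq4 [of "F u - F \<delta> + G u" "G \<delta>"] norm_triangle_ineq [of "F u - F \<delta>" "G u"]
      by (simp add: F_def algebra_simps)
    ultimately have "norm (p u - p \<delta>) \<le> 1 / (2 * norm \<sigma> * \<delta>) + 1 / (2 * norm \<sigma> * \<delta>)"
      using False \<delta> by (smt (verit) G_le minus_divide_left)
    also have "\<dots> = \<delta>" using \<delta>2 by (simp add: mult.commute)
    finally have "norm (p u - p \<delta>) \<le> \<delta>" .
    moreover have "norm (p \<delta> - p 0) \<le> \<delta>" using near \<delta> by simp
    ultimately have "norm (p u - p 0) \<le> \<delta> + \<delta>"
      using norm_triangle_ineq [of "p u - p \<delta>" "p \<delta> - p 0"] by simp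
    then show ?thesis by (simp add: \<delta>_def)
  qed
qed

lemma fresnel_primitive_bound:
  fixes p :: "real \<Rightarrow> complex"
  assumes p: "\<And>u. (p has_vector_derivative exp (- (\<sigma> * of_real (u\<^sup>2)))) (at u)"
    and \<sigma>: "Re \<sigma> \<ge> 0" "\<sigma> \<noteq> 0"
  shows "norm (p u - p 0) \<le> 2 / sqrt (norm \<sigma>)"
proof (cases "u \<ge> 0")
  case True
  then show ?thesis using fresnel_tail [OF p \<sigma>] by blast
next
  case False
  define q where "q u = - p (- u)" for u
  have "(q has_vector_derivative exp (- (\<sigma> * of_real (u\<^sup>2)))) (at u)" for u
  proof -
    have "((\<lambda>u. p (- u)) has_vector_derivative (- 1) *\<^sub>R exp (- (\<sigma> * of_real ((- u)\<^sup>2)))) (at u)"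
      by (rule vector_diff_chain_within [unfolded o_def, OF _ has_vector_derivative_at_within [OF p]])
         (auto intro!: derivative_eq_intros)
    from has_vector_derivative_minus [OF this] show ?thesis by (simp add: q_def [abs_def])
  qed
  from fresnel_tail [OF this \<sigma>, of "- u"] False show ?thesis
    by (simp add: q_def norm_minus_commute)
qed

text \<open>Integration by parts moves the derivative to \<phi> and leaves the Fresnel primitive,
  which is at most 2 / sqrt |\<sigma>| everywhere. The constant contains only \<phi> at the end
  points and a bound for \<phi>', hence is uniform in \<sigma> and x.\<close>

lemma fresnel_weighted_bound:
  fixes \<phi> \<phi>' :: "real \<Rightarrow> complex"
  assumes \<phi>: "\<And>y. (\<phi> has_vector_derivative \<phi>' y) (at y)" and \<phi>': "continuous_on UNIV \<phi>'" and PQ: "P \<le> Q"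
  obtains C where "C > 0" "\<And>\<sigma> x. Re \<sigma> \<ge> 0 \<Longrightarrow> \<sigma> \<noteq> 0 \<Longrightarrow>
    norm (integral {P..Q} (\<lambda>y. exp (- (\<sigma> * of_real ((x - y)\<^sup>2))) * \<phi> y)) \<le> C / sqrt (norm \<sigma>)"
proof -
  have "compact (\<phi>' ` {P..Q})"
    by (intro compact_continuous_image continuous_on_subset [OF \<phi>']) auto
  then obtain K where K: "K > 0" "\<And>y. y \<in> {P..Q} \<Longrightarrow> norm (\<phi>' y) \<le> K"
    using compact_imp_bounded bounded_pos by (metis imageI)
  define C where "C = 2 * norm (\<phi> P) + 2 * norm (\<phi> Q) + 2 * K * (Q - P) + 1"
  show ?thesis
  proof
    show "C > 0" using K PQ by (auto simp: C_def intro!: add_nonneg_pos add_nonneg_nonneg mult_nonneg_nonneg)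
    fix \<sigma> :: complex and x :: real
    assume \<sigma>: "Re \<sigma> \<ge> 0" "\<sigma> \<noteq> 0"
    define s where "s = sqrt (norm \<sigma>)"
    have s: "s > 0" using \<sigma> by (simp add: s_def)
    define p where "p u = prim (\<lambda>z. exp (- (\<sigma> * z\<^sup>2))) (of_real u)" for u :: real
    have p: "(p has_vector_derivative exp (- (\<sigma> * of_real (u\<^sup>2)))) (at u)" for u
    proof -
      have "(prim (\<lambda>z. exp (- (\<sigma> * z\<^sup>2))) has_field_derivative exp (- (\<sigma> * (of_real u)\<^sup>2))) (at (of_real u))"
        by (rule has_field_derivative_prim) (intro holomorphic_intros)
      from has_vector_derivative_real_field [OF this] show ?thesis by (simp add: p_def [abs_def])
    qed
    define q where "q y = p (y - x) - p 0" for y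
    have q: "(q has_vector_derivative exp (- (\<sigma> * of_real ((x - y)\<^sup>2)))) (at y)" for y
    proof -
      have "((\<lambda>y. p (y - x)) has_vector_derivative 1 *\<^sub>R exp (- (\<sigma> * of_real ((y - x)\<^sup>2)))) (at y)"
        by (rule vector_diff_chain_within [unfolded o_def, OF _ has_vector_derivative_at_within [OF p]])
           (auto intro!: derivative_eq_intros)
      then have "(q has_vector_derivative exp (- (\<sigma> * of_real ((y - x)\<^sup>2)))) (at y)"
        unfolding q_def by (auto intro!: derivative_eq_intros)
      then show ?thesis by (simp add: power2_commute)
    qed
    have qb: "norm (q y) \<le> 2 / s" for y
      unfolding q_def s_def by (rule fresnel_primitive_bound [OF p \<sigma>])
    have "((\<lambda>y. q y * \<phi>' y + exp (- (\<sigma> * of_real ((x - y)\<^sup>2))) * \<phi> y) has_integral q Q * \<phi> Q - q P * \<phi> P) {P..Q}"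
      by (intro fundamental_theorem_of_calculus PQ has_vector_derivative_mult has_vector_derivative_at_within [OF q] has_vector_derivative_at_within [OF \<phi>])
    moreover have qc: "continuous_on {P..Q} q"
      using q by (intro continuous_at_imp_continuous_on) (blast intro: has_vector_derivative_continuous)
    have qi: "(\<lambda>y. q y * \<phi>' y) integrable_on {P..Q}"
      by (intro integrable_continuous_real continuous_intros qc continuous_on_subset [OF \<phi>']) auto
    ultimately have "((\<lambda>y. (q y * \<phi>' y + exp (- (\<sigma> * of_real ((x - y)\<^sup>2))) * \<phi> y) - q y * \<phi>' y) has_integral
        (q Q * \<phi> Q - q P * \<phi> P) - integral {P..Q} (\<lambda>y. q y * \<phi>' y)) {P..Q}"
      by (intro has_integral_diff integrable_integral)
    then have "integral {P..Q} (\<lambda>y. exp (- (\<sigma> * of_real ((x - y)\<^sup>2))) * \<phi> y)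
        = (q Q * \<phi> Q - q P * \<phi> P) - integral {P..Q} (\<lambda>y. q y * \<phi>' y)"
      by (simp add: integral_unique)
    also have "norm \<dots> \<le> norm (q Q * \<phi> Q) + norm (q P * \<phi> P) + norm (integral {P..Q} (\<lambda>y. q y * \<phi>' y))"
      by (meson add_right_mono norm_triangle_ineq4 order_trans)
    also have "norm (q Q * \<phi> Q) \<le> 2 / s * norm (\<phi> Q)"
      unfolding norm_mult by (intro mult_right_mono qb) auto
    also have "norm (q P * \<phi> P) \<le> 2 / s * norm (\<phi> P)"
      unfolding norm_mult by (intro mult_right_mono qb) auto
    also have "norm (integral {P..Q} (\<lambda>y. q y * \<phi>' y)) \<le> (2 / s * K) * (Q - P)"
    proof (rule integral_bound [OF PQ])
      show "continuous_on {P..Q} (\<lambda>y. q y * \<phi>' y)"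
        by (intro continuous_intros qc continuous_on_subset [OF \<phi>']) auto
      show "norm (q y * \<phi>' y) \<le> 2 / s * K" if "y \<in> {P..Q}" for y
        unfolding norm_mult using s that by (intro mult_mono qb K) auto
    qed
    also have "2 / s * norm (\<phi> Q) + 2 / s * norm (\<phi> P) + (2 / s * K) * (Q - P) = (C - 1) / s"
      using s by (simp add: C_def field_simps)
    also have "\<dots> \<le> C / s" using s by (simp add: divide_right_mono)
    finally show "norm (integral {P..Q} (\<lambda>y. exp (- (\<sigma> * of_real ((x - y)\<^sup>2))) * \<phi> y)) \<le> C / sqrt (norm \<sigma>)"
      unfolding s_def by simp
  qed
qed

section \<open>Product integrals\<close>

text \<open>\<open>lborel\<close> on real^'n is the image of a product measure indexed by
  \<open>Basis\<close>; the axis vectors \<open>b j\<close> identify that index set with the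
  coordinates, which reduces the claim to Fubini for product measures.\<close>

lemma lborel_prod_vec:
  fixes h :: "'n::finite \<Rightarrow> real \<Rightarrow> 'a::{real_normed_field,banach,second_countable_topology}"
  assumes h: "\<And>j. integrable lborel (h j)"
  shows "integrable lborel (\<lambda>y::real^'n. \<Prod>j\<in>UNIV. h j (y $ j))" (is ?I)
    and "(LINT y|lborel. (\<Prod>j\<in>UNIV. h j ((y::real^'n) $ j))) = (\<Prod>j\<in>UNIV. (LINT y|lborel. h j y))" (is ?E)
proof -
  interpret product_sigma_finite "\<lambda>_::real^'n. lborel :: real measure" by standard
  define b where "b j = axis j (1::real)" for j :: 'n
  have Basis: "(Basis :: (real^'n) set) = range b"
    by (auto simp: Basis_vec_def b_def)
  have inj: "inj b"
    by (auto simp: inj_on_def b_def axis_eq_axis)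
  define \<iota> where "\<iota> = inv b"
  have \<iota>: "\<iota> (b j) = j" for j
    by (simp add: \<iota>_def inj)
  define T where "T = (\<lambda>f. \<Sum>v\<in>(Basis :: (real^'n) set). f v *\<^sub>R v)"
  have [measurable]: "h j \<in> borel_measurable borel" for j
    using h [of j] by simp
  have T: "T \<in> measurable (Pi\<^sub>M Basis (\<lambda>_. lborel)) borel"
    unfolding T_def by measurable
  have H: "(\<lambda>y::real^'n. \<Prod>j\<in>UNIV. h j (y $ j)) \<in> borel_measurable borel"
    by measurable
  have TH: "(\<Prod>j\<in>UNIV. h j (T f $ j)) = (\<Prod>v\<in>Basis. h (\<iota> v) (f v))" for f
  proof -
    have "T f $ j = f (b j)" for j
    proof -
      have "T f $ j = (\<Sum>i\<in>UNIV. f (b i) * (b i $ j))"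
        unfolding T_def Basis sum.reindex [OF inj] by simp
      also have "\<dots> = (\<Sum>i\<in>UNIV. if i = j then f (b i) else 0)"
        by (intro sum.cong) (auto simp: b_def axis_def)
      finally show ?thesis by simp
    qed
    then show ?thesis
      unfolding Basis prod.reindex [OF inj] by (simp add: \<iota>)
  qed
  have h': "integrable lborel (h (\<iota> v))" for v by (rule h)
  show ?I
    unfolding lborel_eq [where ?'a = "real^'n"] T_def [symmetric] integrable_distr_eq [OF T H] TH
    by (rule product_integrable_prod) (use h' in auto)
  have "(LINT y|lborel. (\<Prod>j\<in>UNIV. h j ((y::real^'n) $ j))) = (LINT f|Pi\<^sub>M Basis (\<lambda>_. lborel). (\<Prod>v\<in>Basis. h (\<iota> v) (f v)))"
    unfolding lborel_eq [where ?'a = "real^'n"] T_def [symmetric] integral_distr [OF T H] TH ..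
  also have "\<dots> = (\<Prod>v\<in>Basis. (LINT y|lborel. h (\<iota> v) y))"
    by (rule product_integral_prod) (use h' in auto)
  also have "\<dots> = (\<Prod>j\<in>UNIV. (LINT y|lborel. h j y))"
    unfolding Basis prod.reindex [OF inj] by (simp add: \<iota>)
  finally show ?E .
qed

text \<open>The Gaussian of |x - y|^2 and the density both factor over the coordinates, so for fixed
  t the integral in y is a product. The hypothesis \<open>int\<close> is the absolute integrability
  in time and space required by Fubini, where only Re \<sigma> is seen.\<close>

lemma gaussian_superposition:
  fixes g :: "'n::finite \<Rightarrow> real \<Rightarrow> complex" and x :: "real^'n" and \<omega> \<sigma> :: "real \<Rightarrow> complex"
  assumes g [measurable]: "\<And>j. g j \<in> borel_measurable borel"
    and gB: "\<And>j y. norm (g j y) \<le> B" and g0: "\<And>j y. y \<notin> {P j..Q j} \<Longrightarrow> g j y = 0"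
    and [measurable]: "\<omega> \<in> borel_measurable borel" "\<sigma> \<in> borel_measurable borel" "S \<in> sets borel"
    and \<sigma>: "\<And>t. t \<in> S \<Longrightarrow> Re (\<sigma> t) \<ge> 0"
    and int: "set_integrable lborel S (\<lambda>t. norm (\<omega> t) *
        (\<Prod>j\<in>UNIV. (LINT y|lborel. norm (g j y) * exp (- (Re (\<sigma> t) * (x $ j - y)\<^sup>2)))))"
  shows "integrable lborel (\<lambda>y. (LINT t:S|lborel. \<omega> t * exp (- (\<sigma> t * of_real ((norm (x - y))\<^sup>2)))) * (\<Prod>j\<in>UNIV. g j (y $ j)))" (is ?I)
    and "(LINT y|lborel. (LINT t:S|lborel. \<omega> t * exp (- (\<sigma> t * of_real ((norm (x - y))\<^sup>2)))) * (\<Prod>j\<in>UNIV. g j (y $ j)))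
      = (LINT t:S|lborel. \<omega> t * (\<Prod>j\<in>UNIV. (LINT y|lborel. exp (- (\<sigma> t * of_real ((x $ j - y)\<^sup>2))) * g j y)))" (is ?E)
proof -
  define G where "G j t y = exp (- (\<sigma> t * of_real ((x $ j - y)\<^sup>2))) * g j y" for j t y
  have G_meas [measurable]: "G j t \<in> borel_measurable borel" for j t
    unfolding G_def by measurable
  have nG: "norm (G j t y) = norm (g j y) * exp (- (Re (\<sigma> t) * (x $ j - y)\<^sup>2))" for j t y
    by (simp add: G_def norm_mult del: of_real_power)
  have intG: "integrable lborel (G j t)" if "t \<in> S" for j t
  proof (rule Bochner_Integration.integrable_bound)
    show "integrable lborel (\<lambda>y. indicator {P j..Q j} y *\<^sub>R B)"
      by (intro integrable_real_indicator integrable_scaleR_left) (auto simp: emeasure_lborel_Icc_eq)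
    show "AE y in lborel. norm (G j t y) \<le> norm (indicator {P j..Q j} y *\<^sub>R B)"
    proof (intro AE_I2)
      fix y
      have "norm (g j y) * exp (- (Re (\<sigma> t) * (x $ j - y)\<^sup>2)) \<le> B * 1"
        using gB [of j y] \<sigma> [OF that] by (intro mult_mono) (auto intro: order_trans [OF norm_ge_zero])
      then show "norm (G j t y) \<le> norm (indicator {P j..Q j} y *\<^sub>R B)"
        unfolding nG using g0 [of y j] by (cases "y \<in> {P j..Q j}") auto
    qed
  qed simp
  define H where "H t y = indicator S t *\<^sub>R (\<omega> t * (\<Prod>j\<in>UNIV. G j t (y $ j)))" for t :: real and y :: "real^'n"
  have GH: "(\<Prod>j\<in>UNIV. G j t (y $ j)) = exp (- (\<sigma> t * of_real ((norm (x - y))\<^sup>2))) * (\<Prod>j\<in>UNIV. g j (y $ j))" for t y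
  proof -
    have "(norm (x - y))\<^sup>2 = (\<Sum>j\<in>UNIV. (x $ j - y $ j)\<^sup>2)"
      by (simp add: norm_vec_def L2_set_def sum_nonneg)
    then have "exp (- (\<sigma> t * of_real ((norm (x - y))\<^sup>2))) = (\<Prod>j\<in>UNIV. exp (- (\<sigma> t * of_real ((x $ j - y $ j)\<^sup>2))))"
      by (simp add: sum_distrib_left exp_sum flip: sum_negf)
    then show ?thesis by (simp add: G_def prod.distrib)
  qed
  have nth: "(\<lambda>p :: real \<times> (real^'n). snd p $ j) \<in> borel_measurable (borel \<Otimes>\<^sub>M borel)" for j
    unfolding borel_prod by (intro borel_measurable_continuous_onI continuous_intros)
  have [measurable]: "(\<lambda>p :: real \<times> (real^'n). snd p $ j) \<in> borel_measurable (lborel \<Otimes>\<^sub>M lborel)" for j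
    using nth [of j] by (simp add: measurable_def space_pair_measure sets_pair_measure)
  have H_meas: "case_prod H \<in> borel_measurable (lborel \<Otimes>\<^sub>M lborel)"
    unfolding H_def G_def by measurable
  have inner: "(LINT y|lborel. norm (H t y)) = indicator S t *\<^sub>R (norm (\<omega> t) *
        (\<Prod>j\<in>UNIV. (LINT y|lborel. norm (g j y) * exp (- (Re (\<sigma> t) * (x $ j - y)\<^sup>2)))))" for t
  proof (cases "t \<in> S")
    case True
    have "(LINT y|lborel. norm (H t y)) = (LINT y|lborel. norm (\<omega> t) * (\<Prod>j\<in>UNIV. norm (G j t ((y::real^'n) $ j))))"
      using True by (simp add: H_def norm_mult prod_norm)
    also have "\<dots> = norm (\<omega> t) * (\<Prod>j\<in>UNIV. (LINT y|lborel. norm (G j t y)))"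
      using lborel_prod_vec(2) [of "\<lambda>j y. norm (G j t y)"] intG [OF True] by simp
    finally show ?thesis using True by (simp add: nG)
  qed (simp add: H_def)
  have H_int: "integrable (lborel \<Otimes>\<^sub>M lborel) (case_prod H)"
  proof (rule lborel_pair.Fubini_integrable [OF H_meas])
    show "integrable lborel (\<lambda>t. LINT y|lborel. norm (case_prod H (t, y)))"
      using int unfolding prod.case inner set_integrable_def .
    show "AE t in lborel. integrable lborel (\<lambda>y. case_prod H (t, y))"
    proof (intro AE_I2)
      fix t show "integrable lborel (\<lambda>y. case_prod H (t, y))"
        using lborel_prod_vec(1) [of "\<lambda>j. G j t"] intG by (cases "t \<in> S") (auto simp: H_def)
    qed
  qed
  have eq: "(LINT t|lborel. H t y) = (LINT t:S|lborel. \<omega> t * exp (- (\<sigma> t * of_real ((norm (x - y))\<^sup>2)))) * (\<Prod>j\<in>UNIV. g j (y $ j))" for y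
  proof -
    have "(LINT t|lborel. H t y) = (LINT t|lborel. (indicator S t *\<^sub>R (\<omega> t * exp (- (\<sigma> t * of_real ((norm (x - y))\<^sup>2))))) * (\<Prod>j\<in>UNIV. g j (y $ j)))"
      by (intro Bochner_Integration.integral_cong) (simp_all add: H_def GH)
    then show ?thesis unfolding set_lebesgue_integral_def integral_mult_left_zero .
  qed
  show ?I
    using lborel_pair.integrable_snd [OF H_int] unfolding eq .
  have inner': "(LINT y|lborel. H t y) = indicator S t *\<^sub>R (\<omega> t * (\<Prod>j\<in>UNIV. (LINT y|lborel. G j t y)))" for t
    using lborel_prod_vec(2) [of "\<lambda>j. G j t"] intG by (cases "t \<in> S") (auto simp: H_def)
  have "(LINT y|lborel. (LINT t|lborel. H t y)) = (LINT t|lborel. (LINT y|lborel. H t y))"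
    by (rule lborel_pair.Fubini_integral [OF H_int])
  then show ?E
    unfolding eq inner' unfolding set_lebesgue_integral_def G_def .
qed

lemma set_integrable_bounded_lborel:
  fixes f :: "real \<Rightarrow> 'a::{banach,second_countable_topology}"
  assumes "S \<in> sets borel" "emeasure lborel S < \<infinity>" "f \<in> borel_measurable borel"
    and "\<And>t. t \<in> S \<Longrightarrow> norm (f t) \<le> B"
  shows "set_integrable lborel S f"
  unfolding set_integrable_def
  by (rule integrableI_bounded_set_indicator [where B = B]) (use assms in auto)

lemma norm_set_integral_Ioo_le:
  fixes f :: "real \<Rightarrow> 'a::{banach,second_countable_topology}"
  assumes "a \<le> b" "\<And>t. t \<in> {a<..<b} \<Longrightarrow> norm (f t) \<le> B" "B \<ge> 0"
  shows "norm (LINT t:{a<..<b}|lborel. f t) \<le> B * (b - a)"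
proof -
  have "norm (LINT t:{a<..<b}|lborel. f t) \<le> (LINT t|lborel. norm (indicator {a<..<b} t *\<^sub>R f t))"
    unfolding set_lebesgue_integral_def by (rule integral_norm_bound)
  also have "\<dots> \<le> (LINT t|lborel. indicator {a<..<b} t *\<^sub>R B)"
  proof (rule integral_mono')
    show "integrable lborel (\<lambda>t. indicator {a<..<b} t *\<^sub>R B)"
      by (intro integrable_real_indicator integrable_scaleR_left) (use assms(1) in auto)
  qed (use assms in \<open>auto simp: indicator_def\<close>)
  also have "\<dots> = B * (b - a)"
    using assms by (simp add: measure_lborel_Ioo)
  finally show ?thesis .
qed

section \<open>The diffraction potential\<close>

lemma has_field_derivative_eta_smooth:
  "((\<lambda>z. (\<Sum>k<M. hermite_coeff k * hermite (2 * k) z) * exp (- z\<^sup>2) / of_real (sqrt pi)) has_field_derivative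
    ((\<Sum>k<M. hermite_coeff k * (2 * z * hermite (2 * k) z - hermite (Suc (2 * k)) z)) * exp (- z\<^sup>2)
      + exp (- z\<^sup>2) * (- 2 * z) * (\<Sum>k<M. hermite_coeff k * hermite (2 * k) z)) / of_real (sqrt pi)) (at z)"
proof (intro DERIV_cdivide DERIV_mult DERIV_sum DERIV_cmult has_field_derivative_hermite)
  show "((\<lambda>z. exp (- z\<^sup>2)) has_field_derivative exp (- z\<^sup>2) * (- 2 * z)) (at z)"
    by (auto intro!: derivative_eq_intros)
qed

lemma eta_smooth_C1:
  obtains \<phi>' where "\<And>y. ((\<lambda>y. eta_smooth M (a * y)) has_vector_derivative \<phi>' y) (at y)" "continuous_on UNIV \<phi>'"
proof
  define D where "D z = ((\<Sum>k<M. hermite_coeff k * (2 * z * hermite (2 * k) z - hermite (Suc (2 * k)) z)) * exp (- z\<^sup>2)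
      + exp (- z\<^sup>2) * (- 2 * z) * (\<Sum>k<M. hermite_coeff k * hermite (2 * k) z)) / of_real (sqrt pi)" for z
  show "((\<lambda>y. eta_smooth M (a * y)) has_vector_derivative of_real a * D (of_real (a * y))) (at y)" for y
  proof -
    have "((\<lambda>z. (\<Sum>k<M. hermite_coeff k * hermite (2 * k) (of_real a * z)) * exp (- (of_real a * z)\<^sup>2) / of_real (sqrt pi))
       has_field_derivative D (of_real a * of_real y) * of_real a) (at (of_real y))"
      unfolding D_def
      by (rule DERIV_chain2 [OF has_field_derivative_eta_smooth]) (auto intro!: derivative_eq_intros)
    from has_vector_derivative_real_field [OF this] show ?thesis
      by (simp add: eta_smooth_def [abs_def] mult.commute)
  qed
  show "continuous_on UNIV (\<lambda>y. of_real a * D (of_real (a * y)))"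
    unfolding D_def by (intro continuous_intros) auto
qed

lemma borel_measurable_eta [measurable]: "eta M \<in> borel_measurable borel"
proof -
  have "(\<lambda>x. hermite (2 * M - 1) (of_real x)) \<in> borel_measurable borel"
    by (intro borel_measurable_continuous_onI continuous_intros)
  then show ?thesis
    unfolding eta_def [abs_def] by measurable
qed

lemma csqrt_of_real_times_ii:
  assumes "r > 0"
  shows "csqrt (of_real r * \<i>) = of_real (sqrt r) * exp (\<i> * of_real (pi / 4))"
proof (rule csqrt_unique)
  have "(exp (\<i> * of_real (pi / 4)))\<^sup>2 = exp (\<i> * of_real (pi / 2))"
    by (simp flip: exp_of_nat_mult exp_double) 
  also have "\<dots> = \<i>" by (simp add: complex_eq_iff Re_exp Im_exp)
  finally show "(of_real (sqrt r) * exp (\<i> * of_real (pi / 4)))\<^sup>2 = of_real r * \<i>"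
    using assms by (simp add: power_mult_distrib flip: of_real_power)
  have "Re (of_real (sqrt r) * exp (\<i> * of_real (pi / 4))) > 0"
    using assms by (simp add: Re_exp cos_45)
  then show "0 < Re (of_real (sqrt r) * exp (\<i> * of_real (pi / 4))) \<or>
     Re (of_real (sqrt r) * exp (\<i> * of_real (pi / 4))) = 0 \<and> 0 \<le> Im (of_real (sqrt r) * exp (\<i> * of_real (pi / 4)))" ..
qed

section \<open>The one-dimensional factors and their bounds\<close>

locale diffraction =
  fixes M :: nat and \<kappa> :: real and a P Q :: "'n::finite \<Rightarrow> real" and x :: "real^'n"
  assumes card: "CARD('n) \<ge> 3" and M: "M \<ge> 1" and \<kappa>: "\<kappa> > 0"
    and a: "\<And>j. a j > 0" and PQ: "\<And>j. P j < Q j"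
begin

definition \<nu> :: real where "\<nu> = real CARD('n) / 2 - 1"

definition g :: "'n \<Rightarrow> real \<Rightarrow> complex" where
  "g j y = of_real (indicator {P j<..<Q j} y) * eta M (a j * y)"

text \<open>One coordinate's factor of the superposed potential, for the rate \<sigma> = 1 / (4
  \<tau>).\<close>

definition K :: "'n \<Rightarrow> complex \<Rightarrow> complex" where
  "K j \<sigma> = (LINT y|lborel. exp (- (\<sigma> * of_real ((x $ j - y)\<^sup>2))) * g j y)"

text \<open>The counterpart of \<open>K\<close> with absolute values, \<rho> standing for Re
  \<sigma>. It justifies Fubini; the smallness of the final integrand near time 0 comes from
  \<open>K\<close>.\<close>

definition W :: "'n \<Rightarrow> real \<Rightarrow> real" where
  "W j \<rho> = (LINT y|lborel. norm (g j y) * exp (- (\<rho> * (x $ j - y)\<^sup>2)))"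

lemma \<nu>: "\<nu> > 0" "- \<nu> - 1 = - (real CARD('n) / 2)"
  using card by (simp_all add: \<nu>_def)

lemma g_measurable [measurable]: "g j \<in> borel_measurable borel"
  unfolding g_def by measurable

lemma K_measurable [measurable]: "K j \<in> borel_measurable borel"
  unfolding K_def by measurable

lemma W_measurable [measurable]: "W j \<in> borel_measurable borel"
  unfolding W_def by measurable

lemma K_eq_integral:
  "K j \<sigma> = integral {P j..Q j} (\<lambda>y. exp (- (\<sigma> * of_real ((x $ j - y)\<^sup>2))) * eta_smooth M (a j * y))"
proof -
  obtain \<phi>' where \<phi>': "\<And>y. ((\<lambda>y. eta_smooth M (a j * y)) has_vector_derivative \<phi>' y) (at y)"
    using eta_smooth_C1 [of M "a j"] by blast
  have cont: "continuous_on UNIV (\<lambda>y. eta_smooth M (a j * y))"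
    using \<phi>' by (intro continuous_at_imp_continuous_on) (blast intro: has_vector_derivative_continuous)
  define h where "h y = exp (- (\<sigma> * of_real ((x $ j - y)\<^sup>2))) * eta_smooth M (a j * y)" for y
  have h: "continuous_on UNIV h"
    unfolding h_def by (intro continuous_intros cont)
  have [measurable]: "h \<in> borel_measurable borel"
    using h by (rule borel_measurable_continuous_onI)
  have "K j \<sigma> = (LINT y:{P j..Q j}|lborel. h y)"
    unfolding K_def set_lebesgue_integral_def
  proof (rule integral_cong_AE)
    \<comment> \<open>The exceptional points: the end points, where open and closed interval differ,
      and 0, where \<open>eta\<close> and \<open>eta_smooth\<close> may differ.\<close>
    have "AE y in lborel. y \<notin> {P j, Q j, 0}"
      by (intro AE_not_in finite_imp_null_set_lborel) simp
    then show "AE y in lborel. exp (- (\<sigma> * of_real ((x $ j - y)\<^sup>2))) * g j y = indicator {P j..Q j} y *\<^sub>R h y"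
    proof eventually_elim
      case (elim y)
      have "eta M (a j * y) = eta_smooth M (a j * y)"
        using elim a [of j] M by (intro eta_eq_eta_smooth) auto
      then show ?case
        using elim by (auto simp: g_def h_def indicator_def)
    qed
  qed auto
  also have "\<dots> = integral {P j..Q j} h"
    by (intro set_borel_integral_eq_integral borel_integrable_atLeastAtMost' continuous_on_subset [OF h]) auto
  finally show ?thesis unfolding h_def .
qed

lemma g_bounded:
  obtains B where "B > 0" "\<And>j y. norm (g j y) \<le> B"
proof -
  have "\<exists>B>0. \<forall>y. norm (g j y) \<le> B" for j
  proof -
    obtain \<phi>' where \<phi>': "\<And>y. ((\<lambda>y. eta_smooth M (a j * y)) has_vector_derivative \<phi>' y) (at y)"
      using eta_smooth_C1 [of M "a j"] by blast
    then have "continuous_on {P j..Q j} (\<lambda>y. eta_smooth M (a j * y))"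
      by (intro continuous_at_imp_continuous_on) (blast intro: has_vector_derivative_continuous)
    then have "compact ((\<lambda>y. eta_smooth M (a j * y)) ` {P j..Q j})"
      by (intro compact_continuous_image) auto
    then obtain B where B: "B > 0" "\<And>y. y \<in> {P j..Q j} \<Longrightarrow> norm (eta_smooth M (a j * y)) \<le> B"
      using compact_imp_bounded bounded_pos by (metis imageI)
    have "norm (g j y) \<le> B" for y
    proof (cases "y \<in> {P j<..<Q j} \<and> y \<noteq> 0")
      case True
      then have "g j y = eta_smooth M (a j * y)"
        using a [of j] M by (simp add: g_def eta_eq_eta_smooth)
      then show ?thesis using B True by simp
    next
      case False
      then have "g j y = 0" by (auto simp: g_def eta_def)
      then show ?thesis using B by simp
    qed
    then show ?thesis using B by blast
  qed
  then obtain B where B: "\<And>j. B j > 0" "\<And>j y. norm (g j y) \<le> B j" by metis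
  have le: "B j \<le> (\<Sum>j\<in>UNIV. B j)" for j
    using B(1) by (intro member_le_sum) (auto intro: less_imp_le)
  show ?thesis
  proof (rule that)
    show "(\<Sum>j\<in>UNIV. B j) > 0" by (intro sum_pos) (use B in auto)
    show "norm (g j y) \<le> (\<Sum>j\<in>UNIV. B j)" for j y
      using B(2) le order_trans by blast
  qed
qed

lemma g_support: "y \<notin> {P j..Q j} \<Longrightarrow> g j y = 0"
  by (auto simp: g_def)

text \<open>Oscillation makes \<open>K\<close> decay in |\<sigma>| on the whole closed half-plane.
  For \<open>W\<close> only the real part counts; its decay follows from the same Fresnel bound with
  weight 1 and real \<sigma>. One D serves all coordinates, obtained by summing over the finite
  index type.\<close>

lemma KW_bounds:
  obtains D where "D > 0" "\<And>j \<sigma>. Re \<sigma> \<ge> 0 \<Longrightarrow> \<sigma> \<noteq> 0 \<Longrightarrow> norm (K j \<sigma>) \<le> D / sqrt (norm \<sigma>)"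
    "\<And>j \<sigma>. Re \<sigma> \<ge> 0 \<Longrightarrow> norm (K j \<sigma>) \<le> D"
    "\<And>j \<rho>. \<rho> \<ge> 0 \<Longrightarrow> W j \<rho> \<le> D" "\<And>j \<rho>. \<rho> > 0 \<Longrightarrow> W j \<rho> \<le> D / sqrt \<rho>"
proof -
  obtain B where B: "B > 0" "\<And>j y. norm (g j y) \<le> B" using g_bounded by blast
  have "\<exists>C>0. \<forall>\<sigma>. Re \<sigma> \<ge> 0 \<longrightarrow> \<sigma> \<noteq> 0 \<longrightarrow> norm (K j \<sigma>) \<le> C / sqrt (norm \<sigma>)" for j
  proof -
    obtain \<phi>' where "\<And>y. ((\<lambda>y. eta_smooth M (a j * y)) has_vector_derivative \<phi>' y) (at y)" "continuous_on UNIV \<phi>'"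
      using eta_smooth_C1 [of M "a j"] by blast
    from fresnel_weighted_bound [OF this less_imp_le [OF PQ [of j]]]
    show ?thesis unfolding K_eq_integral by metis
  qed
  then obtain C1 where C1: "\<And>j. C1 j > 0" "\<And>j \<sigma>. Re \<sigma> \<ge> 0 \<Longrightarrow> \<sigma> \<noteq> 0 \<Longrightarrow> norm (K j \<sigma>) \<le> C1 j / sqrt (norm \<sigma>)"
    by metis
  have "\<exists>C>0. \<forall>\<rho>>0. norm (integral {P j..Q j} (\<lambda>y. exp (- (of_real \<rho> * of_real ((x $ j - y)\<^sup>2))) * (1::complex))) \<le> C / sqrt \<rho>" for j
  proof -
    have "((\<lambda>y::real. 1::complex) has_vector_derivative 0) (at y)" for y by simp
    from fresnel_weighted_bound [OF this continuous_on_const less_imp_le [OF PQ [of j]]]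
    obtain C where C: "C > 0" "\<And>\<sigma> x. Re \<sigma> \<ge> 0 \<Longrightarrow> \<sigma> \<noteq> 0 \<Longrightarrow>
        norm (integral {P j..Q j} (\<lambda>y. exp (- (\<sigma> * of_real ((x - y)\<^sup>2))) * (1::complex))) \<le> C / sqrt (norm \<sigma>)"
      by blast
    show ?thesis
    proof (intro exI conjI allI impI)
      fix \<rho> :: real assume "\<rho> > 0"
      with C(2) [of "of_real \<rho>" "x $ j"]
      show "norm (integral {P j..Q j} (\<lambda>y. exp (- (of_real \<rho> * of_real ((x $ j - y)\<^sup>2))) * (1::complex))) \<le> C / sqrt \<rho>"
        by simp
    qed (rule C(1))
  qed
  then obtain C2 where C2: "\<And>j. C2 j > 0" "\<And>j \<rho>. \<rho> > 0 \<Longrightarrow> norm (integral {P j..Q j} (\<lambda>y. exp (- (of_real \<rho> * of_real ((x $ j - y)\<^sup>2))) * (1::complex))) \<le> C2 j / sqrt \<rho>"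
    by metis
  have W_le: "W j \<rho> \<le> B * integral {P j..Q j} (\<lambda>y. exp (- (\<rho> * (x $ j - y)\<^sup>2)))" for j \<rho>
  proof -
    have c: "continuous_on {P j..Q j} (\<lambda>y. B * exp (- (\<rho> * (x $ j - y)\<^sup>2)))"
      by (intro continuous_intros)
    have "W j \<rho> \<le> (LINT y|lborel. indicator {P j..Q j} y *\<^sub>R (B * exp (- (\<rho> * (x $ j - y)\<^sup>2))))"
      unfolding W_def
    proof (rule integral_mono')
      show "integrable lborel (\<lambda>y. indicator {P j..Q j} y *\<^sub>R (B * exp (- (\<rho> * (x $ j - y)\<^sup>2))))"
        using borel_integrable_atLeastAtMost' [OF c] by (simp add: set_integrable_def)
      show "norm (g j y) * exp (- (\<rho> * (x $ j - y)\<^sup>2)) \<le> indicator {P j..Q j} y *\<^sub>R (B * exp (- (\<rho> * (x $ j - y)\<^sup>2)))" for y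
        using g_support [of y j] B(2) [of j y] by (cases "y \<in> {P j..Q j}") auto
    qed (use B in \<open>auto simp: indicator_def\<close>)
    also have "\<dots> = integral {P j..Q j} (\<lambda>y. B * exp (- (\<rho> * (x $ j - y)\<^sup>2)))"
      using set_borel_integral_eq_integral(2) [OF borel_integrable_atLeastAtMost' [OF c]]
      unfolding set_lebesgue_integral_def .
    finally show ?thesis by simp
  qed
  have W1: "W j \<rho> \<le> B * (Q j - P j)" if "\<rho> \<ge> 0" for j \<rho>
  proof -
    have "norm (integral {P j..Q j} (\<lambda>y. exp (- (\<rho> * (x $ j - y)\<^sup>2)))) \<le> 1 * (Q j - P j)"
      by (rule integral_bound) (use that less_imp_le [OF PQ [of j]] in \<open>auto intro!: continuous_intros\<close>)
    then have "B * integral {P j..Q j} (\<lambda>y. exp (- (\<rho> * (x $ j - y)\<^sup>2))) \<le> B * (Q j - P j)"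
      using B(1) by (intro mult_left_mono) auto
    with W_le [of j \<rho>] show ?thesis by linarith
  qed
  have W2: "W j \<rho> \<le> B * C2 j / sqrt \<rho>" if "\<rho> > 0" for j \<rho>
  proof -
    have "((\<lambda>y. complex_of_real (exp (- (\<rho> * (x $ j - y)\<^sup>2)))) has_integral of_real (integral {P j..Q j} (\<lambda>y. exp (- (\<rho> * (x $ j - y)\<^sup>2))))) {P j..Q j}"
      by (intro has_integral_of_real integrable_integral integrable_continuous_real continuous_intros)
    then have "norm (complex_of_real (integral {P j..Q j} (\<lambda>y. exp (- (\<rho> * (x $ j - y)\<^sup>2))))) \<le> C2 j / sqrt \<rho>"
      using C2(2) [OF that, of j] by (simp add: integral_unique exp_of_real [symmetric])
    then have "B * integral {P j..Q j} (\<lambda>y. exp (- (\<rho> * (x $ j - y)\<^sup>2))) \<le> B * (C2 j / sqrt \<rho>)"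
      using B(1) by (intro mult_left_mono) auto
    with W_le [of j \<rho>] show ?thesis by simp
  qed
  have KW: "norm (K j \<sigma>) \<le> W j (Re \<sigma>)" for j \<sigma>
  proof -
    have "norm (K j \<sigma>) \<le> (LINT y|lborel. norm (exp (- (\<sigma> * of_real ((x $ j - y)\<^sup>2))) * g j y))"
      unfolding K_def by (rule integral_norm_bound)
    also have "\<dots> = W j (Re \<sigma>)"
      unfolding W_def by (intro Bochner_Integration.integral_cong) (auto simp: norm_mult simp del: of_real_power)
    finally show ?thesis .
  qed
  define D where "D = (\<Sum>j\<in>UNIV. C1 j + B * C2 j + B * (Q j - P j))"
  have D: "C1 j + B * C2 j + B * (Q j - P j) \<le> D" for j
    unfolding D_def
    by (rule member_le_sum [where f = "\<lambda>j. C1 j + B * C2 j + B * (Q j - P j)"])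
       (use C1(1) C2(1) B(1) PQ in \<open>auto intro!: add_nonneg_nonneg mult_nonneg_nonneg intro: less_imp_le\<close>)
  have pos: "C1 j > 0" "B * C2 j > 0" "B * (Q j - P j) > 0" for j
    using C1(1) C2(1) B(1) PQ by auto
  have D': "C1 j \<le> D" "B * C2 j \<le> D" "B * (Q j - P j) \<le> D" for j
    using D [of j] pos [of j] by linarith+
  show ?thesis
  proof (rule that)
    show "D > 0" using D'(1) pos(1) by (rule less_le_trans [rotated])
    show "norm (K j \<sigma>) \<le> D / sqrt (norm \<sigma>)" if "Re \<sigma> \<ge> 0" "\<sigma> \<noteq> 0" for j \<sigma>
      using C1(2) [OF that] D'(1) [of j] by (meson divide_right_mono norm_ge_zero order_trans real_sqrt_ge_zero)
    show "norm (K j \<sigma>) \<le> D" if "Re \<sigma> \<ge> 0" for j \<sigma>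
      using KW [of j \<sigma>] W1 [OF that, of j] D'(3) [of j] by linarith
    show "W j \<rho> \<le> D" if "\<rho> \<ge> 0" for j \<rho>
      using W1 [OF that, of j] D'(3) [of j] by linarith
    show "W j \<rho> \<le> D / sqrt \<rho>" if "\<rho> > 0" for j \<rho>
      using W2 [OF that, of j] D'(2) [of j] that by (meson divide_right_mono order_trans real_sqrt_ge_zero less_imp_le)
  qed
qed

end

lemma wt_measurable [measurable]:
  "wt1 \<kappa> \<nu> \<in> borel_measurable borel" "rate1 \<in> borel_measurable borel"
  "wt2 \<kappa> \<nu> c \<in> borel_measurable borel" "rate2 c \<in> borel_measurable borel"
  "wt3 \<kappa> \<nu> \<in> borel_measurable borel" "rate3 \<in> borel_measurable borel"
  unfolding wt1_def [abs_def] rate1_def [abs_def] wt2_def [abs_def] rate2_def [abs_def] wt3_def [abs_def] rate3_def [abs_def]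
  by measurable

lemma has_integral_Ici:
  fixes F :: "real \<Rightarrow> 'a::banach"
  assumes "(F has_integral I) {c<..}"
  shows "(F has_integral I) {c..}"
proof -
  have "negligible {s \<in> {c..} - {c<..}. F s \<noteq> 0}"
    by (rule negligible_subset [of "{c}"]) auto
  moreover have "negligible {s \<in> {c<..} - {c..}. F s \<noteq> 0}"
    by (rule negligible_subset [of "{}"]) auto
  ultimately show ?thesis
    using assms has_integral_spike_set_eq by blast
qed

lemma norm_wt2_le:
  assumes "c > 0"
  shows "norm (wt2 \<kappa> \<nu> c \<theta>) \<le> exp (\<kappa>\<^sup>2 * c) * c powr (- \<nu>)"
proof -
  have "norm (wt2 \<kappa> \<nu> c \<theta>) = exp (\<kappa>\<^sup>2 * c * cos \<theta> - \<nu> * ln c)"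
    by (simp add: wt2_def norm_mult Re_exp)
  also have "\<kappa>\<^sup>2 * c * cos \<theta> \<le> \<kappa>\<^sup>2 * c * 1"
    using assms by (intro mult_left_mono) auto
  then have "exp (\<kappa>\<^sup>2 * c * cos \<theta> - \<nu> * ln c) \<le> exp (\<kappa>\<^sup>2 * c) * c powr (- \<nu>)"
    using assms by (simp add: powr_def flip: exp_add)
  finally show ?thesis .
qed

section \<open>Exchanging space and time integrals on the pieces of the contour\<close>

context diffraction
begin

text \<open>Here singularity and dimension balance: the weight is t^(-n/2), and each of the n
  factors is at most 2 D sqrt t.\<close>

lemma powr_sqrt_cancel:
  assumes "t > 0"
  shows "t powr (- \<nu> - 1) * (2 * D * sqrt t) ^ CARD('n) = (2 * D) ^ CARD('n)"
proof -
  have "sqrt t ^ CARD('n) = t powr (real CARD('n) / 2)"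
    using assms by (simp add: powr_half_sqrt [symmetric] powr_powr flip: powr_realpow)
  then show ?thesis
    unfolding power_mult_distrib \<nu>(2) using assms by (simp add: powr_minus)
qed

definition f :: "real^'n \<Rightarrow> complex" where
  "f y = (\<Prod>j\<in>UNIV. g j (y $ j))"

text \<open>\<open>kern\<close> and \<open>superpos\<close> belong to the two orders of integration
  over a piece of the contour: time first, or space first.\<close>

definition kern :: "real set \<Rightarrow> (real \<Rightarrow> complex) \<Rightarrow> (real \<Rightarrow> complex) \<Rightarrow> real^'n \<Rightarrow> complex" where
  "kern S \<omega> \<sigma> y = (LINT t:S|lborel. \<omega> t * exp (- (\<sigma> t * of_real ((norm (x - y))\<^sup>2)))) * f y"

definition superpos :: "real set \<Rightarrow> (real \<Rightarrow> complex) \<Rightarrow> (real \<Rightarrow> complex) \<Rightarrow> complex" where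
  "superpos S \<omega> \<sigma> = (LINT t:S|lborel. \<omega> t * (\<Prod>j\<in>UNIV. K j (\<sigma> t)))"

lemma superposition:
  assumes "\<omega> \<in> borel_measurable borel" "\<sigma> \<in> borel_measurable borel" "S \<in> sets borel"
    and "\<And>t. t \<in> S \<Longrightarrow> Re (\<sigma> t) \<ge> 0"
    and "set_integrable lborel S (\<lambda>t. norm (\<omega> t) * (\<Prod>j\<in>UNIV. W j (Re (\<sigma> t))))"
  shows "integrable lborel (kern S \<omega> \<sigma>)" "(LINT y|lborel. kern S \<omega> \<sigma> y) = superpos S \<omega> \<sigma>"
proof -
  obtain B where B: "\<And>j y. norm (g j y) \<le> B" using g_bounded by blast
  note * = gaussian_superposition [of g B P Q \<omega> \<sigma> S x, OF g_measurable B g_support assms(1-4)]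
  show "integrable lborel (kern S \<omega> \<sigma>)"
    unfolding kern_def [abs_def] f_def by (rule *(1)) (use assms(5) in \<open>auto simp: W_def\<close>)
  show "(LINT y|lborel. kern S \<omega> \<sigma> y) = superpos S \<omega> \<sigma>"
    unfolding kern_def [abs_def] f_def superpos_def K_def by (rule *(2)) (use assms(5) in \<open>auto simp: W_def\<close>)
qed

lemma W_nonneg: "W j \<rho> \<ge> 0"
  unfolding W_def by (intro Bochner_Integration.integral_nonneg) auto

text \<open>The rate 1 / (4 t) is real, so \<open>W\<close> is at most D / sqrt(1 / (4 t)) = 2 D
  sqrt t, and the majorant stays bounded down to t = 0.\<close>

lemma superposition1:
  assumes c: "c > 0"
  shows "integrable lborel (kern {0<..<c} (wt1 \<kappa> \<nu>) rate1)"
    "(LINT y|lborel. kern {0<..<c} (wt1 \<kappa> \<nu>) rate1 y) = superpos {0<..<c} (wt1 \<kappa> \<nu>) rate1"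
proof -
  obtain D where D: "D > 0" "\<And>j \<rho>. \<rho> > 0 \<Longrightarrow> W j \<rho> \<le> D / sqrt \<rho>" using KW_bounds by metis
  have int: "set_integrable lborel {0<..<c} (\<lambda>t. norm (wt1 \<kappa> \<nu> t) * (\<Prod>j\<in>UNIV. W j (Re (rate1 t))))"
  proof (rule set_integrable_bounded_lborel)
    fix t assume "t \<in> {0<..<c}"
    then have t: "t > 0" "t < c" by auto
    have "W j (Re (rate1 t)) \<le> 2 * D * sqrt t" for j
      using D(2) [of "1 / (4 * t)" j] t by (simp add: rate1_def real_sqrt_divide real_sqrt_mult mult_ac)
    then have "(\<Prod>j\<in>UNIV. W j (Re (rate1 t))) \<le> (\<Prod>j\<in>(UNIV::'n set). 2 * D * sqrt t)"
      by (intro prod_mono) (auto simp: W_nonneg)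
    then have le: "(\<Prod>j\<in>UNIV. W j (Re (rate1 t))) \<le> (2 * D * sqrt t) ^ CARD('n)" by simp
    have "norm (norm (wt1 \<kappa> \<nu> t) * (\<Prod>j\<in>UNIV. W j (Re (rate1 t)))) = exp (\<kappa>\<^sup>2 * t) * (t powr (- \<nu> - 1) * (\<Prod>j\<in>UNIV. W j (Re (rate1 t))))"
      using t by (simp add: wt1_def norm_mult abs_mult abs_prod W_nonneg mult_ac)
    also have "\<dots> \<le> exp (\<kappa>\<^sup>2 * c) * (t powr (- \<nu> - 1) * (2 * D * sqrt t) ^ CARD('n))"
      using t le by (intro mult_mono mult_nonneg_nonneg prod_nonneg) (auto simp: W_nonneg intro: mult_left_mono)
    also have "\<dots> = exp (\<kappa>\<^sup>2 * c) * (2 * D) ^ CARD('n)"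
      using t by (simp only: powr_sqrt_cancel)
    finally show "norm (norm (wt1 \<kappa> \<nu> t) * (\<Prod>j\<in>UNIV. W j (Re (rate1 t)))) \<le> exp (\<kappa>\<^sup>2 * c) * (2 * D) ^ CARD('n)" .
  qed (use c in \<open>auto simp: emeasure_lborel_Ioo\<close>)
  show "integrable lborel (kern {0<..<c} (wt1 \<kappa> \<nu>) rate1)"
    "(LINT y|lborel. kern {0<..<c} (wt1 \<kappa> \<nu>) rate1 y) = superpos {0<..<c} (wt1 \<kappa> \<nu>) rate1"
    by (rule superposition; use int in \<open>auto simp: rate1_def\<close>)+
qed

lemma superposition2:
  assumes c: "c > 0"
  shows "integrable lborel (kern {0<..<pi/2} (wt2 \<kappa> \<nu> c) (rate2 c))"
    "(LINT y|lborel. kern {0<..<pi/2} (wt2 \<kappa> \<nu> c) (rate2 c) y) = superpos {0<..<pi/2} (wt2 \<kappa> \<nu> c) (rate2 c)"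
proof -
  have Re: "Re (rate2 c \<theta>) \<ge> 0" if "\<theta> \<in> {0<..<pi/2}" for \<theta>
  proof -
    have "cos \<theta> \<ge> 0" using that by (intro cos_ge_zero) auto
    then show ?thesis using c unfolding rate2_def Re_divide_of_real by (simp add: Re_exp)
  qed
  obtain D where D: "D > 0" "\<And>j \<rho>. \<rho> \<ge> 0 \<Longrightarrow> W j \<rho> \<le> D" using KW_bounds by metis
  have int: "set_integrable lborel {0<..<pi/2} (\<lambda>t. norm (wt2 \<kappa> \<nu> c t) * (\<Prod>j\<in>UNIV. W j (Re (rate2 c t))))"
  proof (rule set_integrable_bounded_lborel)
    fix t assume t: "t \<in> {0<..<pi/2}"
    have "(\<Prod>j\<in>UNIV. W j (Re (rate2 c t))) \<le> (\<Prod>j\<in>(UNIV::'n set). D)"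
      using D Re [OF t] by (intro prod_mono) (auto simp: W_nonneg)
    then have le: "(\<Prod>j\<in>UNIV. W j (Re (rate2 c t))) \<le> D ^ CARD('n)" by simp
    have "norm (norm (wt2 \<kappa> \<nu> c t) * (\<Prod>j\<in>UNIV. W j (Re (rate2 c t)))) = norm (wt2 \<kappa> \<nu> c t) * (\<Prod>j\<in>UNIV. W j (Re (rate2 c t)))"
      by (simp add: abs_mult abs_prod W_nonneg)
    also have "\<dots> \<le> (exp (\<kappa>\<^sup>2 * c) * c powr (- \<nu>)) * D ^ CARD('n)"
      using le norm_wt2_le [OF c] by (intro mult_mono prod_nonneg) (auto simp: W_nonneg)
    finally show "norm (norm (wt2 \<kappa> \<nu> c t) * (\<Prod>j\<in>UNIV. W j (Re (rate2 c t)))) \<le> (exp (\<kappa>\<^sup>2 * c) * c powr (- \<nu>)) * D ^ CARD('n)" .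
  qed (auto simp: emeasure_lborel_Ioo)
  show "integrable lborel (kern {0<..<pi/2} (wt2 \<kappa> \<nu> c) (rate2 c))"
    "(LINT y|lborel. kern {0<..<pi/2} (wt2 \<kappa> \<nu> c) (rate2 c) y) = superpos {0<..<pi/2} (wt2 \<kappa> \<nu> c) (rate2 c)"
    by (rule superposition; use int Re in auto)+
qed

lemma norm_wt3: "norm (wt3 \<kappa> \<nu> s) = s powr (- \<nu> - 1)"
  by (simp add: wt3_def norm_mult)

text \<open>On the imaginary ray the rate has real part 0, so the majorant is the weight times a
  constant; its integrability rests on the ray starting at c > 0 and on \<nu> > 0.\<close>

lemma superposition3:
  assumes c: "c > 0"
  shows "integrable lborel (kern {c<..} (wt3 \<kappa> \<nu>) rate3)"
    "(LINT y|lborel. kern {c<..} (wt3 \<kappa> \<nu>) rate3 y) = superpos {c<..} (wt3 \<kappa> \<nu>) rate3"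
proof -
  obtain D where D: "D > 0" "\<And>j \<rho>. \<rho> \<ge> 0 \<Longrightarrow> W j \<rho> \<le> D" using KW_bounds by metis
  have "set_integrable lborel {c<..} (\<lambda>s. s powr (- \<nu> - 1) * (\<Prod>j\<in>UNIV. W j 0))"
    using set_integrable_powr_Ioi [OF c \<nu>(1)] by simp
  then have int: "set_integrable lborel {c<..} (\<lambda>t. norm (wt3 \<kappa> \<nu> t) * (\<Prod>j\<in>UNIV. W j (Re (rate3 t))))"
    by (simp add: norm_wt3 rate3_def)
  show "integrable lborel (kern {c<..} (wt3 \<kappa> \<nu>) rate3)"
    "(LINT y|lborel. kern {c<..} (wt3 \<kappa> \<nu>) rate3 y) = superpos {c<..} (wt3 \<kappa> \<nu>) rate3"
    by (rule superposition; use int in \<open>auto simp: rate3_def\<close>)+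
qed

lemma potential_eq:
  assumes c: "c > 0"
  shows "integrable lborel (\<lambda>y. helmholtz_fund \<kappa> (x - y) * f y)"
    and "diffraction_potential \<kappa> f x = of_real ((4 * pi) powr (- \<nu> - 1)) *
      (superpos {0<..<c} (wt1 \<kappa> \<nu>) rate1 + superpos {0<..<pi/2} (wt2 \<kappa> \<nu> c) (rate2 c) + superpos {c<..} (wt3 \<kappa> \<nu>) rate3)"
proof -
  define F where "F y = of_real ((4 * pi) powr (- \<nu> - 1)) * (kern {0<..<c} (wt1 \<kappa> \<nu>) rate1 y
     + kern {0<..<pi/2} (wt2 \<kappa> \<nu> c) (rate2 c) y + kern {c<..} (wt3 \<kappa> \<nu>) rate3 y)" for y
  have F: "integrable lborel F"
    unfolding F_def [abs_def]
    by (intro integrable_mult_right Bochner_Integration.integrable_add superposition1 superposition2 superposition3 c)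
  \<comment> \<open>At y = x division by zero makes \<open>helmholtz_fund\<close> equal to 0, hence
    the indicator.\<close>
  have eq: "helmholtz_fund \<kappa> (x - y) * f y = indicator (- {x}) y *\<^sub>R F y" for y
  proof (cases "y = x")
    case True
    then show ?thesis by (simp add: helmholtz_fund_def)
  next
    case False
    then have "x - y \<noteq> 0" by simp
    from helmholtz_fund_eq_integrals [OF card \<kappa> c this]
    show ?thesis using False unfolding F_def kern_def \<nu>_def by (simp add: algebra_simps)
  qed
  show int: "integrable lborel (\<lambda>y. helmholtz_fund \<kappa> (x - y) * f y)"
    unfolding eq by (rule integrable_mult_indicator [OF _ F]) simp
  have "diffraction_potential \<kappa> f x = (LINT y|lborel. F y)"
    unfolding diffraction_potential_def
  proof (rule integral_cong_AE)
    show "AE y in lborel. helmholtz_fund \<kappa> (x - y) * f y = F y"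
      using AE_lborel_singleton [of x] by eventually_elim (simp add: eq)
  qed (use int F in auto)
  also have "\<dots> = of_real ((4 * pi) powr (- \<nu> - 1)) *
      (superpos {0<..<c} (wt1 \<kappa> \<nu>) rate1 + superpos {0<..<pi/2} (wt2 \<kappa> \<nu> c) (rate2 c) + superpos {c<..} (wt3 \<kappa> \<nu>) rate3)"
    unfolding F_def using superposition1 [OF c] superposition2 [OF c] superposition3 [OF c] by simp
  finally show "diffraction_potential \<kappa> f x = of_real ((4 * pi) powr (- \<nu> - 1)) *
      (superpos {0<..<c} (wt1 \<kappa> \<nu>) rate1 + superpos {0<..<pi/2} (wt2 \<kappa> \<nu> c) (rate2 c) + superpos {c<..} (wt3 \<kappa> \<nu>) rate3)" .
qed

text \<open>Letting the arc shrink to the origin moves the contour onto the imaginary axis.\<close>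

lemma potential_eq_limit:
  shows "set_integrable lborel {0<..} (\<lambda>s. wt3 \<kappa> \<nu> s * (\<Prod>j\<in>UNIV. K j (rate3 s)))" (is ?I)
    and "diffraction_potential \<kappa> f x = of_real ((4 * pi) powr (- \<nu> - 1)) * superpos {0<..} (wt3 \<kappa> \<nu>) rate3" (is ?E)
proof -
  obtain D where D: "D > 0" "\<And>j \<sigma>. Re \<sigma> \<ge> 0 \<Longrightarrow> \<sigma> \<noteq> 0 \<Longrightarrow> norm (K j \<sigma>) \<le> D / sqrt (norm \<sigma>)"
    "\<And>j \<sigma>. Re \<sigma> \<ge> 0 \<Longrightarrow> norm (K j \<sigma>) \<le> D" using KW_bounds by metis
  define C where "C = (2 * D) ^ CARD('n)"
  have C: "C \<ge> 0" using D by (simp add: C_def)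
  have prodK: "norm (\<Prod>j\<in>UNIV. K j \<sigma>) \<le> (2 * D * sqrt t) ^ CARD('n)" if "Re \<sigma> \<ge> 0" "norm \<sigma> = 1 / (4 * t)" "t > 0" for \<sigma> t
  proof -
    have "\<sigma> \<noteq> 0" using that by auto
    then have "norm (K j \<sigma>) \<le> 2 * D * sqrt t" for j
      using D(2) [OF that(1), of j] that by (simp add: real_sqrt_divide real_sqrt_mult mult_ac)
    then have "(\<Prod>j\<in>UNIV. norm (K j \<sigma>)) \<le> (\<Prod>j\<in>(UNIV::'n set). 2 * D * sqrt t)"
      by (intro prod_mono) auto
    then show ?thesis by (simp add: prod_norm)
  qed
  define L where "L s = wt3 \<kappa> \<nu> s * (\<Prod>j\<in>UNIV. K j (rate3 s))" for s
  have [measurable]: "L \<in> borel_measurable borel"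
    unfolding L_def by measurable
  \<comment> \<open>\<open>L1\<close> serves near 0, where the oscillatory bound balances the
    weight; \<open>L2\<close> serves near infinity, where the weight alone is integrable.\<close>
  have L1: "norm (L s) \<le> C" if "s > 0" for s
  proof -
    have "norm (L s) \<le> s powr (- \<nu> - 1) * (2 * D * sqrt s) ^ CARD('n)"
      unfolding L_def norm_mult norm_wt3 using that
      by (intro mult_left_mono prodK) (auto simp: rate3_def norm_divide)
    then show ?thesis using that by (simp only: powr_sqrt_cancel C_def)
  qed
  have L2: "norm (L s) \<le> s powr (- \<nu> - 1) * D ^ CARD('n)" if "s > 0" for s
  proof -
    have "(\<Prod>j\<in>UNIV. norm (K j (rate3 s))) \<le> (\<Prod>j\<in>(UNIV::'n set). D)"
      by (intro prod_mono) (auto intro!: D(3) simp: rate3_def)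
    then show ?thesis
      unfolding L_def norm_mult norm_wt3 by (intro mult_left_mono) (auto simp: prod_norm)
  qed
  have int0': "set_integrable lborel {0<..c} L" if "c > 0" for c :: real
    by (rule set_integrable_bounded_lborel [where B = C]) (use L1 that in auto)
  have int1: "set_integrable lborel {c<..} L" if "c > 0" for c
  proof (rule set_integrable_bound)
    show "set_integrable lborel {c<..} (\<lambda>s. s powr (- \<nu> - 1) * D ^ CARD('n))"
      using set_integrable_powr_Ioi [OF that \<nu>(1)] by simp
    show "set_borel_measurable lborel {c<..} L"
      unfolding set_borel_measurable_def by measurable
    show "AE s in lborel. s \<in> {c<..} \<longrightarrow> norm (L s) \<le> norm (s powr (- \<nu> - 1) * D ^ CARD('n))"
      using L2 that D by (intro AE_I2) (auto intro: order_trans [OF _ abs_ge_self])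
  qed
  have "{0<..} = {0<..1} \<union> {1::real<..}" by auto
  then have intL: "set_integrable lborel {0<..} L"
    using set_integrable_Un [OF int0' [of 1] int1 [of 1]] by simp
  then show ?I by (simp add: L_def [abs_def])

  define A where "A = of_real ((4 * pi) powr (- \<nu> - 1)) * superpos {0<..} (wt3 \<kappa> \<nu>) rate3"
  define c0 where "c0 = (4 * pi) powr (- \<nu> - 1)"
  \<comment> \<open>The left-hand side is the same for every c. The terms on the right belong to the
    real segment, the arc and the part of the imaginary axis below i c, and all are O(c).\<close>
  have bound: "norm (diffraction_potential \<kappa> f x - A) \<le> c0 * (exp (\<kappa>\<^sup>2 * c) * C * c + exp (\<kappa>\<^sup>2 * c) * C * c * (pi / 2) + C * c)"
    if c: "c > 0" for c
  proof -
    have I1: "norm (superpos {0<..<c} (wt1 \<kappa> \<nu>) rate1) \<le> exp (\<kappa>\<^sup>2 * c) * C * (c - 0)"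
      unfolding superpos_def
    proof (rule norm_set_integral_Ioo_le)
      fix t assume t: "t \<in> {0<..<c}"
      have "norm (wt1 \<kappa> \<nu> t * (\<Prod>j\<in>UNIV. K j (rate1 t))) = exp (\<kappa>\<^sup>2 * t) * (t powr (- \<nu> - 1) * norm (\<Prod>j\<in>UNIV. K j (rate1 t)))"
        by (simp add: wt1_def norm_mult)
      also have "\<dots> \<le> exp (\<kappa>\<^sup>2 * c) * (t powr (- \<nu> - 1) * (2 * D * sqrt t) ^ CARD('n))"
      proof (intro mult_mono)
        show "norm (\<Prod>j\<in>UNIV. K j (rate1 t)) \<le> (2 * D * sqrt t) ^ CARD('n)"
          using t by (intro prodK) (auto simp: rate1_def norm_divide)
      qed (use t in \<open>auto intro: mult_left_mono\<close>)
      also have "\<dots> = exp (\<kappa>\<^sup>2 * c) * C"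
        using t by (simp only: powr_sqrt_cancel C_def greaterThanLessThan_iff)
      finally show "norm (wt1 \<kappa> \<nu> t * (\<Prod>j\<in>UNIV. K j (rate1 t))) \<le> exp (\<kappa>\<^sup>2 * c) * C" .
    qed (use c C in auto)
    have I2: "norm (superpos {0<..<pi/2} (wt2 \<kappa> \<nu> c) (rate2 c)) \<le> exp (\<kappa>\<^sup>2 * c) * C * c * (pi / 2 - 0)"
      unfolding superpos_def
    proof (rule norm_set_integral_Ioo_le)
      fix t assume t: "t \<in> {0<..<pi/2}"
      have "cos t \<ge> 0" using t by (intro cos_ge_zero) auto
      then have r: "Re (rate2 c t) \<ge> 0" "norm (rate2 c t) = 1 / (4 * c)"
        using c unfolding rate2_def Re_divide_of_real by (auto simp: Re_exp norm_divide)
      have "norm (wt2 \<kappa> \<nu> c t * (\<Prod>j\<in>UNIV. K j (rate2 c t))) \<le> (exp (\<kappa>\<^sup>2 * c) * c powr (- \<nu>)) * (2 * D * sqrt c) ^ CARD('n)"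
        unfolding norm_mult by (intro mult_mono norm_wt2_le prodK r c) auto
      \<comment> \<open>The factor c is the Jacobian of the arc, which \<open>wt2\<close> contains;
        the other factor is the weight that \<open>powr_sqrt_cancel\<close> balances.\<close>
      also have "c powr (- \<nu>) = c * c powr (- \<nu> - 1)"
        using c by (simp add: powr_diff)
      also have "(exp (\<kappa>\<^sup>2 * c) * (c * c powr (- \<nu> - 1))) * (2 * D * sqrt c) ^ CARD('n)
          = exp (\<kappa>\<^sup>2 * c) * c * (c powr (- \<nu> - 1) * (2 * D * sqrt c) ^ CARD('n))"
        by (simp only: mult_ac)
      also have "\<dots> = exp (\<kappa>\<^sup>2 * c) * C * c"
        unfolding powr_sqrt_cancel [OF c] by (simp only: C_def mult_ac)
      finally show "norm (wt2 \<kappa> \<nu> c t * (\<Prod>j\<in>UNIV. K j (rate2 c t))) \<le> exp (\<kappa>\<^sup>2 * c) * C * c" .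
    qed (use c C in auto)
    have Un: "{0<..} = {0<..c} \<union> {c<..}" using c by auto
    have "superpos {0<..} (wt3 \<kappa> \<nu>) rate3 = (LINT s:{0<..c} \<union> {c<..}|lborel. L s)"
      by (simp only: superpos_def L_def Un)
    also have "\<dots> = (LINT s:{0<..c}|lborel. L s) + (LINT s:{c<..}|lborel. L s)"
      by (rule set_integral_Un [OF _ int0' [OF c] int1 [OF c]]) auto
    also have "(LINT s:{c<..}|lborel. L s) = superpos {c<..} (wt3 \<kappa> \<nu>) rate3"
      by (simp only: superpos_def L_def)
    also have "(LINT s:{0<..c}|lborel. L s) = (LINT s:{0<..<c}|lborel. L s)"
      unfolding set_lebesgue_integral_def
    proof (rule integral_cong_AE)
      show "AE s in lborel. indicator {0<..c} s *\<^sub>R L s = indicator {0<..<c} s *\<^sub>R L s"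
        using AE_lborel_singleton [of c] by eventually_elim (auto simp: indicator_def)
    qed measurable
    finally have split: "superpos {0<..} (wt3 \<kappa> \<nu>) rate3 = (LINT s:{0<..<c}|lborel. L s) + superpos {c<..} (wt3 \<kappa> \<nu>) rate3" .
    have I3: "norm (LINT s:{0<..<c}|lborel. L s) \<le> C * (c - 0)"
      by (rule norm_set_integral_Ioo_le) (use c C L1 in auto)
    have "diffraction_potential \<kappa> f x - A = of_real c0 * (superpos {0<..<c} (wt1 \<kappa> \<nu>) rate1
        + superpos {0<..<pi/2} (wt2 \<kappa> \<nu> c) (rate2 c) - (LINT s:{0<..<c}|lborel. L s))"
      unfolding A_def split potential_eq(2) [OF c] c0_def by (simp add: algebra_simps)
    also have "norm \<dots> \<le> c0 * (exp (\<kappa>\<^sup>2 * c) * C * (c - 0) + exp (\<kappa>\<^sup>2 * c) * C * c * (pi / 2 - 0) + C * (c - 0))"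
    proof -
      have "norm (superpos {0<..<c} (wt1 \<kappa> \<nu>) rate1 + superpos {0<..<pi/2} (wt2 \<kappa> \<nu> c) (rate2 c) - (LINT s:{0<..<c}|lborel. L s))
        \<le> norm (superpos {0<..<c} (wt1 \<kappa> \<nu>) rate1) + norm (superpos {0<..<pi/2} (wt2 \<kappa> \<nu> c) (rate2 c)) + norm (LINT s:{0<..<c}|lborel. L s)"
        by (meson add_right_mono norm_triangle_ineq norm_triangle_ineq4 order_trans)
      also have "\<dots> \<le> exp (\<kappa>\<^sup>2 * c) * C * (c - 0) + exp (\<kappa>\<^sup>2 * c) * C * c * (pi / 2 - 0) + C * (c - 0)"
        by (intro add_mono I1 I2 I3)
      finally show ?thesis
        unfolding norm_mult by (intro mult_mono) (auto simp: c0_def)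
    qed
    finally show ?thesis by simp
  qed
  have "((\<lambda>c. c0 * (exp (\<kappa>\<^sup>2 * c) * C * c + exp (\<kappa>\<^sup>2 * c) * C * c * (pi / 2) + C * c)) \<longlongrightarrow>
      c0 * (exp (\<kappa>\<^sup>2 * 0) * C * 0 + exp (\<kappa>\<^sup>2 * 0) * C * 0 * (pi / 2) + C * 0)) (at_right 0)"
    by (intro tendsto_intros)
  moreover have "eventually (\<lambda>c. norm (diffraction_potential \<kappa> f x - A) \<le> c0 * (exp (\<kappa>\<^sup>2 * c) * C * c + exp (\<kappa>\<^sup>2 * c) * C * c * (pi / 2) + C * c)) (at_right 0)"
    using eventually_at_right_less [of 0] by eventually_elim (rule bound)
  ultimately have "norm (diffraction_potential \<kappa> f x - A) \<le> c0 * (exp (\<kappa>\<^sup>2 * 0) * C * 0 + exp (\<kappa>\<^sup>2 * 0) * C * 0 * (pi / 2) + C * 0)"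
    by (rule tendsto_lowerbound) simp
  then show ?E by (simp add: A_def)
qed

text \<open>Each coordinate contributes the root R of 4 pi i s, so |R|^n cancels (4 pi s)^(-n/2).
  The phases n pi / 4 of R^n and -pi \<nu> / 2 of \<open>wt3\<close> add up to pi / 2, which is the
  factor i in front of the final integral.\<close>

lemma integrand_eq:
  assumes s: "s > 0"
  shows "of_real ((4 * pi) powr (- \<nu> - 1)) * (wt3 \<kappa> \<nu> s * (\<Prod>j\<in>UNIV. K j (rate3 s)))
    = \<i> * exp (\<i> * of_real (\<kappa>\<^sup>2 * s)) *
      (\<Prod>j\<in>UNIV. Psi M (a j * x $ j) (4 * \<i> * of_real ((a j)\<^sup>2 * s)) (a j * P j)
                     - Psi M (a j * x $ j) (4 * \<i> * of_real ((a j)\<^sup>2 * s)) (a j * Q j))"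
proof -
  define R where "R = csqrt (of_real (4 * pi * s) * \<i>)"
  define d where "d j = Psi M (a j * x $ j) (4 * \<i> * of_real ((a j)\<^sup>2 * s)) (a j * P j)
                     - Psi M (a j * x $ j) (4 * \<i> * of_real ((a j)\<^sup>2 * s)) (a j * Q j)" for j
  have "K j (rate3 s) = R * d j" for j
  proof -
    have "- (rate3 s * of_real ((x $ j - y)\<^sup>2)) = \<i> * of_real ((x $ j - y)\<^sup>2 / (4 * s))" for y
      by (simp add: rate3_def)
    then show ?thesis
      unfolding K_eq_integral R_def d_def
      using integral_unique [OF Psi_diff_eq_integral [OF a [of j] s less_imp_le [OF PQ [of j]], of "x $ j" M]] by simp
  qed
  then have prod: "(\<Prod>j\<in>UNIV. K j (rate3 s)) = R ^ CARD('n) * (\<Prod>j\<in>UNIV. d j)"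
    by (simp add: prod.distrib)
  have "sqrt (4 * pi * s) ^ CARD('n) = (4 * pi * s) powr (real CARD('n) / 2)"
    using s by (simp add: powr_half_sqrt [symmetric] powr_powr flip: powr_realpow)
  also have "\<dots> = (4 * pi) powr (real CARD('n) / 2) * s powr (real CARD('n) / 2)"
    using s by (simp add: powr_mult)
  finally have sq: "(4 * pi) powr (- \<nu> - 1) * (s powr (- \<nu> - 1) * sqrt (4 * pi * s) ^ CARD('n)) = 1"
    unfolding \<nu>(2) using s by (simp add: powr_minus field_simps)
  have "R ^ CARD('n) = of_real (sqrt (4 * pi * s) ^ CARD('n)) * exp (of_nat CARD('n) * (\<i> * of_real (pi / 4)))"
    unfolding R_def using s by (subst csqrt_of_real_times_ii) (auto simp: power_mult_distrib exp_of_nat_mult [symmetric])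
  then have "of_real ((4 * pi) powr (- \<nu> - 1)) * (wt3 \<kappa> \<nu> s * (R ^ CARD('n) * (\<Prod>j\<in>UNIV. d j)))
     = of_real ((4 * pi) powr (- \<nu> - 1) * (s powr (- \<nu> - 1) * sqrt (4 * pi * s) ^ CARD('n)))
       * (exp (- (\<i> * of_real (pi * \<nu> / 2))) * exp (of_nat CARD('n) * (\<i> * of_real (pi / 4)))) * exp (\<i> * of_real (\<kappa>\<^sup>2 * s)) * (\<Prod>j\<in>UNIV. d j)"
    by (simp add: wt3_def mult_ac)
  also have "exp (- (\<i> * of_real (pi * \<nu> / 2))) * exp (of_nat CARD('n) * (\<i> * of_real (pi / 4))) = \<i>"
  proof -
    have e: "- (\<i> * of_real (pi * \<nu> / 2)) + of_nat CARD('n) * (\<i> * of_real (pi / 4)) = \<i> * of_real (pi / 2)"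
      by (simp add: \<nu>_def complex_eq_iff field_simps)
    show ?thesis
      unfolding exp_add [symmetric] e by (simp add: complex_eq_iff Re_exp Im_exp)
  qed
  finally show ?thesis
    unfolding prod sq by (simp add: d_def)
qed

theorem diffraction_potential_has_integral:
  "((\<lambda>t::real. \<i> * exp (\<i> * of_real (\<kappa>\<^sup>2 * t)) *
         (\<Prod>j\<in>UNIV. Psi M (a j * x $ j) (4 * \<i> * of_real ((a j)\<^sup>2 * t)) (a j * P j)
                     - Psi M (a j * x $ j) (4 * \<i> * of_real ((a j)\<^sup>2 * t)) (a j * Q j)))
       has_integral diffraction_potential \<kappa> f x) {0..}"
proof -
  define L where "L s = wt3 \<kappa> \<nu> s * (\<Prod>j\<in>UNIV. K j (rate3 s))" for s
  have "(L has_integral superpos {0<..} (wt3 \<kappa> \<nu>) rate3) {0<..}"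
    using set_borel_integral_eq_integral [OF potential_eq_limit(1)]
    unfolding L_def superpos_def by (simp add: has_integral_integral)
  then have "((\<lambda>s. of_real ((4 * pi) powr (- \<nu> - 1)) * L s) has_integral diffraction_potential \<kappa> f x) {0<..}"
    unfolding potential_eq_limit(2) by (rule has_integral_mult_right)
  then have "((\<lambda>t::real. \<i> * exp (\<i> * of_real (\<kappa>\<^sup>2 * t)) *
         (\<Prod>j\<in>UNIV. Psi M (a j * x $ j) (4 * \<i> * of_real ((a j)\<^sup>2 * t)) (a j * P j)
                     - Psi M (a j * x $ j) (4 * \<i> * of_real ((a j)\<^sup>2 * t)) (a j * Q j)))
       has_integral diffraction_potential \<kappa> f x) {0<..}"
    by (rule has_integral_eq [rotated]) (use integrand_eq in \<open>simp add: L_def\<close>)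
  \<comment> \<open>The end point t = 0 is a null set, so the value given to the integrand there
    does not affect the integral.\<close>
  then show ?thesis
    by (rule has_integral_Ici)
qed

end

theorem theorem3:
  fixes M :: nat and \<kappa> :: real and a P Q :: "'n::finite \<Rightarrow> real"
  assumes "CARD('n) \<ge> 3" and "M \<ge> 1" and "\<kappa> > 0"
    and "\<And>j. a j > 0" and "\<And>j. P j < Q j"
  defines "f \<equiv> (\<lambda>y::real^'n. \<Prod>j\<in>UNIV.
              of_real (indicator {P j<..<Q j} (y $ j)) * eta M (a j * y $ j))"
  shows "\<forall>x::real^'n.
     integrable lborel (\<lambda>y. helmholtz_fund \<kappa> (x - y) * f y) \<and>
     ((\<lambda>t::real. \<i> * exp (\<i> * of_real (\<kappa>\<^sup>2 * t)) *
         (\<Prod>j\<in>UNIV. Psi M (a j * x $ j) (4 * \<i> * of_real ((a j)\<^sup>2 * t)) (a j * P j)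
                     - Psi M (a j * x $ j) (4 * \<i> * of_real ((a j)\<^sup>2 * t)) (a j * Q j)))
       has_integral diffraction_potential \<kappa> f x) {0..}"
proof
  fix x :: "real^'n"
  interpret d: diffraction M \<kappa> a P Q x
    by unfold_locales (use assms(1-5) in blast)+
  have f: "f = d.f"
    unfolding f_def by (rule ext) (simp add: d.f_def d.g_def)
  show "integrable lborel (\<lambda>y. helmholtz_fund \<kappa> (x - y) * f y) \<and>
     ((\<lambda>t::real. \<i> * exp (\<i> * of_real (\<kappa>\<^sup>2 * t)) *
         (\<Prod>j\<in>UNIV. Psi M (a j * x $ j) (4 * \<i> * of_real ((a j)\<^sup>2 * t)) (a j * P j)
                     - Psi M (a j * x $ j) (4 * \<i> * of_real ((a j)\<^sup>2 * t)) (a j * Q j)))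
       has_integral diffraction_potential \<kappa> f x) {0..}"
    \<comment> \<open>Integrability follows from the contour decomposition with any c > 0; c = 1 is
      one choice.\<close>
    unfolding f using d.potential_eq(1) [of 1] d.diffraction_potential_has_integral by simp
qed

end
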